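(* Let $L=M(p_1/q_1,\ldots,p_r/q_r)$ be a Montesinos link, let $\mu=\sum_{\ell=1}^r q_\ell/p_\ell$, and let $N(\mu)$ be the numerator of $\mu$. All notation is as in the context. For a trace-free representation $\rho$ of $L$ let $\rho_\ell$ be its restriction to the rational tangle $[p_\ell/q_\ell]$ and let $(X_\ell,Y_\ell)$ be the generating pair of $\rho_\ell$. Let $s_\ell$ be such that $-\mathrm{tr}(X_\ell Y_\ell)=s_\ell+s_\ell^{-1}$, and let $a$ be such that $-\mathrm{tr}_h(\rho_1)=a+a^{-1}$. Consider the condition $$(\ast)\qquad (-1)^{\widetilde{p_\ell}}s_\ell^{p_\ell}=a,\qquad \ell=1,\ldots,r.$$ Each conjugacy class of trace-free representations of $L$ contains a unique representation $\rho$ such that $X_1=A(1)$, $-\mathrm{tr}_h(\rho_1)=a+a^{-1}$ with $a\in\mathcal F$, and (i) if $\rho$ is abelian, then it is determined by $a\in\{\pm1\}$ and a unique tuple $(s_1,\ldots,s_r)\in\{\pm1\}^r$ satisfying $(\ast)$; (ii) if $\rho$ is reducible but not abelian, then $\mu=0$ and, up to the two choices $Y_1\in\{S_a,S'_a\}$, $\rho$ is determined by $a\in\{\pm1\}$ and a unique tuple $(s_1,\ldots,s_r)\in\{\pm1\}^r$ satisfying $(\ast)$ and $$\prod_{\ell=1}^r(-1)^{\widetilde{q_\ell}-1}s_\ell^{q_\ell}=1;$$ (iii) if $\rho$ is irreducible with $a\in\{\pm1\}$, then $\rho$ is determined by $a$ and a unique tuple $(h;s_1,\ldots,s_r;a_2,b_2,c_2;\ldots;a_r,b_r,c_r)$,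 where $X_\ell=a_\ell A(1)+b_\ell D+c_\ell E$, such that $s_1,\ldots,s_{h-1}\in\{\pm1\}$, $s_h\in\mathcal F-\{\pm1\}$, $$X_{h+1}=(-1)^{\widetilde{q_1}+\cdots+\widetilde{q_h}}\,s_1^{q_1}\cdots s_{h-1}^{q_{h-1}}\,A(s_h^{q_h}),$$ $(\ast)$ holds, and for each $\ell$ (with $(a_1,b_1,c_1)=(a_{r+1},b_{r+1},c_{r+1})=(1,0,0)$) $$a_\ell^2+b_\ell^2+c_\ell^2=1,$$ $$(-1)^{\widetilde{q_\ell}}(s_\ell^{q_\ell}+s_\ell^{-q_\ell})=2(a_\ell a_{\ell+1}+b_\ell b_{\ell+1}+c_\ell c_{\ell+1}),$$ $$(a_{\ell+1},b_{\ell+1},c_{\ell+1})=(-1)^{\widetilde{q_\ell}}s_\ell^{q_\ell}\cdot(a_\ell,b_\ell,c_\ell)\quad\text{if } s_\ell\in\{\pm1\};$$ (iv) if $\mu=0$ and $\rho$ is irreducible with $a\notin\{\pm1\}$, then $Y_1=A(s_1)$, and $\rho$ is determined by $a$ and a unique tuple $(n,n_1,\ldots,n_r)\in\mathbb Z^{r+1}$ satisfying $$0\le n_\ell<p_\ell\ (\ell=1,\ldots,r),\qquad 0\le n<N(\mu),$$ and $$\sum_{\ell=1}^r\frac{2n_\ell q_\ell+1}{p_\ell}=2n+r;$$ (v) if $\mu\ne0$ and $\rho$ is irreducible with $a\notin\{\pm1\}$, then $Y_1=A(s_1)$, $|a|=1$, and $\rho$ is determined by a unique tuple $(n,n_1,\ldots,n_r)\in\mathbb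 Z^{r+1}$ satisfying $$0\le n_\ell<p_\ell\ (\ell=1,\ldots,r),\qquad 0\le n<N(\mu),$$ and $$2n+r-\sum_{\ell=1}^r\frac{2n_\ell q_\ell+1}{p_\ell}\in(2k\mu,(2k+1)\mu)\quad\text{for some }k\in\mathbb Z.$$ In (iv) and (v) the integers $n_\ell$ encode $s_\ell$ as follows: writing $a=|a|e^{i\theta}$, $$s_\ell=|a|^{1/p_\ell}\exp\Big(\frac{i}{p_\ell}(\theta+\widetilde{p_\ell}\pi+2n_\ell\pi)\Big),$$ and in (v) $$\theta=\frac{\pi}{\mu}\Big(2n+r-\sum_{\ell=1}^r\frac{2n_\ell q_\ell+1}{p_\ell}\Big).$$
   Context: **Trace-free representations.** $\mathrm{SL}_0(2,\mathbb C)=\{X\in\mathrm{SL}(2,\mathbb C):\mathrm{tr}(X)=0\}$; each such $X$ satisfies $X^{-1}=-X$. A trace-free representation of a link $L\subset S^3$ is a homomorphism $\pi_1(S^3-L)\to\mathrm{SL}(2,\mathbb C)$ sending each meridian to an element of trace zero. For an unoriented link or tangle diagram $T$, it is given by a map $\rho$ from the set of directed arcs of $T$ to $\mathrm{SL}_0(2,\mathbb C)$ with $\rho(x^{-1})=\rho(x)^{-1}$ (where $x^{-1}$ is $x$ with reversed direction) and $\rho(z)=\rho(x)\rho(y)\rho(x)^{-1}$ at each crossing with over-arc $x$ and under-arcs $y,z$ directed consistently along the under-strand. Conjugacy is by elements of $\mathrm{SL}(2,\mathbb C)$. $\rho$ is reducible if all elements of its image have a common eigenvector, irreducible otherwise,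 and abelian if its image is abelian. **Tangles.** Consider tangles $T$ with four ends nw, ne, sw, se. For a representation $\rho$ of $T$, $\rho^{\rm nw},\rho^{\rm ne},\rho^{\rm sw},\rho^{\rm se}$ are the values on the end arcs directed outwards, and $\mathrm{tr}_h(\rho)=\mathrm{tr}(\rho^{\rm sw}\rho^{\rm se})$. $[1]$ is the single crossing whose over-strand joins nw to se, $[-1]$ the single crossing whose over-strand joins sw to ne. $T_1\ast T_2$ is horizontal composition ($T_1$ left, $T_2$ right) and $T_1\star T_2$ is vertical composition ($T_1$ on top). For $k\ne0$, $[k]$ (resp. $[1/k]$) is the horizontal (resp. vertical) composite of $|k|$ copies of $[1]$ if $k>0$, of $[-1]$ if $k<0$. For integers $k_1,\ldots,k_m$ the rational tangle $[[k_1],\ldots,[k_m]]$ is $[k_1]\star[1/k_2]\ast[k_3]\star\cdots$, composed successively from the left, ending with $\star[1/k_m]$ if $m$ is even and with $\ast[k_m]$ if $m$ is odd. Its fraction is $p/q=[[k_1,\ldots,k_m]]^{(-1)^{m-1}}$, where $[[k_1]]=k_1$ and $[[k_1,\ldots,k_j]]=k_j+1/[[k_1,\ldots,k_{j-1}]]$; the tangle is denoted $[p/q]$, and $p,q\ne0$ is assumed. Define $u_0=0$, $u_1=1$, $u_{j+1}=k_{j+1}u_j+u_{j-1}$ and $v_0=1$, $v_1=k_1$, $v_{j+1}=k_{j+1}v_j+v_{j-1}$ for $j\ge1$. If $m$ is odd, $p=v_m$, $q=v_{m-1}$, $\tilde p=u_m$, $\tilde q=u_{m-1}$; if $m$ is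 even, $q=v_m$, $p=v_{m-1}$, $\tilde q=u_m$, $\tilde p=u_{m-1}$. Thus $\tilde p/\tilde q=[[k_2,\ldots,k_m]]^{(-1)^{m-1}}$ and $\tilde pq-p\tilde q=1$. The generating pair of a representation $\rho$ of this tangle is $(X,Y)$, where $X=\rho^{\rm nw}$ and $Y$ is the value of $\rho$ on the sw end arc of the initial sub-tangle $[k_1]$, directed outwards from it; $\rho$ is determined by $X$ and $Y$. **Montesinos links.** $M(p_1/q_1,\ldots,p_r/q_r)$ is the link obtained from $T=[p_1/q_1]\star\cdots\star[p_r/q_r]$ by connecting the nw and ne ends of $T$ with its sw and se ends, respectively. The integers $\widetilde{p_\ell},\widetilde{q_\ell}$ are $\tilde p,\tilde q$ for the $\ell$-th tangle. The convention $X_{r+1}=X_1$ is used. The numbers $-\mathrm{tr}_h(\rho_\ell)$ have a common value, written $a+a^{-1}$, and equal $(-1)^{\widetilde{p_\ell}}(s_\ell^{p_\ell}+s_\ell^{-p_\ell})$; switching $s_\ell$ with $s_\ell^{-1}$ if necessary one has $(-1)^{\widetilde{p_\ell}}s_\ell^{p_\ell}=a$. **Matrices and sets.** For $c\in\mathbb C\setminus\{0\}$, $$A(c)=\frac12\begin{pmatrix}(c+c^{-1})i & c-c^{-1}\\ c-c^{-1}&-(c+c^{-1})i\end{pmatrix},\quad D=\begin{pmatrix}0&1\\-1&0\end{pmatrix},\quad E=\begin{pmatrix}0&i\\ i&0\end{pmatrix}.$$ For $a\in\{\pm1\}$, $$S_a=\begin{pmatrix}ai&1\\0&-ai\end{pmatrix},\qquad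 S'_a=\begin{pmatrix}ai&0\\1&-ai\end{pmatrix}.$$ Each $X\in\mathrm{SL}_0(2,\mathbb C)$ is uniquely $xA(1)+yD+zE$ with $x^2+y^2+z^2=1$. Finally $\mathcal F=\{e^{i\varphi}:0\le\varphi\le\pi\}\cup\{s\in\mathbb C:|s|<1\}$.
   Formalization: As printed (ii)-(v) fail. Mended: in (ii) Y_1 is S_{s_1} or S'_{s_1}; in (iii) signs use q̃_ℓ-1 for q̃_ℓ and all s_ℓ lie in F; in (iv),(v) the bound 0≤n<N(μ) is dropped, θ is the principal argument of a, 0≤n_ℓ<|p_ℓ|, and interval ends may be in either order. *)

theory Defs
  imports "HOL-Analysis.Analysis"
begin

section \<open>Matrices\<close>

type_synonym cmat = "complex^2^2"

definition mat2 :: "complex \<Rightarrow> complex \<Rightarrow> complex \<Rightarrow> complex \<Rightarrow> cmat" where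
  "mat2 a b c d = vector [vector [a, b], vector [c, d]]"

definition scale_mat :: "complex \<Rightarrow> cmat \<Rightarrow> cmat" (infixr "*\<^sub>m" 75) where
  "c *\<^sub>m M = (\<chi> i j. c * M $ i $ j)"

definition SL0 :: "cmat set" where
  "SL0 = {M. det M = 1 \<and> trace M = 0}"

definition A_mat :: "complex \<Rightarrow> cmat" where
  "A_mat c = (1/2) *\<^sub>m mat2 ((c + inverse c) * \<i>) (c - inverse c) (c - inverse c) (- ((c + inverse c) * \<i>))"

definition D_mat :: cmat where "D_mat = mat2 0 1 (-1) 0"
definition E_mat :: cmat where "E_mat = mat2 0 \<i> \<i> 0"

definition S_mat :: "complex \<Rightarrow> cmat" where "S_mat a = mat2 (a * \<i>) 1 0 (- (a * \<i>))"
definition S'_mat :: "complex \<Rightarrow> cmat" where "S'_mat a = mat2 (a * \<i>) 0 1 (- (a * \<i>))"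

text \<open>The set contains 0, but in every use below 0 is excluded explicitly, because the
  parameter \<open>c\<close> always enters through \<open>c + c\<^sup>-\<^sup>1\<close> and \<open>inverse 0 = 0\<close>.\<close>

definition F_set :: "complex set" where
  "F_set = {exp (\<i> * of_real \<phi>) |\<phi>. 0 \<le> \<phi> \<and> \<phi> \<le> pi} \<union> {s. norm s < 1}"


section \<open>Tangle diagrams\<close>

text \<open>\<open>Pos\<close> is the crossing \<open>[1]\<close> (over-strand from nw to se), \<open>Neg\<close> is \<open>[-1]\<close> (over-strand from
  sw to ne). In \<open>T1 \<ast> T2\<close> the tangle \<open>T1\<close> is on the left, in \<open>T1 \<star> T2\<close> it is on top.\<close>

datatype tangle =
    Pos
  | Neg
  | Hcomp tangle tangle (infixl "\<ast>" 65)
  | Vcomp tangle tangle (infixl "\<star>" 65)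

datatype corner = NW | NE | SW | SE
datatype side = First | Second

text \<open>Every crossing of a composite diagram has an address, the path leading to it. The dart
  \<open>(w, c)\<close> stands for the directed arc that leaves the crossing at address \<open>w\<close> through its corner
  \<open>c\<close>. Several darts may stand for the same directed arc or for an arc and its reverse; the
  conditions in \<open>compatible\<close> below are exactly those making a function on darts descend to a function
  on directed arcs with \<open>\<rho>(x\<^sup>-\<^sup>1) = \<rho>(x)\<^sup>-\<^sup>1\<close> and satisfy the relations at the crossings.\<close>

type_synonym dart = "side list \<times> corner"

definition push :: "side \<Rightarrow> dart \<Rightarrow> dart" where
  "push x d = (x # fst d, snd d)"

primrec darts :: "tangle \<Rightarrow> dart set" where
  "darts Pos = {[]} \<times> UNIV"
| "darts Neg = {[]} \<times> UNIV"
| "darts (T1 \<ast> T2) = push First ` darts T1 \<union> push Second ` darts T2"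
| "darts (T1 \<star> T2) = push First ` darts T1 \<union> push Second ` darts T2"

text \<open>The end arc at a corner of the tangle, directed outwards.\<close>

primrec end_dart :: "tangle \<Rightarrow> corner \<Rightarrow> dart" where
  "end_dart Pos c = ([], c)"
| "end_dart Neg c = ([], c)"
| "end_dart (T1 \<ast> T2) c =
     (if c \<in> {NW, SW} then push First (end_dart T1 c) else push Second (end_dart T2 c))"
| "end_dart (T1 \<star> T2) c =
     (if c \<in> {NW, NE} then push First (end_dart T1 c) else push Second (end_dart T2 c))"

definition restr :: "side list \<Rightarrow> (dart \<Rightarrow> cmat) \<Rightarrow> dart \<Rightarrow> cmat" where
  "restr w \<rho> = (\<lambda>(v, c). \<rho> (w @ v, c))"

text \<open>At \<open>Pos\<close>, the over-arc is directed towards nw, and the under-strand runs from sw to ne, so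
  its incoming arc has the value \<open>matrix_inv (\<rho> ([], SW))\<close>. For trace-free values the relation
  does not depend on the chosen directions of the two strands.\<close>

primrec compatible :: "tangle \<Rightarrow> (dart \<Rightarrow> cmat) \<Rightarrow> bool" where
  "compatible Pos \<rho> \<longleftrightarrow>
     \<rho> ([], SE) = matrix_inv (\<rho> ([], NW)) \<and>
     \<rho> ([], NE) = \<rho> ([], NW) ** matrix_inv (\<rho> ([], SW)) ** matrix_inv (\<rho> ([], NW))"
| "compatible Neg \<rho> \<longleftrightarrow>
     \<rho> ([], NE) = matrix_inv (\<rho> ([], SW)) \<and>
     \<rho> ([], SE) = \<rho> ([], SW) ** matrix_inv (\<rho> ([], NW)) ** matrix_inv (\<rho> ([], SW))"
| "compatible (T1 \<ast> T2) \<rho> \<longleftrightarrow>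
     compatible T1 (restr [First] \<rho>) \<and> compatible T2 (restr [Second] \<rho>) \<and>
     restr [First] \<rho> (end_dart T1 NE) = matrix_inv (restr [Second] \<rho> (end_dart T2 NW)) \<and>
     restr [First] \<rho> (end_dart T1 SE) = matrix_inv (restr [Second] \<rho> (end_dart T2 SW))"
| "compatible (T1 \<star> T2) \<rho> \<longleftrightarrow>
     compatible T1 (restr [First] \<rho>) \<and> compatible T2 (restr [Second] \<rho>) \<and>
     restr [First] \<rho> (end_dart T1 SW) = matrix_inv (restr [Second] \<rho> (end_dart T2 NW)) \<and>
     restr [First] \<rho> (end_dart T1 SE) = matrix_inv (restr [Second] \<rho> (end_dart T2 NE))"

definition tangle_reps :: "tangle \<Rightarrow> (dart \<Rightarrow> cmat) set" where
  "tangle_reps T = {\<rho> \<in> darts T \<rightarrow>\<^sub>E SL0. compatible T \<rho>}"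

text \<open>Trace-free representations of the link obtained from \<open>T\<close> by connecting the nw and ne ends
  with the sw and se ends, respectively.\<close>

definition closure_reps :: "tangle \<Rightarrow> (dart \<Rightarrow> cmat) set" where
  "closure_reps T = {\<rho> \<in> tangle_reps T.
     \<rho> (end_dart T NW) = matrix_inv (\<rho> (end_dart T SW)) \<and>
     \<rho> (end_dart T NE) = matrix_inv (\<rho> (end_dart T SE))}"

definition tr_h :: "tangle \<Rightarrow> (dart \<Rightarrow> cmat) \<Rightarrow> complex" where
  "tr_h T \<rho> = trace (\<rho> (end_dart T SW) ** \<rho> (end_dart T SE))"

definition conjugate_reps :: "tangle \<Rightarrow> (dart \<Rightarrow> cmat) \<Rightarrow> (dart \<Rightarrow> cmat) \<Rightarrow> bool" where
  "conjugate_reps T \<rho> \<rho>' \<longleftrightarrow>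
     (\<exists>P. det P = 1 \<and> (\<forall>d\<in>darts T. \<rho>' d = P ** \<rho> d ** matrix_inv P))"

text \<open>The image of the homomorphism given by \<open>\<rho>\<close>: the group generated by the values on arcs.\<close>

inductive_set rep_image :: "tangle \<Rightarrow> (dart \<Rightarrow> cmat) \<Rightarrow> cmat set"
  for T :: tangle and \<rho> :: "dart \<Rightarrow> cmat" where
  one: "mat 1 \<in> rep_image T \<rho>"
| gen: "d \<in> darts T \<Longrightarrow> \<rho> d \<in> rep_image T \<rho>"
| inv: "M \<in> rep_image T \<rho> \<Longrightarrow> matrix_inv M \<in> rep_image T \<rho>"
| mult: "M \<in> rep_image T \<rho> \<Longrightarrow> N \<in> rep_image T \<rho> \<Longrightarrow> M ** N \<in> rep_image T \<rho>"

definition reducible_rep :: "tangle \<Rightarrow> (dart \<Rightarrow> cmat) \<Rightarrow> bool" where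
  "reducible_rep T \<rho> \<longleftrightarrow> (\<exists>v. v \<noteq> 0 \<and> (\<forall>M\<in>rep_image T \<rho>. \<exists>c. M *v v = c *s v))"

definition abelian_rep :: "tangle \<Rightarrow> (dart \<Rightarrow> cmat) \<Rightarrow> bool" where
  "abelian_rep T \<rho> \<longleftrightarrow> (\<forall>M\<in>rep_image T \<rho>. \<forall>N\<in>rep_image T \<rho>. M ** N = N ** M)"


section \<open>Rational tangles\<close>

text \<open>The tangles \<open>[k]\<close> and \<open>[1/k]\<close>, meaningful only for \<open>k \<noteq> 0\<close>.\<close>

definition int_tangle :: "int \<Rightarrow> tangle" where
  "int_tangle k = (let c = if k > 0 then Pos else Neg in ((\<lambda>T. T \<ast> c) ^^ (nat \<bar>k\<bar> - 1)) c)"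

definition recip_tangle :: "int \<Rightarrow> tangle" where
  "recip_tangle k = (let c = if k > 0 then Pos else Neg in ((\<lambda>T. T \<star> c) ^^ (nat \<bar>k\<bar> - 1)) c)"

fun compose_from :: "bool \<Rightarrow> tangle \<Rightarrow> int list \<Rightarrow> tangle" where
  "compose_from vertical T [] = T"
| "compose_from True T (k # ks) = compose_from False (T \<star> recip_tangle k) ks"
| "compose_from False T (k # ks) = compose_from True (T \<ast> int_tangle k) ks"

text \<open>The list \<open>[k\<^sub>1, \<dots>, k\<^sub>m]\<close> encodes \<open>[[k\<^sub>1], \<dots>, [k\<^sub>m]]\<close>.\<close>

definition rational_tangle :: "int list \<Rightarrow> tangle" where
  "rational_tangle ks = compose_from True (int_tangle (hd ks)) (tl ks)"

text \<open>\<open>ks ! j\<close> is \<open>k\<^bsub>j+1\<^esub>\<close>.\<close>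

fun cf_u :: "int list \<Rightarrow> nat \<Rightarrow> int" where
  "cf_u ks 0 = 0"
| "cf_u ks (Suc 0) = 1"
| "cf_u ks (Suc (Suc j)) = ks ! Suc j * cf_u ks (Suc j) + cf_u ks j"

fun cf_v :: "int list \<Rightarrow> nat \<Rightarrow> int" where
  "cf_v ks 0 = 1"
| "cf_v ks (Suc 0) = ks ! 0"
| "cf_v ks (Suc (Suc j)) = ks ! Suc j * cf_v ks (Suc j) + cf_v ks j"

text \<open>The integers \<open>p\<close>, \<open>q\<close>, \<open>p\<close>-tilde and \<open>q\<close>-tilde.\<close>

definition rat_p :: "int list \<Rightarrow> int" where
  "rat_p ks = (let m = length ks in if odd m then cf_v ks m else cf_v ks (m - 1))"

definition rat_q :: "int list \<Rightarrow> int" where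
  "rat_q ks = (let m = length ks in if odd m then cf_v ks (m - 1) else cf_v ks m)"

definition rat_pt :: "int list \<Rightarrow> int" where
  "rat_pt ks = (let m = length ks in if odd m then cf_u ks m else cf_u ks (m - 1))"

definition rat_qt :: "int list \<Rightarrow> int" where
  "rat_qt ks = (let m = length ks in if odd m then cf_u ks (m - 1) else cf_u ks m)"

definition admissible :: "int list \<Rightarrow> bool" where
  "admissible ks \<longleftrightarrow> ks \<noteq> [] \<and> 0 \<notin> set ks \<and> rat_p ks \<noteq> 0 \<and> rat_q ks \<noteq> 0"

text \<open>The initial sub-tangle \<open>[k\<^sub>1]\<close> is reached by going to the first component \<open>m - 1\<close> times.\<close>

definition gen_X :: "int list \<Rightarrow> (dart \<Rightarrow> cmat) \<Rightarrow> cmat" where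
  "gen_X ks \<rho> = \<rho> (end_dart (rational_tangle ks) NW)"

definition gen_Y :: "int list \<Rightarrow> (dart \<Rightarrow> cmat) \<Rightarrow> cmat" where
  "gen_Y ks \<rho> = restr (replicate (length ks - 1) First) \<rho> (end_dart (int_tangle (hd ks)) SW)"


section \<open>Montesinos links\<close>

text \<open>Throughout, \<open>ks l\<close> is the list of integers defining the \<open>l\<close>-th rational tangle,
  \<open>1 \<le> l \<le> r\<close>.\<close>

definition montesinos_tangle :: "nat \<Rightarrow> (nat \<Rightarrow> int list) \<Rightarrow> tangle" where
  "montesinos_tangle r ks =
     foldl (\<star>) (rational_tangle (ks 1)) (map (\<lambda>l. rational_tangle (ks l)) [2..<Suc r])"

definition montesinos_reps :: "nat \<Rightarrow> (nat \<Rightarrow> int list) \<Rightarrow> (dart \<Rightarrow> cmat) set" where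
  "montesinos_reps r ks = closure_reps (montesinos_tangle r ks)"

definition mu :: "nat \<Rightarrow> (nat \<Rightarrow> int list) \<Rightarrow> real" where
  "mu r ks = (\<Sum>l=1..r. of_int (rat_q (ks l)) / of_int (rat_p (ks l)))"

text \<open>The restriction of \<open>\<rho>\<close> to the \<open>l\<close>-th rational tangle; the composition \<open>\<star>\<close> being nested to the
  left, this tangle is the second component of a first component of \<open>\<dots>\<close> for \<open>l > 1\<close>.\<close>

definition part :: "nat \<Rightarrow> nat \<Rightarrow> (dart \<Rightarrow> cmat) \<Rightarrow> dart \<Rightarrow> cmat" where
  "part r l \<rho> = restr (replicate (r - l) First @ (if l = 1 then [] else [Second])) \<rho>"

text \<open>The convention \<open>X\<^bsub>r+1\<^esub> = X\<^sub>1\<close> is built in.\<close>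

definition mont_X :: "nat \<Rightarrow> (nat \<Rightarrow> int list) \<Rightarrow> (dart \<Rightarrow> cmat) \<Rightarrow> nat \<Rightarrow> cmat" where
  "mont_X r ks \<rho> l = (let l' = if l = r + 1 then 1 else l in gen_X (ks l') (part r l' \<rho>))"

definition mont_Y :: "nat \<Rightarrow> (nat \<Rightarrow> int list) \<Rightarrow> (dart \<Rightarrow> cmat) \<Rightarrow> nat \<Rightarrow> cmat" where
  "mont_Y r ks \<rho> l = gen_Y (ks l) (part r l \<rho>)"

definition mont_abelian :: "nat \<Rightarrow> (nat \<Rightarrow> int list) \<Rightarrow> (dart \<Rightarrow> cmat) \<Rightarrow> bool" where
  "mont_abelian r ks \<rho> \<longleftrightarrow> abelian_rep (montesinos_tangle r ks) \<rho>"

definition mont_reducible :: "nat \<Rightarrow> (nat \<Rightarrow> int list) \<Rightarrow> (dart \<Rightarrow> cmat) \<Rightarrow> bool" where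
  "mont_reducible r ks \<rho> \<longleftrightarrow> reducible_rep (montesinos_tangle r ks) \<rho>"

text \<open>Since \<open>F_set\<close> without 0 contains exactly one of \<open>c\<close>, \<open>c\<^sup>-\<^sup>1\<close> for each nonzero \<open>c\<close>, the number
  \<open>a\<close> is determined by \<open>\<rho>\<close>.\<close>

definition normalized :: "nat \<Rightarrow> (nat \<Rightarrow> int list) \<Rightarrow> (dart \<Rightarrow> cmat) \<Rightarrow> complex \<Rightarrow> bool" where
  "normalized r ks \<rho> a \<longleftrightarrow>
     \<rho> \<in> montesinos_reps r ks \<and> mont_X r ks \<rho> 1 = A_mat 1 \<and> a \<in> F_set \<and> a \<noteq> 0 \<and>
     - tr_h (rational_tangle (ks 1)) (part r 1 \<rho>) = a + inverse a"

text \<open>The numbers \<open>s\<^sub>l\<close> of \<open>\<rho>\<close>, with the condition \<open>(-1)\<^bsup>pt\<^esup> s\<^sub>l\<^sup>p = a\<close> imposed for each \<open>l\<close>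
  (\<open>pt\<close> denoting \<open>p\<close>-tilde). Tuples are functions that are \<open>undefined\<close> outside their index set.\<close>

definition s_values ::
  "nat \<Rightarrow> (nat \<Rightarrow> int list) \<Rightarrow> (dart \<Rightarrow> cmat) \<Rightarrow> complex \<Rightarrow> (nat \<Rightarrow> complex) \<Rightarrow> bool" where
  "s_values r ks \<rho> a s \<longleftrightarrow> s \<in> {1..r} \<rightarrow>\<^sub>E UNIV - {0} \<and>
     (\<forall>l\<in>{1..r}.
        - trace (mont_X r ks \<rho> l ** mont_Y r ks \<rho> l) = s l + inverse (s l) \<and>
        (-1) powi rat_pt (ks l) * s l powi rat_p (ks l) = a)"

text \<open>\<open>t\<close> is the unique tuple encoding \<open>\<rho>\<close>, and \<open>\<rho>\<close> is the only representation it encodes.\<close>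

definition determined_by_unique :: "('r \<Rightarrow> 't \<Rightarrow> bool) \<Rightarrow> 'r \<Rightarrow> bool" where
  "determined_by_unique enc \<rho> \<longleftrightarrow> (\<exists>!t. enc \<rho> t) \<and> (\<forall>t \<rho>'. enc \<rho> t \<and> enc \<rho>' t \<longrightarrow> \<rho>' = \<rho>)"

definition abelian_code ::
  "nat \<Rightarrow> (nat \<Rightarrow> int list) \<Rightarrow> complex \<Rightarrow> (dart \<Rightarrow> cmat) \<Rightarrow> (nat \<Rightarrow> complex) \<Rightarrow> bool" where
  "abelian_code r ks a \<rho> s \<longleftrightarrow>
     normalized r ks \<rho> a \<and> mont_abelian r ks \<rho> \<and>
     s \<in> {1..r} \<rightarrow>\<^sub>E {1, -1} \<and> s_values r ks \<rho> a s"

definition reducible_code ::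
  "nat \<Rightarrow> (nat \<Rightarrow> int list) \<Rightarrow> complex \<Rightarrow> (dart \<Rightarrow> cmat) \<Rightarrow> (nat \<Rightarrow> complex) \<Rightarrow> bool" where
  "reducible_code r ks a \<rho> s \<longleftrightarrow>
     normalized r ks \<rho> a \<and> mont_reducible r ks \<rho> \<and> \<not> mont_abelian r ks \<rho> \<and>
     s \<in> {1..r} \<rightarrow>\<^sub>E {1, -1} \<and> s_values r ks \<rho> a s \<and>
     (\<Prod>l=1..r. (-1) powi (rat_qt (ks l) - 1) * s l powi rat_q (ks l)) = 1"

text \<open>The sign \<open>(-1)\<^bsup>qt-1\<^esup>\<close> (\<open>qt\<close> denoting \<open>q\<close>-tilde) is the one in \<open>reducible_code\<close>: the sw value
  of a rational tangle generated by \<open>(A 1, A s)\<close> is \<open>(-1)\<^bsup>qt\<^esup> A (s\<^sup>q)\<close>, and gluing it to the nw end of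
  the next tangle, where outwards is the opposite direction, gives
  \<open>X\<^bsub>l+1\<^esub> = (-1)\<^bsup>qt-1\<^esup> A (s\<^sup>q)\<close>. Requiring \<open>s\<^sub>l \<in> F\<close> for all \<open>l\<close> selects one of \<open>s\<^sub>l\<close>, \<open>s\<^sub>l\<^sup>-\<^sup>1\<close>.
  The coordinate functions are indexed by \<open>1, \<dots>, r+1\<close>, with fixed values at both ends.\<close>

definition irreducible_code ::
  "nat \<Rightarrow> (nat \<Rightarrow> int list) \<Rightarrow> complex \<Rightarrow> (dart \<Rightarrow> cmat) \<Rightarrow>
     nat \<times> (nat \<Rightarrow> complex) \<times> (nat \<Rightarrow> complex \<times> complex \<times> complex) \<Rightarrow> bool" where
  "irreducible_code r ks a \<rho> = (\<lambda>(h, s, x).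
     normalized r ks \<rho> a \<and> \<not> mont_reducible r ks \<rho> \<and>
     h \<in> {1..r} \<and> s_values r ks \<rho> a s \<and> s \<in> {1..r} \<rightarrow>\<^sub>E F_set \<and>
     (\<forall>l\<in>{1..<h}. s l \<in> {1, -1}) \<and> s h \<notin> {1, -1} \<and>
     mont_X r ks \<rho> (h + 1) =
       ((-1) powi (\<Sum>l=1..h. rat_qt (ks l) - 1) * (\<Prod>l=1..<h. s l powi rat_q (ks l)))
         *\<^sub>m A_mat (s h powi rat_q (ks h)) \<and>
     x \<in> extensional {1..r+1} \<and> x 1 = (1, 0, 0) \<and> x (r + 1) = (1, 0, 0) \<and>
     (\<forall>l\<in>{1..r}. case x l of (a1, b1, c1) \<Rightarrow> case x (l + 1) of (a2, b2, c2) \<Rightarrow>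
        mont_X r ks \<rho> l = a1 *\<^sub>m A_mat 1 + b1 *\<^sub>m D_mat + c1 *\<^sub>m E_mat \<and>
        a1\<^sup>2 + b1\<^sup>2 + c1\<^sup>2 = 1 \<and>
        (-1) powi (rat_qt (ks l) - 1) * (s l powi rat_q (ks l) + s l powi (- rat_q (ks l)))
          = 2 * (a1 * a2 + b1 * b2 + c1 * c2) \<and>
        (s l \<in> {1, -1} \<longrightarrow>
           (let e = (-1) powi (rat_qt (ks l) - 1) * s l powi rat_q (ks l)
            in (a2, b2, c2) = (e * a1, e * b1, e * c1)))))"

text \<open>The argument of \<open>a\<close> is the principal one, which lies in \<open>[0, pi]\<close> if \<open>a \<in> F\<close> and \<open>|a| = 1\<close>.\<close>

definition s_of :: "(nat \<Rightarrow> int list) \<Rightarrow> complex \<Rightarrow> (nat \<Rightarrow> int) \<Rightarrow> nat \<Rightarrow> complex" where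
  "s_of ks a ns l =
     of_real (norm a powr (1 / of_int (rat_p (ks l)))) *
     exp (\<i> / of_int (rat_p (ks l)) *
          of_real (Arg a + of_int (rat_pt (ks l)) * pi + 2 * of_int (ns l) * pi))"

definition angle_sum :: "nat \<Rightarrow> (nat \<Rightarrow> int list) \<Rightarrow> (nat \<Rightarrow> int) \<Rightarrow> real" where
  "angle_sum r ks ns =
     (\<Sum>l=1..r. (2 * of_int (ns l) * of_int (rat_q (ks l)) + 1) / of_int (rat_p (ks l)))"

text \<open>The residue system \<open>{0..<\<bar>p\<bar>}\<close> covers the fractions that are presented with \<open>p < 0\<close>, such
  as \<open>[-3]\<close>.\<close>

definition angle_code ::
  "nat \<Rightarrow> (nat \<Rightarrow> int list) \<Rightarrow> complex \<Rightarrow> (dart \<Rightarrow> cmat) \<Rightarrow> (nat \<Rightarrow> int) \<Rightarrow> bool" where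
  "angle_code r ks a \<rho> ns \<longleftrightarrow>
     normalized r ks \<rho> a \<and> \<not> mont_reducible r ks \<rho> \<and> a \<notin> {1, -1} \<and>
     ns \<in> (\<Pi>\<^sub>E l\<in>{1..r}. {0..<\<bar>rat_p (ks l)\<bar>}) \<and>
     s_values r ks \<rho> a (restrict (s_of ks a ns) {1..r}) \<and>
     mont_Y r ks \<rho> 1 = A_mat (s_of ks a ns 1)"

definition irreducible_code_mu_zero ::
  "nat \<Rightarrow> (nat \<Rightarrow> int list) \<Rightarrow> complex \<Rightarrow> (dart \<Rightarrow> cmat) \<Rightarrow> int \<times> (nat \<Rightarrow> int) \<Rightarrow> bool" where
  "irreducible_code_mu_zero r ks a \<rho> = (\<lambda>(n, ns).
     angle_code r ks a \<rho> ns \<and> angle_sum r ks ns = 2 * of_int n + of_nat r)"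

text \<open>Here \<open>a\<close> is not a parameter: it is recovered from the tuple. The open segment is the open
  interval between its two ends in either order, as \<open>mu\<close> may be negative.\<close>

definition irreducible_code_mu_nonzero ::
  "nat \<Rightarrow> (nat \<Rightarrow> int list) \<Rightarrow> (dart \<Rightarrow> cmat) \<Rightarrow> int \<times> (nat \<Rightarrow> int) \<Rightarrow> bool" where
  "irreducible_code_mu_nonzero r ks \<rho> = (\<lambda>(n, ns).
     (let \<delta> = 2 * of_int n + of_nat r - angle_sum r ks ns in
       (\<exists>k::int. \<delta> \<in> open_segment (2 * of_int k * mu r ks) ((2 * of_int k + 1) * mu r ks)) \<and>
       (\<exists>a. angle_code r ks a \<rho> ns \<and> norm a = 1 \<and> Arg a = pi / mu r ks * \<delta>)))"

end

(*
For trace-free X and Y one has X Y X^-1 = B(X,Y) X - Y with B(X,Y) = -tr(XY). Hence every value of a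
representation of a rational tangle with generating pair (X,Y) is, up to sign, a member of the
sequence W(n) of iterated reflections with W(0) = X, W(1) = Y. This sequence is a combination of X
and Y with Chebyshev coefficients in s, where B(X,Y) = s + 1/s. Sign and index depend only on the
arc; at the corners nw, ne, sw, se the indices are 0, -p, q, q - p. A representation of the
Montesinos link is thus a cyclic chain of pairs (X_l,Y_l), with X_(l+1) and the ne value of the
(l+1)-st tangle determined by the l-th pair.

If a is not 1 or -1, the nw and ne values of the first tangle determine an axis shared by all
tangles, so that X_l = A(c_l) and Y_l = A(c_l s_l), and the chain closes iff the product of the
factors (-1)^(qt-1) s_l^q is 1; moduli and arguments of this equation give the integer conditions.
If a is 1 or -1, then the differences (ne value) - a (nw value) are proportional nilpotent matrices.
If they do not vanish, then all values have a common eigenvector, and the off-diagonal entries add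
up along the chain to a multiple of mu, which must be 0. If they vanish, then Y_l = s_l X_l whenever
s_l is 1 or -1, and the other pairs (X_l,Y_l) are determined by X_l and X_(l+1).

Once X_1 = A(1), the remaining conjugations are by diagonal matrices, and each normal form fixes the
diagonal matrix up to sign.
*)
theory Submission
  imports Defs
begin

section \<open>Trace-free matrices\<close>

definition bil :: "cmat \<Rightarrow> cmat \<Rightarrow> complex" where
  "bil X Y = - trace (X ** Y)"

definition tf :: "complex \<Rightarrow> complex \<Rightarrow> complex \<Rightarrow> cmat" where
  "tf x y z = mat2 (\<i> * x) y z (- (\<i> * x))"

lemma mat2_nth [simp]:
  "mat2 a b c d $ 1 $ 1 = a" "mat2 a b c d $ 1 $ 2 = b"
  "mat2 a b c d $ 2 $ 1 = c" "mat2 a b c d $ 2 $ 2 = d"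
  by (simp_all add: mat2_def)

lemma scale_mat_nth [simp]: "(c *\<^sub>m M) $ i $ j = c * M $ i $ j"
  by (simp add: scale_mat_def)

lemma cmat_eq_iff:
  fixes M N :: cmat
  shows "M = N \<longleftrightarrow> M $ 1 $ 1 = N $ 1 $ 1 \<and> M $ 1 $ 2 = N $ 1 $ 2 \<and> M $ 2 $ 1 = N $ 2 $ 1 \<and> M $ 2 $ 2 = N $ 2 $ 2"
  by (auto simp: vec_eq_iff forall_2)

lemma cmat_mult_nth:
  fixes M N :: cmat
  shows "(M ** N) $ i $ j = M $ i $ 1 * N $ 1 $ j + M $ i $ 2 * N $ 2 $ j"
  by (simp add: matrix_matrix_mult_def sum_2)

lemma mat_nth_2 [simp]:
  "(mat c :: cmat) $ 1 $ 1 = c" "(mat c :: cmat) $ 2 $ 2 = c"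
  "(mat c :: cmat) $ 1 $ 2 = 0" "(mat c :: cmat) $ 2 $ 1 = 0"
  by (simp_all add: mat_def)

lemma trace_2: "trace (M :: cmat) = M $ 1 $ 1 + M $ 2 $ 2"
  by (simp add: trace_def sum_2)

lemmas cmat_simps = cmat_eq_iff cmat_mult_nth trace_2 det_2

lemma tf_nth [simp]:
  "tf x y z $ 1 $ 1 = \<i> * x" "tf x y z $ 1 $ 2 = y" "tf x y z $ 2 $ 1 = z" "tf x y z $ 2 $ 2 = - (\<i> * x)"
  by (simp_all add: tf_def)

lemma i_squared: "\<i> * \<i> = (-1 :: complex)"
  by simp

lemma ii_mult [simp]: "\<i> * (\<i> * x) = - x"
  by (metis complex_i_mult_minus)

lemma tf_in_SL0_iff: "tf x y z \<in> SL0 \<longleftrightarrow> x\<^sup>2 - y * z = 1"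
  by (simp add: SL0_def cmat_simps power2_eq_square algebra_simps)

lemma SL0_obtain_tf:
  assumes "X \<in> SL0"
  obtains x y z where "X = tf x y z" "x\<^sup>2 - y * z = 1"
proof -
  have eq: "X = tf (- \<i> * X $ 1 $ 1) (X $ 1 $ 2) (X $ 2 $ 1)"
    using assms by (simp add: SL0_def cmat_simps eq_neg_iff_add_eq_0 add.commute)
  with assms tf_in_SL0_iff have "(- \<i> * X $ 1 $ 1)\<^sup>2 - X $ 1 $ 2 * X $ 2 $ 1 = 1"
    by metis
  with eq that show thesis by blast
qed

lemma bil_tf [simp]: "bil (tf x y z) (tf x' y' z') = 2 * x * x' - y * z' - z * y'"
  by (simp add: bil_def cmat_simps)

lemma tf_scale [simp]: "c *\<^sub>m tf x y z = tf (c * x) (c * y) (c * z)"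
  by (simp add: cmat_eq_iff)

lemma tf_add [simp]: "tf x y z + tf x' y' z' = tf (x + x') (y + y') (z + z')"
  by (simp add: cmat_eq_iff algebra_simps)

lemma tf_diff [simp]: "tf x y z - tf x' y' z' = tf (x - x') (y - y') (z - z')"
  by (simp add: cmat_eq_iff algebra_simps)

lemma tf_minus [simp]: "- tf x y z = tf (- x) (- y) (- z)"
  by (simp add: cmat_eq_iff)

lemma tf_eq_iff [simp]: "tf x y z = tf x' y' z' \<longleftrightarrow> x = x' \<and> y = y' \<and> z = z'"
  by (auto simp: cmat_eq_iff)

lemma A_mat_tf: "A_mat c = tf ((c + inverse c) / 2) ((c - inverse c) / 2) ((c - inverse c) / 2)"
  by (simp add: A_mat_def cmat_eq_iff)

lemma A_mat_1: "A_mat 1 = tf 1 0 0"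
  by (simp add: A_mat_tf)

lemma D_mat_tf: "D_mat = tf 0 1 (-1)"
  by (simp add: D_mat_def cmat_eq_iff)

lemma E_mat_tf: "E_mat = tf 0 \<i> \<i>"
  by (simp add: E_mat_def cmat_eq_iff)

lemma S_mat_tf: "S_mat a = tf a 1 0" "S'_mat a = tf a 0 1"
  by (simp_all add: S_mat_def S'_mat_def cmat_eq_iff)

lemma A_mat_minus: "A_mat (- c) = - A_mat c"
  unfolding A_mat_tf tf_minus tf_eq_iff by (simp add: field_simps)

lemma A_mat_inj:
  assumes "A_mat c = A_mat d" shows "c = d"
proof -
  have "(c + inverse c) / 2 + (c - inverse c) / 2 = (d + inverse d) / 2 + (d - inverse d) / 2"
    using assms unfolding A_mat_tf tf_eq_iff by argo
  then show ?thesis by (simp add: add_divide_distrib diff_divide_distrib)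
qed

lemma matrix_inv_eqI:
  fixes M N :: cmat
  assumes "M ** N = mat 1"
  shows "matrix_inv M = N"
proof -
  have NM: "N ** M = mat 1"
    using assms matrix_left_right_inverse by blast
  have "M ** matrix_inv M = mat 1 \<and> matrix_inv M ** M = mat 1"
    unfolding matrix_inv_def by (rule someI[of _ N]) (use assms NM in auto)
  then have "N ** (M ** matrix_inv M) = N" by simp
  then show ?thesis
    by (simp add: matrix_mul_assoc NM)
qed

lemma SL0_matrix_inv:
  assumes "X \<in> SL0" shows "matrix_inv X = - X"
proof -
  obtain x y z where X: "X = tf x y z" "x\<^sup>2 - y * z = 1"
    using assms SL0_obtain_tf by blast
  then have "X ** (- X) = mat 1"
    by (simp add: cmat_simps power2_eq_square algebra_simps)
  then show ?thesis by (rule matrix_inv_eqI)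
qed

lemma SL0_uminus: "X \<in> SL0 \<Longrightarrow> - X \<in> SL0"
  by (auto elim!: SL0_obtain_tf simp: tf_in_SL0_iff)

lemma SL0_conj:
  assumes "X \<in> SL0" "Y \<in> SL0"
  shows "X ** Y ** matrix_inv X = bil X Y *\<^sub>m X - Y"
proof -
  obtain x y z where X: "X = tf x y z" "x\<^sup>2 - y * z = 1"
    using assms SL0_obtain_tf by blast
  obtain x' y' z' where Y: "Y = tf x' y' z'"
    using assms SL0_obtain_tf by blast
  have yz: "y * z = x * x - 1"
    using X(2) by (simp add: power2_eq_square algebra_simps)
  have "X ** Y ** (- X) = bil X Y *\<^sub>m X - Y"
    unfolding X(1) Y bil_tf tf_scale tf_diff
    unfolding cmat_simps tf_nth tf_minus
    using yz i_squared by (intro conjI; algebra)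
  with assms show ?thesis by (simp add: SL0_matrix_inv)
qed

lemma bil_self:
  assumes "X \<in> SL0" shows "bil X X = 2"
proof -
  obtain x y z where X: "X = tf x y z" "x\<^sup>2 - y * z = 1"
    using assms SL0_obtain_tf by blast
  have "2 * x * x - y * z - z * y = 2" using X(2) by algebra
  with X(1) show ?thesis by simp
qed

lemma bil_commute: "bil X Y = bil Y X"
  by (simp add: bil_def cmat_simps algebra_simps)

lemma bil_diff_left: "bil (X - Y) Z = bil X Z - bil Y Z"
  and bil_diff_right: "bil Z (X - Y) = bil Z X - bil Z Y"
  and bil_add_left: "bil (X + Y) Z = bil X Z + bil Y Z"
  and bil_add_right: "bil Z (X + Y) = bil Z X + bil Z Y"
  and bil_scale_left: "bil (c *\<^sub>m X) Z = c * bil X Z"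
  and bil_scale_right: "bil Z (c *\<^sub>m X) = c * bil Z X"
  and bil_minus_left: "bil (- X) Z = - bil X Z"
  and bil_minus_right: "bil Z (- X) = - bil Z X"
  by (simp_all add: bil_def cmat_simps algebra_simps)

lemmas bil_linear = bil_diff_left bil_diff_right bil_add_left bil_add_right
  bil_scale_left bil_scale_right bil_minus_left bil_minus_right

section \<open>Chebyshev coefficients and iterated reflections\<close>

definition cheb :: "complex \<Rightarrow> int \<Rightarrow> complex" where
  "cheb s n = (if s = 1 \<or> s = -1 then of_int n * s powi (n - 1)
     else (s powi n - s powi (- n)) / (s - inverse s))"

definition pow_sum :: "complex \<Rightarrow> int \<Rightarrow> complex" where
  "pow_sum s n = s powi n + s powi (- n)"

definition refl_seq :: "complex \<Rightarrow> cmat \<Rightarrow> cmat \<Rightarrow> int \<Rightarrow> cmat" where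
  "refl_seq s X Y n = cheb s n *\<^sub>m Y - cheb s (n - 1) *\<^sub>m X"

lemma inverse_neq_self:
  fixes s :: complex
  assumes "s \<noteq> 1" "s \<noteq> -1" "s \<noteq> 0" shows "s - inverse s \<noteq> 0"
proof
  assume "s - inverse s = 0"
  then have "s * s = 1" using assms(3) by (simp add: field_simps)
  then show False using assms square_eq_1_iff by blast
qed

lemma cheb_0 [simp]: "cheb s 0 = 0"
  by (simp add: cheb_def)

lemma cheb_1 [simp]: "s \<noteq> 0 \<Longrightarrow> cheb s 1 = 1"
  using inverse_neq_self[of s] by (auto simp: cheb_def power_int_minus)

lemma cheb_m1 [simp]: "s \<noteq> 0 \<Longrightarrow> cheb s (-1) = -1"
  using inverse_neq_self[of s] by (auto simp: cheb_def power_int_minus field_simps)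

lemma pow_sum_0 [simp]: "pow_sum s 0 = 2" and pow_sum_1 [simp]: "pow_sum s 1 = s + inverse s"
  by (simp_all add: pow_sum_def power_int_minus)

lemma pow_sum_minus [simp]: "pow_sum s (- n) = pow_sum s n"
  by (simp add: pow_sum_def)

lemma pm1_powi_sq:
  fixes s :: complex
  assumes "s = 1 \<or> s = -1" shows "s powi n * s powi n = 1"
  using assms by auto

lemma pm1_inverse: "(s :: complex) = 1 \<or> s = -1 \<Longrightarrow> inverse (s powi n) = s powi n"
  by (metis inverse_1 inverse_minus_eq power_int_inverse)

lemma cheb_add_diff:
  assumes "s \<noteq> 0"
  shows "cheb s (a + b) + cheb s (a - b) = pow_sum s b * cheb s a"
proof (cases "s = 1 \<or> s = -1")
  case True
  have "s powi (a + b - 1) = s powi b * s powi (a - 1)" "s powi (a - b - 1) = s powi b * s powi (a - 1)"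
    using assms True by (auto simp: power_int_diff power_int_add pm1_inverse field_simps power_int_minus_left)
  moreover have "s powi (-b) = s powi b"
    using True by (simp add: power_int_minus pm1_inverse)
  ultimately show ?thesis
    using True unfolding cheb_def pow_sum_def by (simp add: algebra_simps)
next
  case False
  have 1: "s powi (a + b) = s powi a * s powi b" "s powi (a - b) = s powi a * s powi (- b)"
    "s powi (- (a + b)) = s powi (- a) * s powi (- b)" "s powi (- (a - b)) = s powi (- a) * s powi b"
    using assms by (simp_all add: power_int_diff power_int_add power_int_minus field_simps)
  show ?thesis
    using False inverse_neq_self[of s] assms
    unfolding cheb_def pow_sum_def 1 by (simp add: divide_simps) (simp add: algebra_simps)
qed

lemma refl_seq_add_diff:
  assumes "s \<noteq> 0"
  shows "refl_seq s X Y (a + b) + refl_seq s X Y (a - b) = pow_sum s b *\<^sub>m refl_seq s X Y a"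
proof -
  have "a + b - 1 = (a - 1) + b" "a - b - 1 = (a - 1) - b" by simp_all
  then have 2: "cheb s (a + b - 1) = pow_sum s b * cheb s (a - 1) - cheb s (a - b - 1)"
    using cheb_add_diff[OF assms, of "a - 1" b] by (simp add: algebra_simps)
  have 1: "cheb s (a + b) = pow_sum s b * cheb s a - cheb s (a - b)"
    using cheb_add_diff[OF assms, of a b] by (simp add: algebra_simps)
  show ?thesis
    unfolding refl_seq_def 1 2 by (simp add: cmat_eq_iff algebra_simps)
qed

lemma refl_seq_0: "s \<noteq> 0 \<Longrightarrow> refl_seq s X Y 0 = X"
  and refl_seq_1: "s \<noteq> 0 \<Longrightarrow> refl_seq s X Y 1 = Y"
  by (simp_all add: refl_seq_def cmat_eq_iff)

lemma cheb_cassini: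
  assumes "s \<noteq> 0"
  shows "2 * cheb s m * cheb s n + 2 * cheb s (m - 1) * cheb s (n - 1)
    - (s + inverse s) * (cheb s m * cheb s (n - 1) + cheb s (m - 1) * cheb s n) = pow_sum s (m - n)"
proof (cases "s = 1 \<or> s = -1")
  case True
  have p: "s powi k * s powi k = 1" for k
    using True by (rule pm1_powi_sq)
  define u where "u = s powi m"
  define v where "v = s powi n"
  have uv: "u * u = 1" "v * v = 1" unfolding u_def v_def by (rule p)+
  have ss: "s * s = 1" "inverse s = s" using True by auto
  have e: "s powi (m - 1) = u * s" "s powi (n - 1) = v * s" "s powi (m - 1 - 1) = u" "s powi (n - 1 - 1) = v"
    "s powi (m - n) = u * v" "s powi (- (m - n)) = u * v"
    using assms True uv by (auto simp: u_def v_def power_int_diff power_int_minus pm1_inverse divide_inverse)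
  have "(s * u) * (s * v) = u * v" using ss by (simp add: mult.assoc mult.left_commute)
  then show ?thesis
    using True unfolding cheb_def pow_sum_def e ss(2)
    by (simp add: algebra_simps) (use ss in algebra)
next
  case False
  define u where "u = s powi m"
  define v where "v = s powi n"
  have uv: "u \<noteq> 0" "v \<noteq> 0" using assms by (simp_all add: u_def v_def)
  define i where "i = inverse s"
  define ui where "ui = inverse u"
  define vi where "vi = inverse v"
  have inv: "s * i = 1" "u * ui = 1" "v * vi = 1" using assms uv by (simp_all add: i_def ui_def vi_def)
  have e: "s powi m = u" "s powi n = v" "s powi (m - 1) = u * i" "s powi (n - 1) = v * i"
    "s powi (- m) = ui" "s powi (- n) = vi" "s powi (- (m - 1)) = ui * s" "s powi (- (n - 1)) = vi * s"
    "s powi (m - n) = u * vi" "s powi (- (m - n)) = v * ui"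
    using assms by (simp_all add: u_def v_def i_def ui_def vi_def power_int_diff power_int_minus field_simps)
  have d: "s - i \<noteq> 0" using inverse_neq_self[of s] assms False by (simp add: i_def)
  have "2 * (u - ui) * (v - vi) + 2 * (u * i - ui * s) * (v * i - vi * s)
    - (s + i) * ((u - ui) * (v * i - vi * s) + (u * i - ui * s) * (v - vi)) = (u * vi + v * ui) * (s - i)\<^sup>2"
    using inv by algebra
  then show ?thesis
    using False d unfolding cheb_def pow_sum_def e i_def[symmetric]
    by (simp add: divide_simps power2_eq_square)
qed

lemma bil_refl_seq:
  assumes "s \<noteq> 0" "X \<in> SL0" "Y \<in> SL0" "bil X Y = s + inverse s"
  shows "bil (refl_seq s X Y m) (refl_seq s X Y n) = pow_sum s (m - n)"
proof -
  have "bil (refl_seq s X Y m) (refl_seq s X Y n) =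
    cheb s m * cheb s n * bil Y Y + cheb s (m - 1) * cheb s (n - 1) * bil X X
     - (cheb s m * cheb s (n - 1) + cheb s (m - 1) * cheb s n) * bil X Y"
    unfolding refl_seq_def by (simp add: bil_linear bil_commute[of Y X] algebra_simps)
  with assms show ?thesis
    using cheb_cassini[OF assms(1), of m n] by (simp add: bil_self algebra_simps)
qed

lemma int_two_step_induct:
  fixes P :: "int \<Rightarrow> bool"
  assumes "P 0" "P 1" "\<And>n. P n \<Longrightarrow> P (n - 1) \<Longrightarrow> P (n + 1)" "\<And>n. P n \<Longrightarrow> P (n + 1) \<Longrightarrow> P (n - 1)"
  shows "P n"
proof -
  have "P n \<and> P (n + 1)"
  proof (induction n rule: int_induct[where k = 0])
    case base
    show ?case using assms(1,2) by simp
  next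
    case (step1 i)
    show ?case using assms(3)[of "i + 1"] step1 by simp
  next
    case (step2 i)
    show ?case using assms(4)[of i] step2 by simp
  qed
  then show ?thesis ..
qed

lemma refl_seq_eqI:
  assumes "s \<noteq> 0" "f 0 = X" "f 1 = Y"
    and "\<And>n. f (n + 1) + f (n - 1) = (s + inverse s) *\<^sub>m f n"
  shows "f n = refl_seq s X Y n"
proof (induction n rule: int_two_step_induct)
  have rec: "refl_seq s X Y (n + 1) + refl_seq s X Y (n - 1) = (s + inverse s) *\<^sub>m refl_seq s X Y n" for n
    using refl_seq_add_diff[OF assms(1), of X Y n 1] by simp
  {
    case 1
    show ?case using assms by (simp add: refl_seq_0)
  next
    case 2
    show ?case using assms by (simp add: refl_seq_1)
  next
    case (3 n)
    with assms(4)[of n] rec[of n] show ?case by (metis add_right_cancel)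
  next
    case (4 n)
    with assms(4)[of n] rec[of n] show ?case by (metis add_left_cancel)
  }
qed

lemma refl_seq_reparam:
  assumes "s \<noteq> 0" "e = 1 \<or> e = -1" "d = 1 \<or> d = -1"
  shows "refl_seq (e * s powi b) (d *\<^sub>m refl_seq s X Y a) ((d * e) *\<^sub>m refl_seq s X Y (a + b)) n
     = (d * e powi n) *\<^sub>m refl_seq s X Y (a + b * n)"
proof -
  have ii: "inverse (e * s powi b) = e * s powi (- b)"
    using assms by (auto simp: power_int_minus)
  have e2: "e powi (n + 1) = e * e powi n" "e powi (n - 1) = e * e powi n" for n
    using assms(2) by (auto simp: power_int_add power_int_diff)
  have "(d * e powi (n + 1)) *\<^sub>m refl_seq s X Y (a + b * (n + 1)) +
      (d * e powi (n - 1)) *\<^sub>m refl_seq s X Y (a + b * (n - 1)) =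
      (e * s powi b + inverse (e * s powi b)) *\<^sub>m ((d * e powi n) *\<^sub>m refl_seq s X Y (a + b * n))" for n
  proof -
    have ix: "a + b * (n + 1) = a + b * n + b" "a + b * (n - 1) = a + b * n - b"
      by (simp_all add: algebra_simps)
    have r: "refl_seq s X Y (a + b * n + b)
        = pow_sum s b *\<^sub>m refl_seq s X Y (a + b * n) - refl_seq s X Y (a + b * n - b)"
      using refl_seq_add_diff[OF assms(1), of X Y "a + b * n" b] by (simp add: eq_diff_eq)
    show ?thesis
      unfolding ii e2 ix r by (simp add: cmat_eq_iff pow_sum_def algebra_simps)
  qed
  then show ?thesis
    using assms by (intro refl_seq_eqI[symmetric]) auto
qed

section \<open>Representations of tangles\<close>

definition trep :: "tangle \<Rightarrow> (dart \<Rightarrow> cmat) \<Rightarrow> bool" where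
  "trep T \<rho> \<longleftrightarrow> (\<forall>d\<in>darts T. \<rho> d \<in> SL0) \<and> compatible T \<rho>"

lemma restr_Nil [simp]: "restr [] \<rho> = \<rho>"
  by (auto simp: restr_def)

lemma restr_append: "restr (v @ w) \<rho> = restr w (restr v \<rho>)"
  by (auto simp: restr_def)

lemma restr_single: "restr [x] \<rho> d = \<rho> (push x d)"
  by (simp add: restr_def push_def case_prod_unfold)

lemma restr_apply: "restr w \<rho> d = \<rho> (w @ fst d, snd d)"
  by (simp add: restr_def case_prod_unfold)

lemma end_dart_in [simp]: "end_dart T c \<in> darts T"
  by (induction T arbitrary: c) auto

lemma trep_SL0: "trep T \<rho> \<Longrightarrow> d \<in> darts T \<Longrightarrow> \<rho> d \<in> SL0"
  by (simp add: trep_def)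

lemma eq_matrix_inv_end_dart:
  assumes "\<forall>d\<in>darts T. f d \<in> SL0"
  shows "(N = matrix_inv (f (end_dart T c))) = (f (end_dart T c) = - N)"
  using SL0_matrix_inv[of "f (end_dart T c)"] assms by auto

lemma trep_Hcomp:
  "trep (T1 \<ast> T2) \<rho> \<longleftrightarrow> trep T1 (restr [First] \<rho>) \<and> trep T2 (restr [Second] \<rho>) \<and>
    restr [Second] \<rho> (end_dart T2 NW) = - restr [First] \<rho> (end_dart T1 NE) \<and>
    restr [Second] \<rho> (end_dart T2 SW) = - restr [First] \<rho> (end_dart T1 SE)"
  (is "?L \<longleftrightarrow> ?R")
proof -
  have "?L \<longleftrightarrow> (\<forall>d\<in>darts T1. restr [First] \<rho> d \<in> SL0) \<and> (\<forall>d\<in>darts T2. restr [Second] \<rho> d \<in> SL0)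
      \<and> compatible (T1 \<ast> T2) \<rho>"
    by (auto simp: trep_def restr_single)
  also have "\<dots> \<longleftrightarrow> ?R"
    unfolding trep_def by (cases "\<forall>d\<in>darts T2. restr [Second] \<rho> d \<in> SL0")
      (auto simp only: eq_matrix_inv_end_dart compatible.simps)
  finally show ?thesis .
qed

lemma trep_Vcomp:
  "trep (T1 \<star> T2) \<rho> \<longleftrightarrow> trep T1 (restr [First] \<rho>) \<and> trep T2 (restr [Second] \<rho>) \<and>
    restr [Second] \<rho> (end_dart T2 NW) = - restr [First] \<rho> (end_dart T1 SW) \<and>
    restr [Second] \<rho> (end_dart T2 NE) = - restr [First] \<rho> (end_dart T1 SE)"
  (is "?L \<longleftrightarrow> ?R")
proof -
  have "?L \<longleftrightarrow> (\<forall>d\<in>darts T1. restr [First] \<rho> d \<in> SL0) \<and> (\<forall>d\<in>darts T2. restr [Second] \<rho> d \<in> SL0)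
      \<and> compatible (T1 \<star> T2) \<rho>"
    by (auto simp: trep_def restr_single)
  also have "\<dots> \<longleftrightarrow> ?R"
    unfolding trep_def by (cases "\<forall>d\<in>darts T2. restr [Second] \<rho> d \<in> SL0")
      (auto simp only: eq_matrix_inv_end_dart compatible.simps)
  finally show ?thesis .
qed

text \<open>The quantifier over \<open>\<rho>\<close> is inside: sign and index depend only on the position \<open>d\<close>.\<close>

definition dart_value :: "tangle \<Rightarrow> dart \<Rightarrow> dart \<Rightarrow> dart \<Rightarrow> complex \<Rightarrow> int \<Rightarrow> bool" where
  "dart_value T dX dY d e n \<longleftrightarrow> (e = 1 \<or> e = -1) \<and>
     (\<forall>\<rho> s. trep T \<rho> \<and> s \<noteq> 0 \<and> bil (\<rho> dX) (\<rho> dY) = s + inverse s \<longrightarrow>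
       \<rho> d = e *\<^sub>m refl_seq s (\<rho> dX) (\<rho> dY) n)"

lemma dart_valueD:
  assumes "dart_value T dX dY d e n" "trep T \<rho>" "s \<noteq> 0" "bil (\<rho> dX) (\<rho> dY) = s + inverse s"
  shows "\<rho> d = e *\<^sub>m refl_seq s (\<rho> dX) (\<rho> dY) n"
  using assms by (auto simp: dart_value_def)

lemma dart_value_sign: "dart_value T dX dY d e n \<Longrightarrow> e = 1 \<or> e = -1"
  by (simp add: dart_value_def)

lemma dart_value_X: "dart_value T dX dY dX 1 0"
  and dart_value_Y: "dart_value T dX dY dY 1 1"
  by (auto simp: dart_value_def refl_seq_0 refl_seq_1 cmat_eq_iff)

lemma refl_seq_shift:
  assumes "dart_value S dX dY d e n" "trep S \<rho>" "e1 = 1 \<or> e1 = -1" "e2 = 1 \<or> e2 = -1"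
    and "\<rho> dX = - (e1 *\<^sub>m refl_seq s X Y n1)" "\<rho> dY = - (e2 *\<^sub>m refl_seq s X Y n2)"
    and "X \<in> SL0" "Y \<in> SL0" "s \<noteq> 0" "bil X Y = s + inverse s"
  shows "\<rho> d = (- e * e1 * (e1 * e2) powi n) *\<^sub>m refl_seq s X Y (n1 + (n2 - n1) * n)"
proof -
  define s' where "s' = (e1 * e2) * s powi (n2 - n1)"
  have s': "s' \<noteq> 0" using assms by (auto simp: s'_def)
  have e12: "e1 * e2 = 1 \<or> e1 * e2 = -1" using assms by auto
  have "inverse (e1 * e2) = e1 * e2"
    using e12 by (metis inverse_1 inverse_minus_eq)
  then have "inverse s' = (e1 * e2) * s powi (- (n2 - n1))"
    by (simp only: s'_def inverse_mult_distrib[of "e1 * e2"] power_int_minus)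
  then have "bil (\<rho> dX) (\<rho> dY) = s' + inverse s'"
    unfolding assms(5,6) using bil_refl_seq[OF assms(9,7,8,10), of n1 n2]
    by (simp add: bil_linear s'_def pow_sum_def algebra_simps)
  then have *: "\<rho> d = e *\<^sub>m refl_seq s' (\<rho> dX) (\<rho> dY) n"
    using assms(1,2) s' by (intro dart_valueD)
  have X': "\<rho> dX = (- e1) *\<^sub>m refl_seq s X Y n1"
    using assms(5) by (simp add: cmat_eq_iff)
  have Y': "\<rho> dY = (- e1 * (e1 * e2)) *\<^sub>m refl_seq s X Y (n1 + (n2 - n1))"
    using assms(3,6) by (auto simp add: cmat_eq_iff)
  have "refl_seq s' (\<rho> dX) (\<rho> dY) n = (- e1 * (e1 * e2) powi n) *\<^sub>m refl_seq s X Y (n1 + (n2 - n1) * n)"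
    unfolding X' Y' s'_def by (rule refl_seq_reparam) (use assms e12 in auto)
  with * show ?thesis by (simp add: cmat_eq_iff)
qed

lemma sign_mult_powi:
  fixes e e1 e2 :: complex
  assumes "e = 1 \<or> e = -1" "e1 = 1 \<or> e1 = -1" "e2 = 1 \<or> e2 = -1"
  shows "- e * e1 * (e1 * e2) powi n = 1 \<or> - e * e1 * (e1 * e2) powi n = -1"
proof -
  have "(-1 :: complex) powi n = 1 \<or> (-1 :: complex) powi n = -1"
    by (cases "even n") auto
  with assms show ?thesis by auto
qed

text \<open>Horizontal and vertical composition are mirror images of each other in the diagonal through nw and
  se, which interchanges the corners sw and ne.\<close>

definition composition :: "(tangle \<Rightarrow> tangle \<Rightarrow> tangle) \<Rightarrow> corner \<Rightarrow> corner \<Rightarrow> bool" where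
  "composition cmp A B \<longleftrightarrow> cmp = Hcomp \<and> A = SW \<and> B = NE \<or> cmp = Vcomp \<and> A = NE \<and> B = SW"

lemma compositionD:
  assumes "composition cmp A B"
  shows "darts (cmp T S) = push First ` darts T \<union> push Second ` darts S"
    "end_dart (cmp T S) NW = push First (end_dart T NW)" "end_dart (cmp T S) A = push First (end_dart T A)"
    "end_dart (cmp T S) B = push Second (end_dart S B)" "end_dart (cmp T S) SE = push Second (end_dart S SE)"
    "trep (cmp T S) \<rho> \<longleftrightarrow> trep T (restr [First] \<rho>) \<and> trep S (restr [Second] \<rho>) \<and>
       restr [Second] \<rho> (end_dart S NW) = - restr [First] \<rho> (end_dart T B) \<and>
       restr [Second] \<rho> (end_dart S A) = - restr [First] \<rho> (end_dart T SE)"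
  using assms trep_Hcomp trep_Vcomp by (auto simp: composition_def)

lemma dart_value_First:
  assumes "composition cmp A B" "dart_value T dX dY d e n"
  shows "dart_value (cmp T S) (push First dX) (push First dY) (push First d) e n"
  using assms(2) unfolding dart_value_def by (auto simp: compositionD(6)[OF assms(1)] simp flip: restr_single)

lemma dart_value_Second:
  assumes "composition cmp A B"
    and "dart_value T dX dY (end_dart T B) e1 n1" "dart_value T dX dY (end_dart T SE) e2 n2"
    and "dart_value S (end_dart S NW) (end_dart S A) d e n" and "dX \<in> darts T" "dY \<in> darts T"
  shows "dart_value (cmp T S) (push First dX) (push First dY) (push Second d)
     (- e * e1 * (e1 * e2) powi n) (n1 + (n2 - n1) * n)"
  unfolding dart_value_def
proof (intro conjI allI impI)
  have e: "e = 1 \<or> e = -1" "e1 = 1 \<or> e1 = -1" "e2 = 1 \<or> e2 = -1"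
    using assms dart_value_sign by blast+
  then show "- e * e1 * (e1 * e2) powi n = 1 \<or> - e * e1 * (e1 * e2) powi n = -1"
    by (rule sign_mult_powi)
  fix \<rho> s assume *: "trep (cmp T S) \<rho> \<and> s \<noteq> 0 \<and> bil (\<rho> (push First dX)) (\<rho> (push First dY)) = s + inverse s"
  let ?\<rho> = "restr [First] \<rho>"
  note glue = compositionD(6)[OF assms(1)]
  have 1: "trep T ?\<rho>" "s \<noteq> 0" "bil (?\<rho> dX) (?\<rho> dY) = s + inverse s"
    using * by (auto simp: restr_single glue)
  have "restr [Second] \<rho> d = (- e * e1 * (e1 * e2) powi n) *\<^sub>m refl_seq s (?\<rho> dX) (?\<rho> dY) (n1 + (n2 - n1) * n)"
    using e dart_valueD[OF assms(2) 1] dart_valueD[OF assms(3) 1] 1 assms(5,6) *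
    by (intro refl_seq_shift[OF assms(4)]) (auto simp: glue intro: trep_SL0)
  then show "\<rho> (push Second d) = (- e * e1 * (e1 * e2) powi n) *\<^sub>m
      refl_seq s (\<rho> (push First dX)) (\<rho> (push First dY)) (n1 + (n2 - n1) * n)"
    by (simp add: restr_single)
qed

definition generated_by :: "tangle \<Rightarrow> dart \<Rightarrow> dart \<Rightarrow> bool" where
  "generated_by T dX dY \<longleftrightarrow> dX \<in> darts T \<and> dY \<in> darts T \<and> (\<forall>d\<in>darts T. \<exists>e n. dart_value T dX dY d e n)"

lemma generated_by_composition:
  assumes "composition cmp A B" "generated_by T dX dY" "generated_by S (end_dart S NW) (end_dart S A)"
  shows "generated_by (cmp T S) (push First dX) (push First dY)"
  unfolding generated_by_def
proof (intro conjI ballI)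
  note D = compositionD(1)[OF assms(1), of T S]
  have d: "dX \<in> darts T" "dY \<in> darts T" using assms by (auto simp: generated_by_def)
  then show "push First dX \<in> darts (cmp T S)" "push First dY \<in> darts (cmp T S)" by (auto simp: D)
  obtain e1 n1 e2 n2 where ends:
    "dart_value T dX dY (end_dart T B) e1 n1" "dart_value T dX dY (end_dart T SE) e2 n2"
    using assms(2) end_dart_in unfolding generated_by_def by meson
  fix d' assume "d' \<in> darts (cmp T S)"
  then consider d where "d' = push First d" "d \<in> darts T" | d where "d' = push Second d" "d \<in> darts S"
    by (auto simp: D)
  then show "\<exists>e n. dart_value (cmp T S) (push First dX) (push First dY) d' e n"
  proof cases
    case 1
    then show ?thesis
      using assms(2) dart_value_First[OF assms(1)] unfolding generated_by_def by meson
  next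
    case 2
    then show ?thesis
      using assms(3) dart_value_Second[OF assms(1) ends _ d] unfolding generated_by_def by meson
  qed
qed

lemma refl_seq_2:
  assumes "s \<noteq> 0"
  shows "refl_seq s X Y 2 = (s + inverse s) *\<^sub>m Y - X"
  using refl_seq_add_diff[OF assms, of X Y 1 1] assms
  by (simp add: refl_seq_0 refl_seq_1 eq_diff_eq)

lemma refl_seq_m1:
  assumes "s \<noteq> 0"
  shows "refl_seq s X Y (-1) = (s + inverse s) *\<^sub>m X - Y"
  using refl_seq_add_diff[OF assms, of X Y 0 1] assms
  by (simp add: refl_seq_0 refl_seq_1 eq_diff_eq add.commute)

lemma crossing_inv:
  assumes "X \<in> SL0" "Y \<in> SL0"
  shows "X ** matrix_inv Y ** matrix_inv X = - (bil X Y *\<^sub>m X - Y)"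
  unfolding SL0_matrix_inv[OF assms(2)] SL0_conj[OF assms(1) SL0_uminus[OF assms(2)]]
  by (simp add: bil_linear cmat_eq_iff)

lemma trep_Pos_iff: "trep Pos \<rho> \<longleftrightarrow> (\<forall>c. \<rho> ([], c) \<in> SL0) \<and> \<rho> ([], SE) = - \<rho> ([], NW) \<and>
    \<rho> ([], NE) = - (bil (\<rho> ([], NW)) (\<rho> ([], SW)) *\<^sub>m \<rho> ([], NW) - \<rho> ([], SW))"
  using crossing_inv[of "\<rho> ([], NW)" "\<rho> ([], SW)"] SL0_matrix_inv[of "\<rho> ([], NW)"]
  by (auto simp: trep_def)

lemma trep_Neg_iff: "trep Neg \<rho> \<longleftrightarrow> (\<forall>c. \<rho> ([], c) \<in> SL0) \<and> \<rho> ([], NE) = - \<rho> ([], SW) \<and>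
    \<rho> ([], SE) = - (bil (\<rho> ([], NW)) (\<rho> ([], SW)) *\<^sub>m \<rho> ([], SW) - \<rho> ([], NW))"
  using crossing_inv[of "\<rho> ([], SW)" "\<rho> ([], NW)"] SL0_matrix_inv[of "\<rho> ([], SW)"]
  by (auto simp: trep_def bil_commute)

lemma trep_Pos:
  assumes "trep Pos \<rho>"
  shows "\<rho> ([], SE) = - \<rho> ([], NW)"
    "\<rho> ([], NE) = - (bil (\<rho> ([], NW)) (\<rho> ([], SW)) *\<^sub>m \<rho> ([], NW) - \<rho> ([], SW))"
    "\<rho> ([], SW) = - (bil (\<rho> ([], NW)) (\<rho> ([], NE)) *\<^sub>m \<rho> ([], NW) - \<rho> ([], NE))"
proof -
  note P = assms[unfolded trep_Pos_iff]
  show "\<rho> ([], SE) = - \<rho> ([], NW)"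
    and ne: "\<rho> ([], NE) = - (bil (\<rho> ([], NW)) (\<rho> ([], SW)) *\<^sub>m \<rho> ([], NW) - \<rho> ([], SW))"
    using P by blast+
  show "\<rho> ([], SW) = - (bil (\<rho> ([], NW)) (\<rho> ([], NE)) *\<^sub>m \<rho> ([], NW) - \<rho> ([], NE))"
    unfolding ne using P by (simp add: bil_linear bil_self cmat_eq_iff algebra_simps)
qed

lemma trep_Neg:
  assumes "trep Neg \<rho>"
  shows "\<rho> ([], NE) = - \<rho> ([], SW)"
    "\<rho> ([], SE) = - (bil (\<rho> ([], NW)) (\<rho> ([], SW)) *\<^sub>m \<rho> ([], SW) - \<rho> ([], NW))"
    "\<rho> ([], SE) = - (bil (\<rho> ([], NW)) (\<rho> ([], NE)) *\<^sub>m \<rho> ([], NE) - \<rho> ([], NW))"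
proof -
  show ne: "\<rho> ([], NE) = - \<rho> ([], SW)"
    and se: "\<rho> ([], SE) = - (bil (\<rho> ([], NW)) (\<rho> ([], SW)) *\<^sub>m \<rho> ([], SW) - \<rho> ([], NW))"
    using assms[unfolded trep_Neg_iff] by blast+
  show "\<rho> ([], SE) = - (bil (\<rho> ([], NW)) (\<rho> ([], NE)) *\<^sub>m \<rho> ([], NE) - \<rho> ([], NW))"
    unfolding ne se by (simp add: bil_linear cmat_eq_iff)
qed

definition crossing :: "int \<Rightarrow> tangle" where
  "crossing k = (if k > 0 then Pos else Neg)"

lemma scale_1 [simp]: "1 *\<^sub>m X = X" and scale_m1 [simp]: "(-1) *\<^sub>m X = - X"
  by (simp_all add: cmat_eq_iff)

lemma crossing_values:
  assumes "composition cmp A B"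
  shows "generated_by (crossing k) ([], NW) ([], A)"
    "dart_value (crossing k) ([], NW) ([], A) ([], B) (-1) (if k > 0 then -1 else 1)"
    "dart_value (crossing k) ([], NW) ([], A) ([], SE) (-1) (if k > 0 then 0 else 2)"
proof -
  have sw: "\<rho> ([], SW) = - \<rho> ([], NE)" if "trep Neg \<rho>" for \<rho>
    using trep_Neg(1)[OF that] by simp
  have 1: "dart_value (crossing k) ([], NW) ([], SW) ([], NE) (-1) (if k > 0 then -1 else 1)"
    "dart_value (crossing k) ([], NW) ([], SW) ([], SE) (-1) (if k > 0 then 0 else 2)"
    unfolding dart_value_def crossing_def
    by (auto simp: refl_seq_0 refl_seq_1 refl_seq_2 refl_seq_m1 trep_Pos(1,2) trep_Neg(1,2))
  have 2: "dart_value (crossing k) ([], NW) ([], NE) ([], SW) (-1) (if k > 0 then -1 else 1)"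
    "dart_value (crossing k) ([], NW) ([], NE) ([], SE) (-1) (if k > 0 then 0 else 2)"
    unfolding dart_value_def crossing_def
    by (auto simp: refl_seq_0 refl_seq_1 refl_seq_2 refl_seq_m1 sw trep_Pos(1)
      dest: trep_Pos(3) trep_Neg(3))
  have "\<exists>e n. dart_value (crossing k) ([], NW) ([], A) ([], c) e n" for c
    using assms 1 2 dart_value_X dart_value_Y unfolding composition_def by (cases c) blast+
  then show "generated_by (crossing k) ([], NW) ([], A)"
    by (auto simp: generated_by_def crossing_def)
  show "dart_value (crossing k) ([], NW) ([], A) ([], B) (-1) (if k > 0 then -1 else 1)"
    "dart_value (crossing k) ([], NW) ([], A) ([], SE) (-1) (if k > 0 then 0 else 2)"
    using assms 1 2 unfolding composition_def by blast+
qed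

lemma end_dart_crossing [simp]: "end_dart (crossing k) c = ([], c)"
  by (simp add: crossing_def)

lemma iterated_crossing_values:
  fixes k :: int
  assumes "composition cmp A B" "k \<noteq> 0"
  defines "T \<equiv> ((\<lambda>T. cmp T (crossing k)) ^^ (nat \<bar>k\<bar> - 1)) (crossing k)"
  shows "generated_by T (end_dart T NW) (end_dart T A)"
    "dart_value T (end_dart T NW) (end_dart T A) (end_dart T B) (-1) (- k)"
    "dart_value T (end_dart T NW) (end_dart T A) (end_dart T SE) (-1) (1 - k)"
proof -
  let ?T = "\<lambda>m. ((\<lambda>T. cmp T (crossing k)) ^^ m) (crossing k)"
  let ?j = "\<lambda>m. (if k > 0 then 1 else -1) * (int m + 1)"
  note cmp = compositionD[OF assms(1)] and cross = crossing_values[OF assms(1), of k]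
  have "generated_by (?T m) (end_dart (?T m) NW) (end_dart (?T m) A) \<and>
    dart_value (?T m) (end_dart (?T m) NW) (end_dart (?T m) A) (end_dart (?T m) B) (-1) (- ?j m) \<and>
    dart_value (?T m) (end_dart (?T m) NW) (end_dart (?T m) A) (end_dart (?T m) SE) (-1) (1 - ?j m)" for m
  proof (induction m)
    case 0
    then show ?case using cross by auto
  next
    case (Suc m)
    have IH: "generated_by (?T m) (end_dart (?T m) NW) (end_dart (?T m) A)"
      "dart_value (?T m) (end_dart (?T m) NW) (end_dart (?T m) A) (end_dart (?T m) B) (-1) (- ?j m)"
      "dart_value (?T m) (end_dart (?T m) NW) (end_dart (?T m) A) (end_dart (?T m) SE) (-1) (1 - ?j m)"
      using Suc by auto
    have "generated_by (cmp (?T m) (crossing k)) (push First (end_dart (?T m) NW)) (push First (end_dart (?T m) A))"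
      using IH(1) cross(1) by (intro generated_by_composition[OF assms(1)]) auto
    moreover note dart_value_Second[OF assms(1) IH(2,3), of "crossing k", simplified, OF cross(2)]
      dart_value_Second[OF assms(1) IH(2,3), of "crossing k", simplified, OF cross(3)]
    ultimately show ?case by (auto simp: cmp algebra_simps)
  qed
  moreover have "?j (nat \<bar>k\<bar> - 1) = k" using assms(2) by (auto simp: of_nat_diff)
  ultimately show "generated_by T (end_dart T NW) (end_dart T A)"
    "dart_value T (end_dart T NW) (end_dart T A) (end_dart T B) (-1) (- k)"
    "dart_value T (end_dart T NW) (end_dart T A) (end_dart T SE) (-1) (1 - k)"
    unfolding T_def by metis+
qed

lemma composition_H: "composition Hcomp SW NE" and composition_V: "composition Vcomp NE SW"
  by (simp_all add: composition_def)

lemma int_tangle_eq: "int_tangle k = ((\<lambda>T. T \<ast> crossing k) ^^ (nat \<bar>k\<bar> - 1)) (crossing k)"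
  and recip_tangle_eq: "recip_tangle k = ((\<lambda>T. T \<star> crossing k) ^^ (nat \<bar>k\<bar> - 1)) (crossing k)"
  by (simp_all add: int_tangle_def recip_tangle_def crossing_def Let_def)

lemmas int_tangle_values = iterated_crossing_values[OF composition_H, folded int_tangle_eq]
lemmas recip_tangle_values = iterated_crossing_values[OF composition_V, folded recip_tangle_eq]

definition rational_values :: "tangle \<Rightarrow> dart \<Rightarrow> int \<Rightarrow> int \<Rightarrow> complex \<Rightarrow> complex \<Rightarrow> bool" where
  "rational_values T dY p q ep eq \<longleftrightarrow> generated_by T (end_dart T NW) dY \<and>
     dart_value T (end_dart T NW) dY (end_dart T NE) ep (- p) \<and>
     dart_value T (end_dart T NW) dY (end_dart T SW) eq q \<and>
     dart_value T (end_dart T NW) dY (end_dart T SE) (ep * eq) (q - p)"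

lemma sign_powi_minus: "(e :: complex) = 1 \<or> e = -1 \<Longrightarrow> e powi (- n) = e powi n"
  by (simp add: power_int_minus pm1_inverse)

lemma sign_powi_1_minus: "(e :: complex) = 1 \<or> e = -1 \<Longrightarrow> e powi (1 - n) = e * e powi n"
  by (auto simp: power_int_diff divide_inverse pm1_inverse)

lemma rational_values_Hcomp:
  assumes "rational_values T dY p q ep eq" "k \<noteq> 0"
  shows "rational_values (T \<ast> int_tangle k) (push First dY) (p + k * q) q (ep * eq powi k) eq"
proof -
  let ?S = "int_tangle k"
  have T: "generated_by T (end_dart T NW) dY"
    "dart_value T (end_dart T NW) dY (end_dart T NE) ep (- p)"
    "dart_value T (end_dart T NW) dY (end_dart T SW) eq q"
    "dart_value T (end_dart T NW) dY (end_dart T SE) (ep * eq) (q - p)"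
    using assms(1) by (auto simp: rational_values_def)
  have sg: "ep = 1 \<or> ep = -1" "eq = 1 \<or> eq = -1"
    using T dart_value_sign by blast+
  have epq: "ep * (ep * eq) = eq" using sg by auto
  have dY: "dY \<in> darts T" using T(1) by (simp add: generated_by_def)
  have ne: "dart_value (T \<ast> ?S) (push First (end_dart T NW)) (push First dY) (push Second (end_dart ?S NE))
     (- (-1) * ep * (ep * (ep * eq)) powi (- k)) (- p + (q - p - - p) * (- k))"
    by (rule dart_value_Second[OF composition_H T(2,4) int_tangle_values(2)[OF assms(2)] _ dY]) simp
  have se: "dart_value (T \<ast> ?S) (push First (end_dart T NW)) (push First dY) (push Second (end_dart ?S SE))
     (- (-1) * ep * (ep * (ep * eq)) powi (1 - k)) (- p + (q - p - - p) * (1 - k))"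
    by (rule dart_value_Second[OF composition_H T(2,4) int_tangle_values(3)[OF assms(2)] _ dY]) simp
  show ?thesis
    unfolding rational_values_def
    using generated_by_composition[OF composition_H T(1) int_tangle_values(1)[OF assms(2)]]
      dart_value_First[OF composition_H T(3), of ?S] ne se
    by (simp add: epq sign_powi_minus[OF sg(2)] sign_powi_1_minus[OF sg(2)] algebra_simps)
qed

lemma rational_values_Vcomp:
  assumes "rational_values T dY p q ep eq" "k \<noteq> 0"
  shows "rational_values (T \<star> recip_tangle k) (push First dY) p (q + k * p) ep (eq * ep powi k)"
proof -
  let ?S = "recip_tangle k"
  have T: "generated_by T (end_dart T NW) dY"
    "dart_value T (end_dart T NW) dY (end_dart T NE) ep (- p)"
    "dart_value T (end_dart T NW) dY (end_dart T SW) eq q"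
    "dart_value T (end_dart T NW) dY (end_dart T SE) (ep * eq) (q - p)"
    using assms(1) by (auto simp: rational_values_def)
  have sg: "ep = 1 \<or> ep = -1" "eq = 1 \<or> eq = -1"
    using T dart_value_sign by blast+
  have epq: "eq * (ep * eq) = ep" "ep * (eq * eq) = ep" using sg by auto
  have dY: "dY \<in> darts T" using T(1) by (simp add: generated_by_def)
  have sw: "dart_value (T \<star> ?S) (push First (end_dart T NW)) (push First dY) (push Second (end_dart ?S SW))
     (- (-1) * eq * (eq * (ep * eq)) powi (- k)) (q + (q - p - q) * (- k))"
    by (rule dart_value_Second[OF composition_V T(3,4) recip_tangle_values(2)[OF assms(2)] _ dY]) simp
  have se: "dart_value (T \<star> ?S) (push First (end_dart T NW)) (push First dY) (push Second (end_dart ?S SE))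
     (- (-1) * eq * (eq * (ep * eq)) powi (1 - k)) (q + (q - p - q) * (1 - k))"
    by (rule dart_value_Second[OF composition_V T(3,4) recip_tangle_values(3)[OF assms(2)] _ dY]) simp
  show ?thesis
    unfolding rational_values_def
    using generated_by_composition[OF composition_V T(1) recip_tangle_values(1)[OF assms(2)]]
      dart_value_First[OF composition_V T(2), of ?S] sw se
    by (simp add: epq sign_powi_minus[OF sg(1)] sign_powi_1_minus[OF sg(1)] algebra_simps)
qed

subsection \<open>Rational tangles\<close>

lemma compose_from_snoc:
  "compose_from b T (ks @ [k]) =
    (if b = even (length ks) then compose_from b T ks \<star> recip_tangle k else compose_from b T ks \<ast> int_tangle k)"
  by (induction b T ks rule: compose_from.induct) auto

lemma rational_tangle_snoc:
  assumes "ks \<noteq> []"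
  shows "rational_tangle (ks @ [k]) =
    (if odd (length ks) then rational_tangle ks \<star> recip_tangle k else rational_tangle ks \<ast> int_tangle k)"
  using assms by (cases ks) (auto simp: rational_tangle_def compose_from_snoc)

lemma cf_snoc:
  assumes "ks \<noteq> []"
  shows "j \<le> length ks \<Longrightarrow> cf_u (ks @ [k]) j = cf_u ks j \<and> cf_v (ks @ [k]) j = cf_v ks j"
proof (induction j rule: less_induct)
  case (less j)
  consider "j = 0" | "j = Suc 0" | i where "j = Suc (Suc i)" by (metis not0_implies_Suc)
  then show ?case using less assms by cases (auto simp: nth_append)
qed

lemma rat_snoc:
  assumes "ks \<noteq> []"
  shows "odd (length ks) \<Longrightarrow> rat_p (ks @ [k]) = rat_p ks \<and> rat_q (ks @ [k]) = rat_q ks + k * rat_p ks \<and>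
      rat_pt (ks @ [k]) = rat_pt ks \<and> rat_qt (ks @ [k]) = rat_qt ks + k * rat_pt ks"
    and "even (length ks) \<Longrightarrow> rat_p (ks @ [k]) = rat_p ks + k * rat_q ks \<and> rat_q (ks @ [k]) = rat_q ks \<and>
      rat_pt (ks @ [k]) = rat_pt ks + k * rat_qt ks \<and> rat_qt (ks @ [k]) = rat_qt ks"
  using assms cf_snoc[OF assms, of "length ks" k] cf_snoc[OF assms, of "length ks - 1" k]
  by (cases "length ks"; auto simp: rat_p_def rat_q_def rat_pt_def rat_qt_def Let_def nth_append)+

lemma rat_single [simp]: "rat_p [k] = k" "rat_q [k] = 1" "rat_pt [k] = 1" "rat_qt [k] = 0"
  by (simp_all add: rat_p_def rat_q_def rat_pt_def rat_qt_def)

lemma rat_det: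
  assumes "ks \<noteq> []"
  shows "rat_pt ks * rat_q ks - rat_p ks * rat_qt ks = 1"
  using assms
proof (induction ks rule: rev_nonempty_induct)
  case (snoc k ks)
  then show ?case
    using rat_snoc[OF snoc(1), of k] by (cases "odd (length ks)") (auto simp: algebra_simps)
qed auto

definition gen_dart :: "int list \<Rightarrow> dart" where
  "gen_dart ks = (replicate (length ks - 1) First @ fst (end_dart (int_tangle (hd ks)) SW),
     snd (end_dart (int_tangle (hd ks)) SW))"

lemma gen_Y_dart: "gen_Y ks \<rho> = \<rho> (gen_dart ks)"
  by (simp add: gen_Y_def gen_dart_def restr_apply)

lemma gen_dart_snoc: "ks \<noteq> [] \<Longrightarrow> gen_dart (ks @ [k]) = push First (gen_dart ks)"
  by (cases ks) (auto simp: gen_dart_def push_def)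

lemma rational_tangle_values:
  assumes "ks \<noteq> []" "0 \<notin> set ks"
  shows "rational_values (rational_tangle ks) (gen_dart ks) (rat_p ks) (rat_q ks)
    ((-1) powi rat_pt ks) ((-1) powi rat_qt ks)"
  using assms
proof (induction ks rule: rev_nonempty_induct)
  case (single k)
  then show ?case
    using int_tangle_values[of k] dart_value_Y
    by (auto simp: rational_tangle_def gen_dart_def rational_values_def)
next
  case (snoc k ks)
  have IH: "rational_values (rational_tangle ks) (gen_dart ks) (rat_p ks) (rat_q ks)
    ((-1) powi rat_pt ks) ((-1) powi rat_qt ks)" and k: "k \<noteq> 0"
    using snoc by auto
  have m: "((-1 :: complex) powi a) * ((-1) powi b) powi k = (-1) powi (a + k * b)" for a b
    by (simp add: power_int_add power_int_mult[symmetric] mult.commute)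
  show ?case
  proof (cases "odd (length ks)")
    case True
    with rational_values_Vcomp[OF IH k] rat_snoc(1)[OF snoc(1) True, of k] show ?thesis
      by (simp add: rational_tangle_snoc[OF snoc(1)] gen_dart_snoc[OF snoc(1)] m)
  next
    case False
    with rational_values_Hcomp[OF IH k] rat_snoc(2)[OF snoc(1), of k] show ?thesis
      by (simp add: rational_tangle_snoc[OF snoc(1)] gen_dart_snoc[OF snoc(1)] m)
  qed
qed

section \<open>Montesinos links\<close>

lemma montesinos_tangle_1: "montesinos_tangle 1 ks = rational_tangle (ks 1)"
  by (simp add: montesinos_tangle_def)

lemma montesinos_tangle_Suc:
  assumes "1 \<le> r"
  shows "montesinos_tangle (Suc r) ks = montesinos_tangle r ks \<star> rational_tangle (ks (Suc r))"
proof -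
  have "[2..<Suc (Suc r)] = [2..<Suc r] @ [Suc r]" using assms by simp
  then show ?thesis by (simp add: montesinos_tangle_def del: upt_Suc)
qed

lemma part_1: "part 1 1 \<rho> = \<rho>"
  by (simp add: part_def)

lemma part_Suc:
  assumes "1 \<le> r"
  shows "l \<le> r \<Longrightarrow> part (Suc r) l \<rho> = part r l (restr [First] \<rho>)"
    "part (Suc r) (Suc r) \<rho> = restr [Second] \<rho>"
  using assms by (auto simp: part_def Suc_diff_le simp flip: restr_append)

lemma montesinos_ends:
  assumes "1 \<le> r"
  shows "\<rho> (end_dart (montesinos_tangle r ks) NW) = part r 1 \<rho> (end_dart (rational_tangle (ks 1)) NW) \<and>
    \<rho> (end_dart (montesinos_tangle r ks) NE) = part r 1 \<rho> (end_dart (rational_tangle (ks 1)) NE) \<and>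
    \<rho> (end_dart (montesinos_tangle r ks) SW) = part r r \<rho> (end_dart (rational_tangle (ks r)) SW) \<and>
    \<rho> (end_dart (montesinos_tangle r ks) SE) = part r r \<rho> (end_dart (rational_tangle (ks r)) SE)"
  using assms
proof (induction r arbitrary: \<rho> rule: nat_induct_at_least)
  case base
  show ?case by (simp add: montesinos_tangle_1 part_1 del: One_nat_def)
next
  case (Suc r)
  show ?case
    using Suc.IH[of "restr [First] \<rho>"] Suc.hyps
    by (simp add: montesinos_tangle_Suc part_Suc flip: restr_single)
qed

lemma trep_montesinos:
  assumes "1 \<le> r" "trep (montesinos_tangle r ks) \<rho>"
  shows "(\<forall>l\<in>{1..r}. trep (rational_tangle (ks l)) (part r l \<rho>)) \<and> (\<forall>l\<in>{1..<r}.
    part r (Suc l) \<rho> (end_dart (rational_tangle (ks (Suc l))) NW) = - part r l \<rho> (end_dart (rational_tangle (ks l)) SW) \<and>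
    part r (Suc l) \<rho> (end_dart (rational_tangle (ks (Suc l))) NE) = - part r l \<rho> (end_dart (rational_tangle (ks l)) SE))"
  (is "(\<forall>l\<in>_. ?T r \<rho> l) \<and> (\<forall>l\<in>_. ?G r \<rho> l)")
  using assms
proof (induction r arbitrary: \<rho> rule: nat_induct_at_least)
  case base
  then show ?case by (simp add: montesinos_tangle_1 part_1 del: One_nat_def)
next
  case (Suc r)
  let ?\<rho> = "restr [First] \<rho>"
  have t: "trep (montesinos_tangle r ks) ?\<rho>" "trep (rational_tangle (ks (Suc r))) (restr [Second] \<rho>)"
    and g: "restr [Second] \<rho> (end_dart (rational_tangle (ks (Suc r))) NW) = - ?\<rho> (end_dart (montesinos_tangle r ks) SW)"
    "restr [Second] \<rho> (end_dart (rational_tangle (ks (Suc r))) NE) = - ?\<rho> (end_dart (montesinos_tangle r ks) SE)"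
    using Suc.prems Suc.hyps by (auto simp: montesinos_tangle_Suc trep_Vcomp)
  note IH = Suc.IH[OF t(1)]
  have "?T (Suc r) \<rho> l" if "l \<in> {1..Suc r}" for l
    using that IH t(2) Suc.hyps by (cases "l = Suc r") (auto simp: part_Suc)
  moreover have "?G (Suc r) \<rho> l" if "l \<in> {1..<Suc r}" for l
    using that IH g Suc.hyps montesinos_ends[OF Suc.hyps] by (cases "l = r") (auto simp: part_Suc)
  ultimately show ?case by blast
qed

lemma montesinos_dart_part:
  assumes "1 \<le> r" "d \<in> darts (montesinos_tangle r ks)"
  shows "\<exists>l\<in>{1..r}. \<exists>d'\<in>darts (rational_tangle (ks l)). \<forall>\<rho>. \<rho> d = part r l \<rho> d'"
  using assms
proof (induction r arbitrary: d rule: nat_induct_at_least)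
  case base
  then show ?case by (auto simp: montesinos_tangle_1 part_1 simp del: One_nat_def)
next
  case (Suc r)
  from Suc.prems Suc.hyps consider d0 where "d = push First d0" "d0 \<in> darts (montesinos_tangle r ks)"
    | d0 where "d = push Second d0" "d0 \<in> darts (rational_tangle (ks (Suc r)))"
    by (auto simp: montesinos_tangle_Suc)
  then show ?case
  proof cases
    case 1
    from Suc.IH[OF 1(2)] obtain l d' where l: "l \<in> {1..r}" "d' \<in> darts (rational_tangle (ks l))"
      and eq: "\<And>\<rho>. \<rho> d0 = part r l \<rho> d'"
      by blast
    have "\<rho> d = part (Suc r) l \<rho> d'" for \<rho>
      using eq[of "restr [First] \<rho>"] l Suc.hyps by (simp add: part_Suc 1 restr_single)
    then show ?thesis using l by (meson atLeastAtMost_iff le_SucI)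
  next
    case 2
    have "\<rho> d = part (Suc r) (Suc r) \<rho> d0" for \<rho>
      using Suc.hyps by (simp add: part_Suc 2 restr_single)
    then show ?thesis using 2 by (meson atLeastAtMost_iff le_refl le_SucI Suc.hyps)
  qed
qed

lemma montesinos_part_dart:
  assumes "1 \<le> r" "l \<in> {1..r}" "d' \<in> darts (rational_tangle (ks l))"
  shows "\<exists>d\<in>darts (montesinos_tangle r ks). \<forall>\<rho>. part r l \<rho> d' = \<rho> d"
  using assms
proof (induction r rule: nat_induct_at_least)
  case base
  then show ?case by (auto simp: montesinos_tangle_1 part_1 simp del: One_nat_def)
next
  case (Suc r)
  show ?case
  proof (cases "l = Suc r")
    case True
    then have "push Second d' \<in> darts (montesinos_tangle (Suc r) ks)"
      "\<forall>\<rho>. part (Suc r) l \<rho> d' = \<rho> (push Second d')"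
      using Suc.prems Suc.hyps by (auto simp: montesinos_tangle_Suc part_Suc restr_single)
    then show ?thesis by blast
  next
    case False
    then obtain d where "d \<in> darts (montesinos_tangle r ks)" "\<forall>\<rho>. part r l \<rho> d' = \<rho> d"
      using Suc by auto
    then have "push First d \<in> darts (montesinos_tangle (Suc r) ks)"
      "\<forall>\<rho>. part (Suc r) l \<rho> d' = \<rho> (push First d)"
      using Suc.prems Suc.hyps False by (auto simp: montesinos_tangle_Suc part_Suc restr_single)
    then show ?thesis by blast
  qed
qed

lemma ex_add_inverse: "\<exists>s. s \<noteq> 0 \<and> (t :: complex) = s + inverse s"
proof -
  define s where "s = (t + csqrt (t\<^sup>2 - 4)) / 2"
  have "s * (t - s) = 1"
    by (simp add: s_def field_simps power2_csqrt flip: power2_eq_square)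
  then have "s \<noteq> 0" "inverse s = t - s"
    by (auto intro: inverse_unique)
  then show ?thesis by (intro exI[of _ s]) auto
qed

locale montesinos =
  fixes r :: nat and ks :: "nat \<Rightarrow> int list"
  assumes r_ge_1: "1 \<le> r" and adm: "\<forall>l\<in>{1..r}. admissible (ks l)"
begin

abbreviation "M \<equiv> montesinos_tangle r ks"
abbreviation "R l \<equiv> rational_tangle (ks l)"
abbreviation "reps \<equiv> montesinos_reps r ks"
abbreviation "normal \<equiv> normalized r ks"
abbreviation "s_vals \<equiv> s_values r ks"
abbreviation "reducible \<equiv> mont_reducible r ks"
abbreviation "abelian \<equiv> mont_abelian r ks"
abbreviation "X \<equiv> mont_X r ks"
abbreviation "Y \<equiv> mont_Y r ks"
abbreviation "p l \<equiv> rat_p (ks l)"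
abbreviation "q l \<equiv> rat_q (ks l)"
abbreviation "pt l \<equiv> rat_pt (ks l)"
abbreviation "qt l \<equiv> rat_qt (ks l)"
abbreviation "ep l \<equiv> (-1 :: complex) powi pt l"
abbreviation "eq l \<equiv> (-1 :: complex) powi (qt l - 1)"

definition Z :: "(dart \<Rightarrow> cmat) \<Rightarrow> nat \<Rightarrow> cmat" where
  "Z \<rho> l = (let l' = if l = r + 1 then 1 else l in part r l' \<rho> (end_dart (R l') NE))"

lemma p_nonzero: "l \<in> {1..r} \<Longrightarrow> p l \<noteq> 0" and q_nonzero: "l \<in> {1..r} \<Longrightarrow> q l \<noteq> 0"
  and ks_nonempty: "l \<in> {1..r} \<Longrightarrow> ks l \<noteq> []" and ks_nonzero: "l \<in> {1..r} \<Longrightarrow> 0 \<notin> set (ks l)"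
  using adm by (auto simp: admissible_def)

lemma generated_by_gen_dart:
  assumes "l \<in> {1..r}"
  shows "generated_by (R l) (end_dart (R l) NW) (gen_dart (ks l))" "gen_dart (ks l) \<in> darts (R l)"
  using rational_tangle_values ks_nonempty ks_nonzero assms by (auto simp: rational_values_def generated_by_def)

lemma X_Suc_r: "X \<rho> (Suc r) = X \<rho> 1" and Z_Suc_r: "Z \<rho> (Suc r) = Z \<rho> 1"
  by (simp_all add: mont_X_def Z_def)

lemma X_part: "l \<in> {1..r} \<Longrightarrow> X \<rho> l = part r l \<rho> (end_dart (R l) NW)"
  and Y_part: "Y \<rho> l = part r l \<rho> (gen_dart (ks l))"
  and Z_part: "l \<in> {1..r} \<Longrightarrow> Z \<rho> l = part r l \<rho> (end_dart (R l) NE)"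
  by (auto simp: mont_X_def mont_Y_def Z_def gen_X_def gen_Y_dart)

lemma X_dart: "l \<in> {1..r} \<Longrightarrow> \<exists>d\<in>darts M. \<forall>\<rho>. X \<rho> l = \<rho> d"
  and Y_dart: "l \<in> {1..r} \<Longrightarrow> \<exists>d\<in>darts M. \<forall>\<rho>. Y \<rho> l = \<rho> d"
  and Z_dart: "l \<in> {1..r} \<Longrightarrow> \<exists>d\<in>darts M. \<forall>\<rho>. Z \<rho> l = \<rho> d"
  using montesinos_part_dart[OF r_ge_1, of l _ ks] generated_by_gen_dart[of l]
  by (simp_all add: X_part Y_part Z_part)

lemma reps_trep: "\<rho> \<in> reps \<Longrightarrow> trep M \<rho>"
  by (auto simp: montesinos_reps_def closure_reps_def tangle_reps_def trep_def)

lemma reps_iff: "\<rho> \<in> reps \<longleftrightarrow> \<rho> \<in> extensional (darts M) \<and> trep M \<rho> \<and>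
   \<rho> (end_dart M NW) = - \<rho> (end_dart M SW) \<and> \<rho> (end_dart M NE) = - \<rho> (end_dart M SE)"
proof -
  have "\<rho> \<in> reps \<longleftrightarrow> \<rho> \<in> extensional (darts M) \<and> trep M \<rho> \<and>
     \<rho> (end_dart M NW) = matrix_inv (\<rho> (end_dart M SW)) \<and> \<rho> (end_dart M NE) = matrix_inv (\<rho> (end_dart M SE))"
    by (auto simp: montesinos_reps_def closure_reps_def tangle_reps_def trep_def PiE_def)
  then show ?thesis
    using trep_SL0[OF _ end_dart_in] by (metis SL0_matrix_inv)
qed

lemma X_SL0: assumes "\<rho> \<in> reps" "l \<in> {1..Suc r}" shows "X \<rho> l \<in> SL0"
proof -
  have *: "X \<rho> l \<in> SL0" if "l \<in> {1..r}" for l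
    using X_dart[OF that] reps_trep[OF assms(1)] by (metis trep_SL0)
  show ?thesis using assms(2) *[of l] *[of 1] r_ge_1 by (cases "l = Suc r") (auto simp: X_Suc_r)
qed

lemma Y_SL0: assumes "\<rho> \<in> reps" "l \<in> {1..r}" shows "Y \<rho> l \<in> SL0"
  using Y_dart[OF assms(2)] reps_trep[OF assms(1)] by (metis trep_SL0)

lemma gluing:
  assumes "\<rho> \<in> reps" "l \<in> {1..r}"
  shows "X \<rho> (Suc l) = - part r l \<rho> (end_dart (R l) SW) \<and> Z \<rho> (Suc l) = - part r l \<rho> (end_dart (R l) SE)"
proof (cases "l = r")
  case True
  have "\<rho> (end_dart M NW) = - \<rho> (end_dart M SW) \<and> \<rho> (end_dart M NE) = - \<rho> (end_dart M SE)"
    using assms reps_iff by blast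
  then show ?thesis
    unfolding True X_Suc_r Z_Suc_r using r_ge_1 montesinos_ends[OF r_ge_1, where ks=ks] by (simp add: X_part Z_part)
next
  case False
  then show ?thesis
    using trep_montesinos[OF r_ge_1 reps_trep[OF assms(1)]] assms(2)
    by (simp add: X_part Z_part)
qed

lemma part_values:
  assumes "\<rho> \<in> reps" "l \<in> {1..r}" "s \<noteq> 0" "bil (X \<rho> l) (Y \<rho> l) = s + inverse s"
  shows "Z \<rho> l = ep l *\<^sub>m refl_seq s (X \<rho> l) (Y \<rho> l) (- p l)"
    "X \<rho> (Suc l) = eq l *\<^sub>m refl_seq s (X \<rho> l) (Y \<rho> l) (q l)"
    "Z \<rho> (Suc l) = (ep l * eq l) *\<^sub>m refl_seq s (X \<rho> l) (Y \<rho> l) (q l - p l)"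
proof -
  have t: "trep (R l) (part r l \<rho>)"
    using trep_montesinos[OF r_ge_1 reps_trep[OF assms(1)]] assms(2) by blast
  have b: "bil (part r l \<rho> (end_dart (R l) NW)) (part r l \<rho> (gen_dart (ks l))) = s + inverse s"
    using assms by (simp add: X_part Y_part)
  have v: "rational_values (R l) (gen_dart (ks l)) (p l) (q l) (ep l) ((-1) powi qt l)"
    using rational_tangle_values ks_nonempty ks_nonzero assms(2) by auto
  have m: "(-1 :: complex) powi qt l = - eq l"
    by (simp add: power_int_diff)
  note D = dart_valueD[OF _ t assms(3) b]
  show "Z \<rho> l = ep l *\<^sub>m refl_seq s (X \<rho> l) (Y \<rho> l) (- p l)"
    using v D assms(2) by (simp add: rational_values_def Z_part X_part Y_part)
  show "X \<rho> (Suc l) = eq l *\<^sub>m refl_seq s (X \<rho> l) (Y \<rho> l) (q l)"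
    using v D[of "end_dart (R l) SW" "- eq l" "q l"] gluing[OF assms(1,2)] assms(2)
    by (simp add: rational_values_def X_part Y_part m cmat_eq_iff)
  show "Z \<rho> (Suc l) = (ep l * eq l) *\<^sub>m refl_seq s (X \<rho> l) (Y \<rho> l) (q l - p l)"
    using v D[of "end_dart (R l) SE" "ep l * - eq l" "q l - p l"] gluing[OF assms(1,2)] assms(2)
    by (simp add: rational_values_def X_part Y_part m cmat_eq_iff)
qed

lemma bil_X_Z:
  assumes "\<rho> \<in> reps" "l \<in> {1..r}" "s \<noteq> 0" "bil (X \<rho> l) (Y \<rho> l) = s + inverse s"
  shows "bil (X \<rho> l) (Z \<rho> l) = ep l * pow_sum s (p l)"
    "bil (X \<rho> (Suc l)) (Z \<rho> (Suc l)) = ep l * pow_sum s (p l)"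
proof -
  note b = bil_refl_seq[OF assms(3) X_SL0[OF assms(1)] Y_SL0[OF assms(1,2)] assms(4)]
  have l: "l \<in> {1..Suc r}" using assms(2) by auto
  have "bil (refl_seq s (X \<rho> l) (Y \<rho> l) 0) (refl_seq s (X \<rho> l) (Y \<rho> l) (- p l)) = pow_sum s (p l)"
    using b[OF l, of 0 "- p l"] by simp
  then show "bil (X \<rho> l) (Z \<rho> l) = ep l * pow_sum s (p l)"
    using part_values[OF assms] assms(3) by (simp add: bil_linear refl_seq_0)
  have "eq l * eq l = 1" by (simp add: pm1_powi_sq)
  then show "bil (X \<rho> (Suc l)) (Z \<rho> (Suc l)) = ep l * pow_sum s (p l)"
    using part_values[OF assms] b[OF l, of "q l" "q l - p l"]
    by (simp add: bil_linear algebra_simps)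
qed

lemma bil_X_Z_const:
  assumes "\<rho> \<in> reps" "l \<in> {1..r}"
  shows "bil (X \<rho> l) (Z \<rho> l) = bil (X \<rho> 1) (Z \<rho> 1)"
proof -
  have "1 \<le> l" "l \<le> r" using assms by auto
  then show ?thesis
  proof (induction l rule: nat_induct_at_least)
    case (Suc l)
    then show ?case
      using bil_X_Z[OF assms(1), of l] ex_add_inverse[of "bil (X \<rho> l) (Y \<rho> l)"] by auto
  qed simp
qed

lemma tr_h_eq:
  assumes "\<rho> \<in> reps"
  shows "- tr_h (R 1) (part r 1 \<rho>) = bil (X \<rho> 1) (Z \<rho> 1)"
proof -
  have 1: "1 \<in> {1..r}" using r_ge_1 by simp
  have "- tr_h (R 1) (part r 1 \<rho>) = bil (X \<rho> (Suc 1)) (Z \<rho> (Suc 1))"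
    unfolding gluing[OF assms 1, THEN conjunct1] gluing[OF assms 1, THEN conjunct2]
    by (simp add: tr_h_def bil_linear) (simp add: bil_def)
  then show ?thesis
    using bil_X_Z[OF assms 1] ex_add_inverse[of "bil (X \<rho> 1) (Y \<rho> 1)"] by auto
qed

lemma dart_combination:
  assumes "d \<in> darts M"
  shows "\<exists>l\<in>{1..r}. \<exists>e n. \<forall>\<rho>\<in>reps. \<forall>s. s \<noteq> 0 \<and> bil (X \<rho> l) (Y \<rho> l) = s + inverse s \<longrightarrow>
    \<rho> d = e *\<^sub>m refl_seq s (X \<rho> l) (Y \<rho> l) n"
proof -
  obtain l d' where l: "l \<in> {1..r}" "d' \<in> darts (R l)" and eq: "\<And>\<rho>. \<rho> d = part r l \<rho> d'"
    using montesinos_dart_part[OF r_ge_1 assms] by blast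
  obtain e n where v: "dart_value (R l) (end_dart (R l) NW) (gen_dart (ks l)) d' e n"
    using generated_by_gen_dart(1)[OF l(1)] l(2) by (auto simp: generated_by_def)
  have "\<rho> d = e *\<^sub>m refl_seq s (X \<rho> l) (Y \<rho> l) n"
    if "\<rho> \<in> reps" "s \<noteq> 0" "bil (X \<rho> l) (Y \<rho> l) = s + inverse s" for \<rho> s
    using dart_valueD[OF v trep_montesinos[THEN conjunct1, OF r_ge_1 reps_trep[OF that(1)], rule_format, OF l(1)], of s] that
    unfolding eq by (simp add: X_part[OF l(1)] Y_part)
  with l(1) show ?thesis by blast
qed

lemma reps_determined:
  assumes "\<rho> \<in> reps" "\<rho>' \<in> reps"
    and "\<And>l. l \<in> {1..r} \<Longrightarrow> X \<rho> l = X \<rho>' l \<and> Y \<rho> l = Y \<rho>' l"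
  shows "\<rho> = \<rho>'"
proof (rule extensionalityI[where A = "darts M"])
  show "\<rho> \<in> extensional (darts M)" "\<rho>' \<in> extensional (darts M)"
    using assms reps_iff by blast+
  fix d assume "d \<in> darts M"
  then obtain l e n where l: "l \<in> {1..r}" and v: "\<And>\<rho> s. \<rho> \<in> reps \<Longrightarrow> s \<noteq> 0 \<Longrightarrow>
      bil (X \<rho> l) (Y \<rho> l) = s + inverse s \<Longrightarrow> \<rho> d = e *\<^sub>m refl_seq s (X \<rho> l) (Y \<rho> l) n"
    using dart_combination by blast
  obtain s where "s \<noteq> 0" "bil (X \<rho> l) (Y \<rho> l) = s + inverse s"
    using ex_add_inverse by blast
  then show "\<rho> d = \<rho>' d"
    using v[OF assms(1)] v[OF assms(2)] assms(3)[OF l] by simp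
qed

lemma reps_span:
  assumes "\<rho> \<in> reps" "d \<in> darts M"
  shows "\<exists>l\<in>{1..r}. \<exists>b c. \<rho> d = b *\<^sub>m X \<rho> l + c *\<^sub>m Y \<rho> l"
proof -
  obtain l e n where l: "l \<in> {1..r}" and v: "\<And>s. s \<noteq> 0 \<Longrightarrow>
      bil (X \<rho> l) (Y \<rho> l) = s + inverse s \<Longrightarrow> \<rho> d = e *\<^sub>m refl_seq s (X \<rho> l) (Y \<rho> l) n"
    using dart_combination[OF assms(2)] assms(1) by blast
  obtain s where "s \<noteq> 0" "bil (X \<rho> l) (Y \<rho> l) = s + inverse s"
    using ex_add_inverse by blast
  then have "\<rho> d = e *\<^sub>m refl_seq s (X \<rho> l) (Y \<rho> l) n" by (rule v)
  also have "\<dots> = (- e * cheb s (n - 1)) *\<^sub>m X \<rho> l + (e * cheb s n) *\<^sub>m Y \<rho> l"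
    by (simp add: refl_seq_def cmat_eq_iff algebra_simps)
  finally show ?thesis using l by blast
qed

end

section \<open>Conjugation and transposition\<close>

text \<open>Transposition is included besides conjugation: it reverses products, but this does not matter
  because \<open>X Y X\<^sup>-\<^sup>1\<close> is the expression \<open>bil X Y X - Y\<close> in terms of the bilinear form.\<close>

definition isometry :: "(cmat \<Rightarrow> cmat) \<Rightarrow> bool" where
  "isometry f \<longleftrightarrow> (\<forall>X\<in>SL0. f X \<in> SL0) \<and> (\<forall>X Y. bil (f X) (f Y) = bil X Y) \<and>
     (\<forall>X Y. f (X - Y) = f X - f Y) \<and> (\<forall>c X. f (c *\<^sub>m X) = c *\<^sub>m f X)"

lemma isometry_minus: "isometry f \<Longrightarrow> f (- X) = - f X"
  unfolding isometry_def by (metis scale_m1)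

lemma trep_isometry:
  assumes "isometry f" "trep T \<rho>" shows "trep T (\<lambda>d. f (\<rho> d))"
proof -
  note f = assms(1)[unfolded isometry_def] isometry_minus[OF assms(1)]
  have restr_f: "restr w (\<lambda>d. f (\<rho> d)) = (\<lambda>d. f (restr w \<rho> d))" for w \<rho>
    by (auto simp: restr_def)
  show ?thesis
    using assms(2)
  proof (induction T arbitrary: \<rho>)
    case Pos
    then show ?case using f unfolding trep_Pos_iff by metis
  next
    case Neg
    then show ?case using f unfolding trep_Neg_iff by metis
  next
    case (Hcomp T1 T2)
    then show ?case using f(2) by (simp add: trep_Hcomp restr_f)
  next
    case (Vcomp T1 T2)
    then show ?case using f(2) by (simp add: trep_Vcomp restr_f)
  qed
qed

lemma trep_cong:
  assumes "\<And>d. d \<in> darts T \<Longrightarrow> \<rho> d = \<rho>' d"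
  shows "trep T \<rho> \<longleftrightarrow> trep T \<rho>'"
  using assms
proof (induction T arbitrary: \<rho> \<rho>')
  case (Hcomp T1 T2)
  have "restr [First] \<rho> d = restr [First] \<rho>' d" if "d \<in> darts T1" for d
    using Hcomp.prems that by (simp add: restr_single)
  moreover have "restr [Second] \<rho> d = restr [Second] \<rho>' d" if "d \<in> darts T2" for d
    using Hcomp.prems that by (simp add: restr_single)
  ultimately show ?case
    using Hcomp.IH(1)[of "restr [First] \<rho>" "restr [First] \<rho>'"] Hcomp.IH(2)[of "restr [Second] \<rho>" "restr [Second] \<rho>'"]
    by (simp add: trep_Hcomp)
next
  case (Vcomp T1 T2)
  have "restr [First] \<rho> d = restr [First] \<rho>' d" if "d \<in> darts T1" for d
    using Vcomp.prems that by (simp add: restr_single)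
  moreover have "restr [Second] \<rho> d = restr [Second] \<rho>' d" if "d \<in> darts T2" for d
    using Vcomp.prems that by (simp add: restr_single)
  ultimately show ?case
    using Vcomp.IH(1)[of "restr [First] \<rho>" "restr [First] \<rho>'"] Vcomp.IH(2)[of "restr [Second] \<rho>" "restr [Second] \<rho>'"]
    by (simp add: trep_Vcomp)
qed (simp_all add: trep_Pos_iff trep_Neg_iff)

lemma det_1_inverse:
  fixes P :: cmat
  assumes "det P = 1" shows "P ** matrix_inv P = mat 1" "matrix_inv P ** P = mat 1"
proof -
  have "invertible P" using assms invertible_det_nz by (metis zero_neq_one)
  then show "P ** matrix_inv P = mat 1" "matrix_inv P ** P = mat 1"
    unfolding invertible_def matrix_inv_def by (metis (mono_tags, lifting) someI_ex)+
qed

lemma mult_inverse_cancel: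
  fixes P :: cmat
  assumes "det P = 1" shows "N ** P ** matrix_inv P = N" "N ** matrix_inv P ** P = N"
  by (simp_all add: det_1_inverse[OF assms] flip: matrix_mul_assoc)

lemma det_matrix_inv_1:
  fixes P :: cmat
  assumes "det P = 1" shows "det (matrix_inv P) = 1"
  using det_mul[of P "matrix_inv P"] by (simp add: assms det_1_inverse)

lemma conj_eq_iff:
  fixes P :: cmat
  assumes "det P = 1" shows "P ** N ** matrix_inv P = K \<longleftrightarrow> P ** N = K ** P"
  using mult_inverse_cancel[OF assms] by metis

lemma scale_mult_left: "(c *\<^sub>m M) ** N = c *\<^sub>m (M ** N)"
  and scale_mult_right: "M ** (c *\<^sub>m N) = c *\<^sub>m (M ** N)"
  by (simp_all add: cmat_eq_iff cmat_mult_nth algebra_simps)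

lemma isometry_conj:
  assumes "det P = 1" shows "isometry (\<lambda>X. P ** X ** matrix_inv P)"
proof -
  note inv = det_1_inverse[OF assms]
  have tr: "trace (P ** X ** matrix_inv P) = trace X" for X
    using trace_mul_sym[of "P ** X" "matrix_inv P"] by (simp add: matrix_mul_assoc inv)
  have det: "det (P ** X ** matrix_inv P) = det X" for X
    by (simp add: det_mul assms det_matrix_inv_1)
  have "(P ** X ** matrix_inv P) ** (P ** Y ** matrix_inv P) = P ** (X ** Y) ** matrix_inv P" for X Y
    by (simp add: matrix_mul_assoc mult_inverse_cancel[OF assms])
  then have bil: "bil (P ** X ** matrix_inv P) (P ** Y ** matrix_inv P) = bil X Y" for X Y
    by (simp add: bil_def tr)
  show ?thesis
    unfolding isometry_def
    by (auto simp: bil SL0_def tr det scale_mult_left scale_mult_right)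
      (simp add: cmat_eq_iff cmat_mult_nth algebra_simps)
qed

lemma isometry_transpose: "isometry transpose"
  unfolding isometry_def
  by (auto simp: SL0_def bil_def cmat_simps transpose_def algebra_simps)

definition diag_mat :: "complex \<Rightarrow> cmat" where
  "diag_mat t = mat2 t 0 0 (inverse t)"

lemma det_diag_mat: "t \<noteq> 0 \<Longrightarrow> det (diag_mat t) = 1"
  by (simp add: diag_mat_def det_2)

lemma diag_mat_inverse: "t \<noteq> 0 \<Longrightarrow> matrix_inv (diag_mat t) = diag_mat (inverse t)"
  by (intro matrix_inv_eqI) (simp add: diag_mat_def cmat_simps)

lemma diag_mat_conj:
  assumes "t \<noteq> 0"
  shows "diag_mat t ** tf x y z ** matrix_inv (diag_mat t) = tf x (t\<^sup>2 * y) (z / t\<^sup>2)"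
  unfolding diag_mat_inverse[OF assms] using assms
  by (simp add: diag_mat_def cmat_simps power2_eq_square divide_simps)

lemma centralizer_A_1:
  assumes "det P = 1" "P ** A_mat 1 ** matrix_inv P = A_mat 1"
  obtains t where "t \<noteq> 0" "P = diag_mat t"
proof -
  have "P ** A_mat 1 = A_mat 1 ** P"
    using assms conj_eq_iff by blast
  then have "P $ 1 $ 2 = 0" "P $ 2 $ 1 = 0"
    by (auto simp: A_mat_1 cmat_simps)
  moreover with assms(1) have "P $ 1 $ 1 * P $ 2 $ 2 = 1" by (simp add: det_2)
  ultimately have "P $ 1 $ 1 \<noteq> 0" "P = diag_mat (P $ 1 $ 1)"
    by (auto simp: diag_mat_def cmat_eq_iff inverse_unique)
  with that show thesis by blast
qed

lemma conj_to_A_1: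
  assumes "X \<in> SL0"
  obtains P where "det P = 1" "P ** X ** matrix_inv P = A_mat 1"
proof -
  obtain x y z where X: "X = tf x y z" "x\<^sup>2 - y * z = 1"
    using assms SL0_obtain_tf by blast
  have ii: "\<i> * \<i> = (-1 :: complex)" by simp
  have "\<exists>Q. det Q \<noteq> 0 \<and> Q ** X = A_mat 1 ** Q"
  proof (cases "x = -1")
    case False
    have "det (tf (x + 1) y z) = 2 * (x + 1)"
      unfolding det_2 tf_nth using X(2) ii by algebra
    moreover have "tf (x + 1) y z ** X = A_mat 1 ** tf (x + 1) y z"
      unfolding X(1) A_mat_1 cmat_eq_iff cmat_mult_nth tf_nth using X(2) ii by (intro conjI; (algebra | simp add: algebra_simps))
    moreover have "x + 1 \<noteq> 0"
      using False eq_neg_iff_add_eq_0 by blast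
    ultimately show ?thesis by (intro exI[of _ "tf (x + 1) y z"]) (simp only: mult_eq_0_iff, simp)
  next
    case True
    let ?Q = "tf 2 (- z) (- y) ** D_mat"
    have yz: "y * z = 0" using X(2) True by simp
    have "det ?Q = 4"
      unfolding det_2 cmat_mult_nth D_mat_tf tf_nth using yz ii by algebra
    moreover have "?Q ** X = A_mat 1 ** ?Q"
      unfolding X(1) A_mat_1 D_mat_tf cmat_eq_iff cmat_mult_nth tf_nth using yz ii True by (intro conjI; (algebra | simp add: algebra_simps))
    ultimately show ?thesis by (intro exI[of _ ?Q]) auto
  qed
  then obtain Q where Q: "det Q \<noteq> 0" "Q ** X = A_mat 1 ** Q" by blast
  define P where "P = inverse (csqrt (det Q)) *\<^sub>m Q"
  have "det P = inverse (csqrt (det Q)) * inverse (csqrt (det Q)) * det Q"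
    by (simp add: P_def det_2 algebra_simps)
  also have "\<dots> = 1"
    using Q(1) by (metis csqrt_eq_0 inverse_mult_distrib left_inverse power2_csqrt power2_eq_square)
  finally have "det P = 1" .
  moreover have "P ** X = A_mat 1 ** P"
    by (simp add: P_def scale_mult_left scale_mult_right Q(2))
  then have "P ** X ** matrix_inv P = A_mat 1"
    using conj_eq_iff[OF \<open>det P = 1\<close>] by blast
  ultimately show thesis using that by blast
qed

lemma rep_image_det:
  assumes "\<And>d. d \<in> darts T \<Longrightarrow> \<rho> d \<in> SL0" "N \<in> rep_image T \<rho>"
  shows "det N = 1"
  using assms(2)
proof induction
  case (gen d)
  then show ?case using assms(1) by (auto simp: SL0_def)
next
  case (inv N)
  then show ?case by (simp add: det_matrix_inv_1)
qed (simp_all add: det_mul)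

lemma reducible_rep_iff:
  assumes "\<And>d. d \<in> darts T \<Longrightarrow> \<rho> d \<in> SL0"
  shows "reducible_rep T \<rho> \<longleftrightarrow> (\<exists>v. v \<noteq> 0 \<and> (\<forall>d\<in>darts T. \<exists>c. \<rho> d *v v = c *s v))"
proof
  assume "reducible_rep T \<rho>"
  then show "\<exists>v. v \<noteq> 0 \<and> (\<forall>d\<in>darts T. \<exists>c. \<rho> d *v v = c *s v)"
    unfolding reducible_rep_def using rep_image.gen by meson
next
  assume "\<exists>v. v \<noteq> 0 \<and> (\<forall>d\<in>darts T. \<exists>c. \<rho> d *v v = c *s v)"
  then obtain v where v: "v \<noteq> 0" "\<And>d. d \<in> darts T \<Longrightarrow> \<exists>c. \<rho> d *v v = c *s v" by blast
  have "\<exists>c. N *v v = c *s v" if "N \<in> rep_image T \<rho>" for N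
    using that
  proof induction
    case one
    then show ?case by (metis matrix_vector_mul_lid vector_smult_lid)
  next
    case (gen d)
    then show ?case by (rule v(2))
  next
    case (inv N)
    then obtain c where c: "N *v v = c *s v" by blast
    note i = det_1_inverse[OF rep_image_det[OF assms inv(1)]]
    have e: "v = c *s (matrix_inv N *v v)"
      by (metis c i(2) matrix_vector_mul_assoc matrix_vector_mul_lid vector_scalar_commute)
    then have "c \<noteq> 0" using v(1) by (metis vector_smult_lzero)
    then have "matrix_inv N *v v = inverse c *s v"
      by (metis e left_inverse vector_smult_assoc vector_smult_lid)
    then show ?case by blast
  next
    case (mult N N')
    then show ?case
      by (metis matrix_vector_mul_assoc vector_scalar_commute vector_smult_assoc)
  qed
  then show "reducible_rep T \<rho>" unfolding reducible_rep_def using v(1) by blast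
qed

lemma abelian_rep_iff:
  assumes "\<And>d. d \<in> darts T \<Longrightarrow> \<rho> d \<in> SL0"
  shows "abelian_rep T \<rho> \<longleftrightarrow> (\<forall>d\<in>darts T. \<forall>d'\<in>darts T. \<rho> d ** \<rho> d' = \<rho> d' ** \<rho> d)"
proof
  assume "abelian_rep T \<rho>"
  then show "\<forall>d\<in>darts T. \<forall>d'\<in>darts T. \<rho> d ** \<rho> d' = \<rho> d' ** \<rho> d"
    unfolding abelian_rep_def using rep_image.gen by meson
next
  assume *: "\<forall>d\<in>darts T. \<forall>d'\<in>darts T. \<rho> d ** \<rho> d' = \<rho> d' ** \<rho> d"
  have closure: "K ** N = N ** K"
    if N: "N \<in> rep_image T \<rho>" and K: "\<And>d. d \<in> darts T \<Longrightarrow> K ** \<rho> d = \<rho> d ** K" for N K :: cmat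
    using N
  proof induction
    case (inv N)
    have det: "det N = 1" by (rule rep_image_det[OF assms inv(1)])
    have "matrix_inv N ** (N ** K) ** matrix_inv N = matrix_inv N ** (K ** N) ** matrix_inv N"
      using inv(2) by simp
    then show ?case
      by (simp add: matrix_mul_assoc mult_inverse_cancel[OF det] det_1_inverse[OF det])
  next
    case (mult N N')
    have "K ** (N ** N') = N ** (K ** N')" by (simp only: matrix_mul_assoc mult.IH(1))
    also have "\<dots> = N ** N' ** K" by (simp only: mult.IH(2) matrix_mul_assoc)
    finally show ?case .
  qed (use K in auto)
  show "abelian_rep T \<rho>"
    unfolding abelian_rep_def
  proof (intro ballI)
    fix N N' assume "N \<in> rep_image T \<rho>" "N' \<in> rep_image T \<rho>"
    then show "N ** N' = N' ** N"
      using closure * by metis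
  qed
qed

context montesinos
begin

definition map_rep :: "(cmat \<Rightarrow> cmat) \<Rightarrow> (dart \<Rightarrow> cmat) \<Rightarrow> dart \<Rightarrow> cmat" where
  "map_rep f \<rho> = restrict (\<lambda>d. f (\<rho> d)) (darts M)"

lemma map_rep_reps:
  assumes "isometry f" "\<rho> \<in> reps" shows "map_rep f \<rho> \<in> reps"
  using assms trep_isometry[OF assms(1) reps_trep[OF assms(2)]]
    trep_cong[of M "map_rep f \<rho>" "\<lambda>d. f (\<rho> d)"]
  by (auto simp: reps_iff map_rep_def isometry_minus)

lemma
  shows map_rep_X: "l \<in> {1..Suc r} \<Longrightarrow> X (map_rep f \<rho>) l = f (X \<rho> l)"
    and map_rep_Y: "l \<in> {1..r} \<Longrightarrow> Y (map_rep f \<rho>) l = f (Y \<rho> l)"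
    and map_rep_Z: "l \<in> {1..r} \<Longrightarrow> Z (map_rep f \<rho>) l = f (Z \<rho> l)"
proof -
  have *: "X (map_rep f \<rho>) l = f (X \<rho> l)" if "l \<in> {1..r}" for l
    using X_dart[OF that] by (auto simp: map_rep_def)
  show "X (map_rep f \<rho>) l = f (X \<rho> l)" if "l \<in> {1..Suc r}"
    using that *[of l] *[of 1] r_ge_1 by (cases "l = Suc r") (auto simp: X_Suc_r)
  show "Y (map_rep f \<rho>) l = f (Y \<rho> l)" if "l \<in> {1..r}"
    using Y_dart[OF that] by (auto simp: map_rep_def)
  show "Z (map_rep f \<rho>) l = f (Z \<rho> l)" if "l \<in> {1..r}"
    using Z_dart[OF that] by (auto simp: map_rep_def)
qed

lemma conjugate_reps_iff:
  assumes "\<rho>' \<in> reps"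
  shows "conjugate_reps M \<rho> \<rho>' \<longleftrightarrow> (\<exists>P. det P = 1 \<and> \<rho>' = map_rep (\<lambda>X. P ** X ** matrix_inv P) \<rho>)"
proof -
  have "(\<forall>d\<in>darts M. \<rho>' d = f d) \<longleftrightarrow> \<rho>' = restrict f (darts M)" for f
    using assms reps_iff by (auto simp: restrict_def fun_eq_iff extensional_def)
  then show ?thesis by (simp add: conjugate_reps_def map_rep_def)
qed

lemma matrix_inv_mult:
  fixes P Q :: cmat
  assumes "det P = 1" "det Q = 1"
  shows "matrix_inv (P ** Q) = matrix_inv Q ** matrix_inv P"
  by (rule matrix_inv_eqI)
    (simp add: matrix_mul_assoc mult_inverse_cancel[OF assms(2)] det_1_inverse[OF assms(1)])

lemma conjugate_reps_trans:
  assumes "conjugate_reps M \<rho> \<rho>'" "conjugate_reps M \<rho>' \<rho>''"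
  shows "conjugate_reps M \<rho> \<rho>''"
proof -
  obtain P Q where PQ: "det P = 1" "det Q = 1" "\<And>d. d \<in> darts M \<Longrightarrow> \<rho>' d = P ** \<rho> d ** matrix_inv P"
    "\<And>d. d \<in> darts M \<Longrightarrow> \<rho>'' d = Q ** \<rho>' d ** matrix_inv Q"
    using assms unfolding conjugate_reps_def by metis
  then have "\<rho>'' d = (Q ** P) ** \<rho> d ** matrix_inv (Q ** P)" if "d \<in> darts M" for d
    using that by (simp add: matrix_inv_mult matrix_mul_assoc)
  with PQ show ?thesis unfolding conjugate_reps_def by (intro exI[of _ "Q ** P"]) (simp add: det_mul)
qed

lemma conjugate_reps_sym:
  assumes "conjugate_reps M \<rho> \<rho>'" shows "conjugate_reps M \<rho>' \<rho>"
proof -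
  obtain P where P: "det P = 1" "\<And>d. d \<in> darts M \<Longrightarrow> \<rho>' d = P ** \<rho> d ** matrix_inv P"
    using assms unfolding conjugate_reps_def by metis
  note i = det_1_inverse[OF P(1)]
  have ii: "matrix_inv (matrix_inv P) = P" by (rule matrix_inv_eqI) (rule i)
  have "\<rho> d = matrix_inv P ** \<rho>' d ** matrix_inv (matrix_inv P)" if "d \<in> darts M" for d
    unfolding ii P(2)[OF that] by (simp add: matrix_mul_assoc mult_inverse_cancel[OF P(1)] i)
  moreover have "det (matrix_inv P) = 1" using P(1) by (rule det_matrix_inv_1)
  ultimately show ?thesis unfolding conjugate_reps_def by blast
qed

definition upper :: "(dart \<Rightarrow> cmat) \<Rightarrow> bool" where
  "upper \<rho> \<longleftrightarrow> (\<forall>l\<in>{1..r}. X \<rho> l $ 2 $ 1 = 0 \<and> Y \<rho> l $ 2 $ 1 = 0)"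

definition lower :: "(dart \<Rightarrow> cmat) \<Rightarrow> bool" where
  "lower \<rho> \<longleftrightarrow> (\<forall>l\<in>{1..r}. X \<rho> l $ 1 $ 2 = 0 \<and> Y \<rho> l $ 1 $ 2 = 0)"

lemma entry_0_darts:
  assumes "\<rho> \<in> reps"
  shows "(\<forall>l\<in>{1..r}. X \<rho> l $ i $ j = 0 \<and> Y \<rho> l $ i $ j = 0) \<longleftrightarrow> (\<forall>d\<in>darts M. \<rho> d $ i $ j = 0)"
    (is "?L \<longleftrightarrow> ?R")
proof
  assume ?L
  show ?R
  proof
    fix d assume "d \<in> darts M"
    from reps_span[OF assms this] show "\<rho> d $ i $ j = 0" using \<open>?L\<close> by auto
  qed
next
  assume ?R
  then show ?L using X_dart Y_dart by metis
qed

lemma upper_darts: "\<rho> \<in> reps \<Longrightarrow> upper \<rho> \<longleftrightarrow> (\<forall>d\<in>darts M. \<rho> d $ 2 $ 1 = 0)"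
  and lower_darts: "\<rho> \<in> reps \<Longrightarrow> lower \<rho> \<longleftrightarrow> (\<forall>d\<in>darts M. \<rho> d $ 1 $ 2 = 0)"
  unfolding upper_def lower_def by (rule entry_0_darts, assumption)+

lemma matrix_vector_nth: "((N :: cmat) *v v) $ i = N $ i $ 1 * v $ 1 + N $ i $ 2 * v $ 2"
  by (simp add: matrix_vector_mult_def sum_2)

lemma reducible_iff:
  assumes "\<rho> \<in> reps" "X \<rho> 1 = A_mat 1"
  shows "reducible \<rho> \<longleftrightarrow> upper \<rho> \<or> lower \<rho>"
proof -
  have red: "reducible \<rho> \<longleftrightarrow> (\<exists>v. v \<noteq> 0 \<and> (\<forall>d\<in>darts M. \<exists>c. \<rho> d *v v = c *s v))"
    unfolding mont_reducible_def
    by (rule reducible_rep_iff) (rule trep_SL0[OF reps_trep[OF assms(1)]])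
  obtain d1 where d1: "d1 \<in> darts M" "\<rho> d1 = A_mat 1"
    using X_dart[of 1] r_ge_1 assms(2) by (metis atLeastAtMost_iff order_refl)
  show ?thesis
  proof
    assume "reducible \<rho>"
    then obtain v where v: "v \<noteq> 0" "\<And>d. d \<in> darts M \<Longrightarrow> \<exists>c. \<rho> d *v v = c *s v"
      using red by (metis (no_types))
    obtain c where "\<rho> d1 *v v = c *s v" using v(2)[OF d1(1)] by blast
    then have c: "tf 1 0 0 *v v = c *s v" unfolding d1(2) A_mat_1 .
    have "\<i> * v $ 1 = c * v $ 1" "- \<i> * v $ 2 = c * v $ 2"
      using arg_cong[OF c, of "\<lambda>v. v $ 1"] arg_cong[OF c, of "\<lambda>v. v $ 2"]
      by (simp_all add: matrix_vector_nth)
    then have "v $ 1 = 0 \<or> v $ 2 = 0"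
      unfolding mult_cancel_right by (auto simp: complex_eq_iff)
    moreover have "v $ 1 \<noteq> 0 \<or> v $ 2 \<noteq> 0" using v(1) by (auto simp: vec_eq_iff forall_2)
    ultimately consider "v $ 1 = 0" "v $ 2 \<noteq> 0" | "v $ 2 = 0" "v $ 1 \<noteq> 0" by auto
    then show "upper \<rho> \<or> lower \<rho>"
    proof cases
      case 1
      have "\<rho> d $ 1 $ 2 = 0" if d: "d \<in> darts M" for d
        using v(2)[OF d] 1 by (auto simp: vec_eq_iff forall_2 matrix_vector_nth)
      then show ?thesis using lower_darts[OF assms(1)] by blast
    next
      case 2
      have "\<rho> d $ 2 $ 1 = 0" if d: "d \<in> darts M" for d
        using v(2)[OF d] 2 by (auto simp: vec_eq_iff forall_2 matrix_vector_nth)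
      then show ?thesis using upper_darts[OF assms(1)] by blast
    qed
  next
    assume "upper \<rho> \<or> lower \<rho>"
    then consider "\<forall>d\<in>darts M. \<rho> d $ 2 $ 1 = 0" | "\<forall>d\<in>darts M. \<rho> d $ 1 $ 2 = 0"
      using upper_darts lower_darts assms(1) by blast
    then show "reducible \<rho>"
      unfolding red
    proof cases
      case 1
      have "\<rho> d *v vector [1, 0] = \<rho> d $ 1 $ 1 *s vector [1, 0]" if "d \<in> darts M" for d
        using 1 that by (simp add: vec_eq_iff forall_2 matrix_vector_nth)
      moreover have "(vector [1, 0] :: complex^2) \<noteq> 0"
        by (simp add: vec_eq_iff forall_2)
      ultimately show "\<exists>v. v \<noteq> 0 \<and> (\<forall>d\<in>darts M. \<exists>c. \<rho> d *v v = c *s v)" by blast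
    next
      case 2
      have "\<rho> d *v vector [0, 1] = \<rho> d $ 2 $ 2 *s vector [0, 1]" if "d \<in> darts M" for d
        using 2 that by (simp add: vec_eq_iff forall_2 matrix_vector_nth)
      moreover have "(vector [0, 1] :: complex^2) \<noteq> 0"
        by (simp add: vec_eq_iff forall_2)
      ultimately show "\<exists>v. v \<noteq> 0 \<and> (\<forall>d\<in>darts M. \<exists>c. \<rho> d *v v = c *s v)" by blast
    qed
  qed
qed

lemma abelian_iff:
  assumes "\<rho> \<in> reps" "X \<rho> 1 = A_mat 1"
  shows "abelian \<rho> \<longleftrightarrow> upper \<rho> \<and> lower \<rho>"
proof -
  have ab: "abelian \<rho> \<longleftrightarrow> (\<forall>d\<in>darts M. \<forall>d'\<in>darts M. \<rho> d ** \<rho> d' = \<rho> d' ** \<rho> d)"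
    unfolding mont_abelian_def
    by (rule abelian_rep_iff) (rule trep_SL0[OF reps_trep[OF assms(1)]])
  obtain d1 where d1: "d1 \<in> darts M" "\<rho> d1 = A_mat 1"
    using X_dart[of 1] r_ge_1 assms(2) by (metis atLeastAtMost_iff order_refl)
  have comm: "N $ 1 $ 2 = 0 \<and> N $ 2 $ 1 = 0" if "A_mat 1 ** N = N ** A_mat 1" for N
    using that by (auto simp: A_mat_1 cmat_simps)
  show ?thesis
    unfolding ab upper_darts[OF assms(1)] lower_darts[OF assms(1)]
  proof
    assume "\<forall>d\<in>darts M. \<forall>d'\<in>darts M. \<rho> d ** \<rho> d' = \<rho> d' ** \<rho> d"
    then have "A_mat 1 ** \<rho> d = \<rho> d ** A_mat 1" if "d \<in> darts M" for d
      using d1 that by metis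
    then show "(\<forall>d\<in>darts M. \<rho> d $ 2 $ 1 = 0) \<and> (\<forall>d\<in>darts M. \<rho> d $ 1 $ 2 = 0)"
      using comm by blast
  next
    assume *: "(\<forall>d\<in>darts M. \<rho> d $ 2 $ 1 = 0) \<and> (\<forall>d\<in>darts M. \<rho> d $ 1 $ 2 = 0)"
    show "\<forall>d\<in>darts M. \<forall>d'\<in>darts M. \<rho> d ** \<rho> d' = \<rho> d' ** \<rho> d"
      using * by (intro ballI) (simp add: cmat_simps mult.commute)
  qed
qed

end

section \<open>The parameters of a normalized representation\<close>

lemma add_inverse_eq_iff:
  fixes s t :: complex
  assumes "s \<noteq> 0" "t \<noteq> 0"
  shows "s + inverse s = t + inverse t \<longleftrightarrow> s = t \<or> s = inverse t"
proof
  assume *: "s + inverse s = t + inverse t"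
  have "(s - t) * (s * t - 1) = s * t * ((s + inverse s) - (t + inverse t))"
    using assms by (simp add: field_simps)
  then have "s = t \<or> t * s = 1" using * by (simp add: mult.commute)
  then show "s = t \<or> s = inverse t"
    using inverse_unique[of t s] by auto
qed auto

lemma add_inverse_pm:
  fixes s e :: complex
  assumes "s \<noteq> 0" "e = 1 \<or> e = -1" "s + inverse s = 2 * e"
  shows "s = e"
proof -
  have "e \<noteq> 0" "e + inverse e = 2 * e" using assms(2) by auto
  then have "s = e \<or> s = inverse e" using add_inverse_eq_iff assms by metis
  then show ?thesis using assms(2) by auto
qed

lemma F_set_iff: "s \<in> F_set \<longleftrightarrow> norm s < 1 \<or> norm s = 1 \<and> 0 \<le> Im s"
proof
  assume "s \<in> F_set"
  then show "norm s < 1 \<or> norm s = 1 \<and> 0 \<le> Im s"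
    by (auto simp: F_set_def Im_exp sin_ge_zero)
next
  assume "norm s < 1 \<or> norm s = 1 \<and> 0 \<le> Im s"
  moreover have "s \<in> F_set" if "norm s = 1" "0 \<le> Im s"
  proof -
    have "s \<noteq> 0" using that by auto
    have "s = exp (\<i> * of_real (Arg s))"
      using Arg_eq[OF \<open>s \<noteq> 0\<close>] that by simp
    moreover have "0 \<le> Arg s" using Arg_less_0[of s] that by linarith
    ultimately show ?thesis unfolding F_set_def using Arg_le_pi by blast
  qed
  ultimately show "s \<in> F_set" by (auto simp: F_set_def)
qed

lemma pm1_in_F_set: "(1 :: complex) \<in> F_set" "(-1 :: complex) \<in> F_set"
  by (simp_all add: F_set_iff)

lemma Im_inverse_unit: "norm s = 1 \<Longrightarrow> Im (inverse s) = - Im s"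
  by (simp add: cmod_def Im_divide)

lemma F_set_cases:
  assumes "s \<noteq> 0" shows "s \<in> F_set \<or> inverse s \<in> F_set"
proof (cases "norm s = 1")
  case True
  then show ?thesis using Im_inverse_unit[OF True] by (auto simp: F_set_iff norm_inverse)
next
  case False
  then show ?thesis using assms by (auto simp: F_set_iff norm_inverse inverse_less_1_iff)
qed

lemma F_set_inj:
  assumes "s \<in> F_set" "t \<in> F_set" "s \<noteq> 0" "t \<noteq> 0" "s + inverse s = t + inverse t"
  shows "s = t"
proof (rule ccontr)
  assume "s \<noteq> t"
  then have st: "s = inverse t" using assms add_inverse_eq_iff by blast
  have "norm s \<le> 1" "norm t \<le> 1" using assms by (auto simp: F_set_iff)
  moreover have n: "norm s * norm t = 1" using st assms(4) by (simp add: norm_inverse)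
  ultimately have 1: "norm t = 1" "norm s = 1"
    by (metis mult_le_one norm_ge_zero mult.commute mult_left_le order_antisym)+
  have "Im s = - Im t" using Im_inverse_unit[OF 1(1)] st by simp
  with assms 1 have "Im s = 0" "Im t = 0" by (auto simp: F_set_iff)
  moreover have "t \<in> \<real>" using \<open>Im t = 0\<close> complex_is_Real_iff by blast
  then obtain x where "t = of_real x" by (auto elim: Reals_cases)
  with 1(1) have "t = 1 \<or> t = -1" by (auto simp: abs_if split: if_splits)
  with st \<open>s \<noteq> t\<close> show False by auto
qed

lemma F_set_representative:
  "\<exists>s. s \<in> F_set \<and> s \<noteq> 0 \<and> (t :: complex) = s + inverse s"
proof -
  obtain s where "s \<noteq> 0" "t = s + inverse s" using ex_add_inverse by blast
  then show ?thesis using F_set_cases[of s] by (metis add.commute inverse_inverse_eq nonzero_imp_inverse_nonzero)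
qed

lemma refl_seq_cancel:
  assumes "cheb s n \<noteq> 0" "refl_seq s X Y n = refl_seq s X Y' n" shows "Y = Y'"
  using assms by (simp add: refl_seq_def cmat_eq_iff)

lemma A_mat_add:
  "A_mat (u * s) + A_mat (u * inverse s) = (s + inverse s) *\<^sub>m A_mat u"
  unfolding A_mat_tf tf_add tf_scale tf_eq_iff
  by (simp add: algebra_simps add_divide_distrib diff_divide_distrib)

lemma refl_seq_A_mat:
  assumes "c \<noteq> 0" "s \<noteq> 0"
  shows "refl_seq s (A_mat c) (A_mat (c * s)) n = A_mat (c * s powi n)"
proof -
  have "A_mat (c * s powi (n + 1)) + A_mat (c * s powi (n - 1)) = (s + inverse s) *\<^sub>m A_mat (c * s powi n)" for n
    using A_mat_add[of "c * s powi n" s] assms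
    by (simp add: power_int_add power_int_diff divide_inverse mult.assoc)
  then have "A_mat (c * s powi n) = refl_seq s (A_mat c) (A_mat (c * s)) n"
    by (intro refl_seq_eqI[where f = "\<lambda>n. A_mat (c * s powi n)"]) (simp_all add: assms)
  then show ?thesis ..
qed

lemma refl_seq_pm:
  assumes "s = 1 \<or> s = -1"
  shows "refl_seq s X Y n = s powi n *\<^sub>m (X + of_int n *\<^sub>m (s *\<^sub>m Y - X))"
proof -
  have "cheb s n = of_int n * (s powi n * s)" "cheb s (n - 1) = of_int (n - 1) * s powi n"
    using assms by (auto simp: cheb_def power_int_diff)
  note c = this
  show ?thesis
    unfolding refl_seq_def c by (simp add: cmat_eq_iff algebra_simps)
qed

lemma cheb_eq_0_iff:
  assumes "s \<noteq> 0" "s \<noteq> 1" "s \<noteq> -1"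
  shows "cheb s n = 0 \<longleftrightarrow> s powi n * s powi n = 1"
proof -
  have "cheb s n = 0 \<longleftrightarrow> s powi n = inverse (s powi n)"
    using assms inverse_neq_self[of s] by (auto simp: cheb_def power_int_minus)
  then show ?thesis using assms by (simp add: field_simps)
qed

lemma cheb_shift:
  assumes "s \<noteq> 0" "s \<noteq> 1" "s \<noteq> -1" "s powi p * s powi p = 1"
  shows "cheb s (n - p) = s powi p * cheb s n"
proof -
  have "inverse (s powi p) = s powi p" using assms(4) by (rule inverse_unique)
  then have "s powi (n - p) = s powi p * s powi n" "s powi (- (n - p)) = s powi p * s powi (- n)"
    using assms(1) by (simp_all add: power_int_diff power_int_minus divide_inverse)
  then show ?thesis using assms unfolding cheb_def by (simp add: algebra_simps diff_divide_distrib)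
qed

lemma refl_seq_shift_period:
  assumes "s \<noteq> 0" "s \<noteq> 1" "s \<noteq> -1" "s powi p * s powi p = 1"
  shows "refl_seq s X Y (n - p) = s powi p *\<^sub>m refl_seq s X Y n"
proof -
  have e: "n - p - 1 = n - 1 - p" by simp
  show ?thesis
    unfolding refl_seq_def e cheb_shift[OF assms] by (simp add: cmat_eq_iff algebra_simps)
qed

lemma coprime_powers_pm1:
  fixes s :: complex
  assumes "s \<noteq> 0" "pt * q - p * qt = 1" "s powi p * s powi p = 1" "s powi q * s powi q = 1"
  shows "s = 1 \<or> s = -1"
proof -
  have "(s * s) powi p = 1" "(s * s) powi q = 1" using assms by (simp_all add: power_int_mult_distrib)
  moreover have "(s * s) powi (pt * q - p * qt) = ((s * s) powi q) powi pt / ((s * s) powi p) powi qt"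
    using assms(1) by (simp add: power_int_diff mult.commute[of pt q] del: power_int_mult_distrib) (simp only: power_int_mult)
  ultimately have "s * s = 1" using assms(2) by simp
  then show ?thesis using square_eq_1_iff by blast
qed

lemma diag_conj_to_A_mat:
  assumes "N \<in> SL0" "w \<noteq> 0" "w \<noteq> 1" "w \<noteq> -1" "bil (A_mat 1) N = w + inverse w"
  obtains t where "t \<noteq> 0" "diag_mat t ** N ** matrix_inv (diag_mat t) = A_mat w"
proof -
  obtain x y z where N: "N = tf x y z" "x\<^sup>2 - y * z = 1" using assms(1) SL0_obtain_tf by blast
  have "2 * x = w + inverse w" using assms(5) by (simp add: N A_mat_1)
  then have x: "x = (w + inverse w) / 2" by (simp only: eq_divide_eq_numeral1 mult.commute) simp
  define k where "k = (w - inverse w) / 2"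
  have k0: "k \<noteq> 0" using inverse_neq_self[of w] assms by (simp add: k_def)
  have "x\<^sup>2 - k\<^sup>2 = 1" using assms(2) by (simp add: x k_def field_simps power2_eq_square)
  then have yz: "y * z = k * k" using N(2) by (simp add: power2_eq_square algebra_simps)
  then have y0: "y \<noteq> 0" using k0 by auto
  define t where "t = csqrt (k / y)"
  have t2: "t\<^sup>2 = k / y" and t0: "t \<noteq> 0" using y0 k0 by (simp_all add: t_def)
  have "diag_mat t ** N ** matrix_inv (diag_mat t) = tf x (k / y * y) (z / (k / y))"
    unfolding N(1) diag_mat_conj[OF t0] t2 ..
  also have "\<dots> = tf x k k" using y0 k0 yz by (simp add: field_simps)
  also have "\<dots> = A_mat w" by (simp add: A_mat_tf x k_def)
  finally show thesis using that t0 by blast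
qed

lemma diag_conj_fixes_A_mat:
  assumes "t \<noteq> 0" "w \<noteq> 0" "w \<noteq> 1" "w \<noteq> -1" "e \<noteq> 0"
    and "diag_mat t ** (e *\<^sub>m A_mat w) ** matrix_inv (diag_mat t) = e *\<^sub>m A_mat w"
  shows "t\<^sup>2 = 1"
proof -
  have "w - inverse w \<noteq> 0" using inverse_neq_self[of w] assms by simp
  then show ?thesis using assms(5,6) by (simp add: A_mat_tf diag_mat_conj[OF assms(1)])
qed

lemma diag_conj_square_1:
  assumes "t\<^sup>2 = 1" "N \<in> SL0" shows "diag_mat t ** N ** matrix_inv (diag_mat t) = N"
proof -
  have "t \<noteq> 0" using assms(1) by auto
  then show ?thesis using assms by (auto elim!: SL0_obtain_tf simp: diag_mat_conj)
qed

context montesinos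
begin

lemma normalized_iff: "normal \<rho> a \<longleftrightarrow> \<rho> \<in> reps \<and> X \<rho> 1 = A_mat 1 \<and> a \<in> F_set \<and> a \<noteq> 0 \<and>
    bil (X \<rho> 1) (Z \<rho> 1) = a + inverse a"
  using tr_h_eq[of \<rho>] by (auto simp: normalized_def)

lemma s_values_iff: "s_vals \<rho> a s \<longleftrightarrow> s \<in> extensional {1..r} \<and> (\<forall>l\<in>{1..r}. s l \<noteq> 0 \<and>
    bil (X \<rho> l) (Y \<rho> l) = s l + inverse (s l) \<and> ep l * s l powi p l = a)"
  by (auto simp: s_values_def bil_def PiE_def)

lemma ep_sign: "ep l = 1 \<or> ep l = -1" and eq_sign: "eq l = 1 \<or> eq l = -1"
  by (cases "even (pt l)"; simp) (cases "even (qt l - 1)"; simp)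

lemma ep_pow_cases:
  assumes "normal \<rho> a" "l \<in> {1..r}" "w \<noteq> 0" "bil (X \<rho> l) (Y \<rho> l) = w + inverse w"
  shows "ep l * w powi p l = a \<or> ep l * w powi p l = inverse a"
proof -
  have n: "\<rho> \<in> reps" "a \<noteq> 0" "bil (X \<rho> 1) (Z \<rho> 1) = a + inverse a"
    using assms(1) normalized_iff by blast+
  have "inverse (ep l * w powi p l) = ep l * w powi (- p l)"
    using ep_sign[of l] by (auto simp: power_int_minus)
  moreover have "ep l * pow_sum w (p l) = a + inverse a"
    using bil_X_Z(1)[OF n(1) assms(2-4)] bil_X_Z_const[OF n(1) assms(2)] n(3) by simp
  ultimately have "ep l * w powi p l + inverse (ep l * w powi p l) = a + inverse a"
    by (simp add: pow_sum_def algebra_simps)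
  moreover have "ep l * w powi p l \<noteq> 0" using assms(3) ep_sign[of l] by auto
  ultimately show ?thesis using add_inverse_eq_iff n(2) by blast
qed

lemma s_values_exist_F:
  assumes "normal \<rho> a"
  shows "\<exists>s. s_vals \<rho> a s \<and> (a = 1 \<or> a = -1 \<longrightarrow> (\<forall>l\<in>{1..r}. s l \<in> F_set))"
proof -
  have "\<exists>w. w \<noteq> 0 \<and> bil (X \<rho> l) (Y \<rho> l) = w + inverse w \<and> ep l * w powi p l = a \<and> (a = 1 \<or> a = -1 \<longrightarrow> w \<in> F_set)"
    if l: "l \<in> {1..r}" for l
  proof -
    obtain w where w: "w \<in> F_set" "w \<noteq> 0" "bil (X \<rho> l) (Y \<rho> l) = w + inverse w" using F_set_representative by blast
    show ?thesis
    proof (cases "ep l * w powi p l = a")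
      case True
      then show ?thesis using w by blast
    next
      case False
      then have inv: "ep l * w powi p l = inverse a" using ep_pow_cases[OF assms l w(2,3)] by blast
      then have "ep l * inverse w powi p l = a"
        using ep_sign[of l] by (auto simp: power_int_inverse minus_equation_iff)
          (metis inverse_inverse_eq inverse_minus_eq)
      moreover have "\<not> (a = 1 \<or> a = -1)" using False inv by auto
      ultimately show ?thesis using w by (intro exI[of _ "inverse w"]) simp
    qed
  qed
  then obtain s where "\<And>l. l \<in> {1..r} \<Longrightarrow> s l \<noteq> 0 \<and> bil (X \<rho> l) (Y \<rho> l) = s l + inverse (s l) \<and>
      ep l * s l powi p l = a \<and> (a = 1 \<or> a = -1 \<longrightarrow> s l \<in> F_set)"
    by metis
  then show ?thesis by (intro exI[of _ "restrict s {1..r}"]) (simp add: s_values_iff)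
qed

lemma s_values_exist: "normal \<rho> a \<Longrightarrow> \<exists>s. s_vals \<rho> a s"
  using s_values_exist_F by blast

lemma s_values_F_unique:
  assumes "s_vals \<rho> a s" "s_vals \<rho> a s'" "\<forall>l\<in>{1..r}. s l \<in> F_set" "\<forall>l\<in>{1..r}. s' l \<in> F_set"
  shows "s = s'"
proof (rule extensionalityI[where A = "{1..r}"])
  fix l assume l: "l \<in> {1..r}"
  have "s l \<noteq> 0" "s' l \<noteq> 0" "bil (X \<rho> l) (Y \<rho> l) = s l + inverse (s l)"
    "bil (X \<rho> l) (Y \<rho> l) = s' l + inverse (s' l)"
    using assms(1,2) l unfolding s_values_iff by blast+
  with assms(3,4) l show "s l = s' l" using F_set_inj by metis
next
  show "s \<in> extensional {1..r}" "s' \<in> extensional {1..r}"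
    using assms unfolding s_values_iff by blast+
qed

lemma s_values_generic_unique:
  assumes "s_vals \<rho> a s" "s_vals \<rho> a s'" "a \<noteq> 1" "a \<noteq> -1"
  shows "s = s'"
proof (rule extensionalityI[where A = "{1..r}"])
  fix l assume l: "l \<in> {1..r}"
  have s0: "s l \<noteq> 0" "s' l \<noteq> 0" "bil (X \<rho> l) (Y \<rho> l) = s l + inverse (s l)"
    "bil (X \<rho> l) (Y \<rho> l) = s' l + inverse (s' l)"
    "ep l * s l powi p l = a" "ep l * s' l powi p l = a"
    using assms(1,2) l unfolding s_values_iff by blast+
  then have s: "s l \<noteq> 0" "s' l \<noteq> 0" "s l + inverse (s l) = s' l + inverse (s' l)"
    "ep l * s l powi p l = a" "ep l * s' l powi p l = a"
    by simp_all
  show "s l = s' l"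
  proof (rule ccontr)
    assume "s l \<noteq> s' l"
    then have "s l = inverse (s' l)" using s add_inverse_eq_iff by blast
    then have "s l * s' l = 1" using s(2) by simp
    then have "s l powi p l * s' l powi p l = 1"
      by (metis power_int_1_left power_int_mult_distrib)
    moreover have "a * a = (ep l * s l powi p l) * (ep l * s' l powi p l)"
      by (simp only: s(4,5))
    then have "a * a = (ep l * ep l) * (s l powi p l * s' l powi p l)"
      by (simp only: mult_ac)
    moreover have "ep l * ep l = 1" by (simp add: pm1_powi_sq)
    ultimately have "a * a = 1" by simp
    then show False using assms(3,4) square_eq_1_iff by blast
  qed
next
  show "s \<in> extensional {1..r}" "s' \<in> extensional {1..r}"
    using assms(1,2) unfolding s_values_iff by blast+
qed

definition acc :: "(nat \<Rightarrow> complex) \<Rightarrow> nat \<Rightarrow> complex" where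
  "acc s l = (\<Prod>j=1..<l. eq j * s j powi q j)"

lemma acc_1 [simp]: "acc s (Suc 0) = 1"
  by (simp add: acc_def)

lemma acc_Suc: "1 \<le> l \<Longrightarrow> acc s (Suc l) = acc s l * (eq l * s l powi q l)"
  by (simp add: acc_def)

lemma acc_nonzero: "(\<And>j. j \<in> {1..<l} \<Longrightarrow> s j \<noteq> 0) \<Longrightarrow> acc s l \<noteq> 0"
  by (auto simp: acc_def)

lemma acc_sign:
  assumes "\<And>j. j \<in> {1..<l} \<Longrightarrow> s j \<in> {1, -1}" shows "acc s l = 1 \<or> acc s l = -1"
  using assms
proof (induction l)
  case (Suc l)
  show ?case
  proof (cases "l = 0")
    case False
    then have "s l = 1 \<or> s l = -1" "acc s l = 1 \<or> acc s l = -1" using Suc by auto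
    moreover from this have "s l powi q l = 1 \<or> s l powi q l = -1"
      by (cases "even (q l)") auto
    ultimately show ?thesis using False eq_sign[of l] by (auto simp: acc_Suc)
  qed (simp add: acc_def)
qed (simp add: acc_def)

end

locale coded_rep = montesinos +
  fixes \<rho> a s
  assumes normalized: "normalized r ks \<rho> a" and s_values: "s_values r ks \<rho> a s"
begin

lemma rep: "\<rho> \<in> reps" and X_1: "X \<rho> 1 = A_mat 1" and a_nonzero: "a \<noteq> 0"
  using normalized by (auto simp: normalized_iff)

lemma s_nonzero: "l \<in> {1..r} \<Longrightarrow> s l \<noteq> 0"
  and bil_X_Y: "l \<in> {1..r} \<Longrightarrow> bil (X \<rho> l) (Y \<rho> l) = s l + inverse (s l)"
  and s_pow: "l \<in> {1..r} \<Longrightarrow> ep l * s l powi p l = a"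
  using s_values by (auto simp: s_values_iff)

lemma s_pow': "l \<in> {1..r} \<Longrightarrow> s l powi p l = ep l * a"
  using s_pow[of l] ep_sign[of l] by auto

lemma corner_values:
  assumes "l \<in> {1..r}"
  shows "Z \<rho> l = ep l *\<^sub>m refl_seq (s l) (X \<rho> l) (Y \<rho> l) (- p l)"
    "X \<rho> (Suc l) = eq l *\<^sub>m refl_seq (s l) (X \<rho> l) (Y \<rho> l) (q l)"
    "Z \<rho> (Suc l) = (ep l * eq l) *\<^sub>m refl_seq (s l) (X \<rho> l) (Y \<rho> l) (q l - p l)"
  using part_values[OF rep assms s_nonzero[OF assms] bil_X_Y[OF assms]] by blast+

lemma reducible_s_pm:
  assumes "l \<in> {1..r}" "X \<rho> l = e *\<^sub>m A_mat 1" "e = 1 \<or> e = -1" "upper \<rho> \<or> lower \<rho>"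
  shows "s l \<in> {1, -1}"
proof -
  obtain x y z where Y: "Y \<rho> l = tf x y z" "x\<^sup>2 - y * z = 1"
    using SL0_obtain_tf[OF Y_SL0[OF rep assms(1)]] by blast
  have "Y \<rho> l $ 2 $ 1 = 0 \<or> Y \<rho> l $ 1 $ 2 = 0" using assms(1,4) upper_def lower_def by blast
  then have "y * z = 0" by (auto simp: Y(1))
  with Y(2) have "x\<^sup>2 = 1" by algebra
  then have x: "x = 1 \<or> x = -1" by (simp add: power2_eq_1_iff)
  have "s l + inverse (s l) = 2 * (e * x)"
    using bil_X_Y[OF assms(1), symmetric] by (simp add: assms(2) Y A_mat_1 bil_linear)
  moreover have "e * x = 1 \<or> e * x = -1" using assms(3) x by auto
  ultimately have "s l = e * x" using add_inverse_pm[OF s_nonzero[OF assms(1)], of "e * x"] by argo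
  then show ?thesis using \<open>e * x = 1 \<or> e * x = -1\<close> by simp
qed

subsection \<open>The case of a different from 1 and -1\<close>

lemma generic_s:
  assumes "a \<noteq> 1" "a \<noteq> -1" "l \<in> {1..r}" shows "s l \<noteq> 1" "s l \<noteq> -1" "cheb (s l) (- p l) \<noteq> 0"
proof -
  have "a * a \<noteq> 1" using assms(1,2) square_eq_1_iff by blast
  then have *: "s l powi p l * s l powi p l \<noteq> 1"
    using s_pow'[OF assms(3)] ep_sign[of l] by auto
  then show 1: "s l \<noteq> 1" "s l \<noteq> -1"
    using pm1_powi_sq by auto
  show "cheb (s l) (- p l) \<noteq> 0"
    using * by (simp add: cheb_eq_0_iff[OF s_nonzero[OF assms(3)] 1] power_int_minus flip: inverse_mult_distrib)
qed

lemma generic_irreducible: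
  assumes "a \<noteq> 1" "a \<noteq> -1" shows "\<not> reducible \<rho>"
  using generic_s[OF assms, of 1] reducible_s_pm[of 1 1] r_ge_1 reducible_iff[OF rep X_1] X_1 by auto

lemma generic_values:
  assumes "a \<noteq> 1" "a \<noteq> -1" "Y \<rho> 1 = A_mat (s 1)"
  shows "l \<in> {1..r} \<Longrightarrow> X \<rho> l = A_mat (acc s l) \<and> Y \<rho> l = A_mat (acc s l * s l)" "acc s (Suc r) = 1"
proof -
  have acc0: "acc s l \<noteq> 0" if "l \<le> Suc r" for l
    using that s_nonzero by (intro acc_nonzero) auto
  have scaleA: "e *\<^sub>m A_mat c = A_mat (e * c)" if "e = 1 \<or> e = -1" for e c
    using that A_mat_minus by auto
  have Y_if: "Y \<rho> l = A_mat (acc s l * s l)"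
    if l: "l \<in> {1..r}" and XZ: "X \<rho> l = A_mat (acc s l)" "Z \<rho> l = A_mat (acc s l / a)" for l
  proof -
    have "ep l *\<^sub>m refl_seq (s l) (A_mat (acc s l)) (A_mat (acc s l * s l)) (- p l) = A_mat (ep l * (acc s l * s l powi (- p l)))"
      using l s_nonzero acc0 ep_sign[of l] by (subst refl_seq_A_mat) (auto simp: scaleA)
    also have "ep l * (acc s l * s l powi (- p l)) = acc s l / a"
      using s_pow[OF l, symmetric] ep_sign[of l] by (auto simp: power_int_minus divide_inverse)
    finally have "ep l *\<^sub>m refl_seq (s l) (X \<rho> l) (Y \<rho> l) (- p l) = ep l *\<^sub>m refl_seq (s l) (X \<rho> l) (A_mat (acc s l * s l)) (- p l)"
      using corner_values(1)[OF l] XZ by simp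
    then have "refl_seq (s l) (X \<rho> l) (Y \<rho> l) (- p l) = refl_seq (s l) (X \<rho> l) (A_mat (acc s l * s l)) (- p l)"
      by (simp add: cmat_eq_iff)
    then show ?thesis
      using generic_s[OF assms(1,2) l] refl_seq_cancel by blast
  qed
  have step: "X \<rho> (Suc l) = A_mat (acc s (Suc l)) \<and> Z \<rho> (Suc l) = A_mat (acc s (Suc l) / a)"
    if l: "l \<in> {1..r}" and XY: "X \<rho> l = A_mat (acc s l)" "Y \<rho> l = A_mat (acc s l * s l)" for l
  proof -
    have n0: "acc s l \<noteq> 0" "s l \<noteq> 0" using l acc0 s_nonzero by auto
    have sgn: "ep l * eq l = 1 \<or> ep l * eq l = -1" using ep_sign[of l] eq_sign[of l] by auto
    have "X \<rho> (Suc l) = A_mat (acc s (Suc l))"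
      unfolding corner_values(2)[OF l] XY refl_seq_A_mat[OF n0] scaleA[OF eq_sign]
      using l by (simp add: acc_Suc mult_ac)
    moreover have "ep l * eq l * (acc s l * s l powi (q l - p l)) = acc s (Suc l) / a"
      using l n0 s_pow[OF l, symmetric] ep_sign[of l] by (auto simp: acc_Suc power_int_diff)
    then have "Z \<rho> (Suc l) = A_mat (acc s (Suc l) / a)"
      unfolding corner_values(3)[OF l] XY refl_seq_A_mat[OF n0] scaleA[OF sgn] by simp
    ultimately show ?thesis ..
  qed
  have main: "X \<rho> l = A_mat (acc s l) \<and> Y \<rho> l = A_mat (acc s l * s l)" if "1 \<le> l" "l \<le> r" for l
    using that
  proof (induction l rule: nat_induct_at_least)
    case base
    then show ?case using X_1 assms(3) by simp
  next
    case (Suc l)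
    then have "X \<rho> (Suc l) = A_mat (acc s (Suc l)) \<and> Z \<rho> (Suc l) = A_mat (acc s (Suc l) / a)"
      by (intro step) auto
    then show ?case using Y_if[of "Suc l"] Suc by auto
  qed
  then show "l \<in> {1..r} \<Longrightarrow> X \<rho> l = A_mat (acc s l) \<and> Y \<rho> l = A_mat (acc s l * s l)" by auto
  have "A_mat (acc s (Suc r)) = A_mat 1"
    using step[of r] main[of r] r_ge_1 X_Suc_r[of \<rho>] X_1 by simp
  then show "acc s (Suc r) = 1" by (rule A_mat_inj)
qed

subsection \<open>The case of a equal to 1 or -1\<close>

definition nilp :: "nat \<Rightarrow> cmat" where
  "nilp l = (if s l \<in> {1, -1} then s l *\<^sub>m Y \<rho> l - X \<rho> l else 0)"

lemma ne_nw:
  assumes "a = 1 \<or> a = -1" "l \<in> {1..r}"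
  shows "Z \<rho> l - a *\<^sub>m X \<rho> l = (- a * of_int (p l)) *\<^sub>m nilp l"
    "Z \<rho> (Suc l) - a *\<^sub>m X \<rho> (Suc l) = (- a * of_int (p l) * (eq l * s l powi q l)) *\<^sub>m nilp l"
    "s l \<in> {1, -1} \<Longrightarrow> X \<rho> (Suc l) = (eq l * s l powi q l) *\<^sub>m (X \<rho> l + of_int (q l) *\<^sub>m nilp l)"
proof -
  note v = corner_values[OF assms(2)]
  show *: "s l \<in> {1, -1} \<Longrightarrow> X \<rho> (Suc l) = (eq l * s l powi q l) *\<^sub>m (X \<rho> l + of_int (q l) *\<^sub>m nilp l)"
    unfolding v nilp_def using refl_seq_pm[of "s l"] by (auto simp: cmat_eq_iff)
  have "(Z \<rho> l - a *\<^sub>m X \<rho> l = (- a * of_int (p l)) *\<^sub>m nilp l) \<and>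
    (Z \<rho> (Suc l) - a *\<^sub>m X \<rho> (Suc l) = (- a * of_int (p l) * (eq l * s l powi q l)) *\<^sub>m nilp l)"
  proof (cases "s l \<in> {1, -1}")
    case True
    then have pm: "s l = 1 \<or> s l = -1" by simp
    have e: "ep l * s l powi (- p l) = a" "s l powi (q l - p l) = s l powi q l * s l powi (- p l)"
      using s_pow[OF assms(2)] pm by (auto simp: power_int_minus power_int_diff divide_inverse pm1_inverse)
    have Zl: "Z \<rho> l = a *\<^sub>m (X \<rho> l + of_int (- p l) *\<^sub>m nilp l)"
      unfolding v(1) refl_seq_pm[OF pm] e(1)[symmetric] using True by (simp add: nilp_def cmat_eq_iff)
    have ZS: "Z \<rho> (Suc l) = (eq l * s l powi q l * a) *\<^sub>m (X \<rho> l + of_int (q l - p l) *\<^sub>m nilp l)"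
      unfolding v(3) refl_seq_pm[OF pm] e using True
      by (simp add: nilp_def cmat_eq_iff e(1)[symmetric] mult_ac)
    show ?thesis
      unfolding Zl ZS *[OF True] by (simp add: cmat_eq_iff algebra_simps)
  next
    case False
    have "a * a = 1" using assms(1) by auto
    then have per: "s l powi p l * s l powi p l = 1"
      using s_pow'[OF assms(2)] ep_sign[of l] by auto
    note shift = refl_seq_shift_period[OF s_nonzero[OF assms(2)] _ _ per, of "X \<rho> l" "Y \<rho> l"]
    have "Z \<rho> l = a *\<^sub>m X \<rho> l"
      using shift[of 0] False s_pow[OF assms(2)] s_nonzero[OF assms(2)] unfolding v(1)
      by (auto simp: refl_seq_0 cmat_eq_iff simp flip: mult.assoc)
    moreover have "Z \<rho> (Suc l) = a *\<^sub>m X \<rho> (Suc l)"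
      using shift[of "q l"] False unfolding v(2,3) s_pow[OF assms(2), symmetric]
      by (auto simp: cmat_eq_iff mult_ac)
    ultimately show ?thesis using False by (simp add: nilp_def cmat_eq_iff)
  qed
  then show "Z \<rho> l - a *\<^sub>m X \<rho> l = (- a * of_int (p l)) *\<^sub>m nilp l"
    "Z \<rho> (Suc l) - a *\<^sub>m X \<rho> (Suc l) = (- a * of_int (p l) * (eq l * s l powi q l)) *\<^sub>m nilp l"
    by blast+
qed

lemma nilp_step:
  assumes "a = 1 \<or> a = -1" "l \<in> {1..r}" "Suc l \<in> {1..r}"
  shows "(of_int (p (Suc l))) *\<^sub>m nilp (Suc l) = (eq l * s l powi q l * of_int (p l)) *\<^sub>m nilp l"
proof -
  have "(- a * of_int (p (Suc l))) *\<^sub>m nilp (Suc l) = (- a * of_int (p l) * (eq l * s l powi q l)) *\<^sub>m nilp l"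
    using ne_nw(2)[OF assms(1,2)] ne_nw(1)[OF assms(1,3)] by simp
  then show ?thesis using a_nonzero by (auto simp: cmat_eq_iff)
qed

lemma nilp_values:
  assumes "a = 1 \<or> a = -1" "l \<in> {1..r}"
  shows "of_int (p l) *\<^sub>m nilp l = (acc s l * of_int (p 1)) *\<^sub>m nilp 1"
proof -
  have "1 \<le> l" "l \<le> r" using assms by auto
  then show ?thesis
  proof (induction l rule: nat_induct_at_least)
    case (Suc l)
    have "of_int (p (Suc l)) *\<^sub>m nilp (Suc l) = (eq l * s l powi q l) *\<^sub>m (of_int (p l) *\<^sub>m nilp l)"
      using nilp_step[OF assms(1), of l] Suc by (simp add: cmat_eq_iff mult_ac)
    also have "\<dots> = (acc s (Suc l) * of_int (p 1)) *\<^sub>m nilp 1"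
      using Suc by (simp add: acc_Suc cmat_eq_iff)
    finally show ?case .
  qed (simp add: cmat_eq_iff)
qed

lemma nilp_all_0:
  assumes "a = 1 \<or> a = -1" "nilp 1 = 0" "l \<in> {1..r}" shows "nilp l = 0"
  using nilp_values[OF assms(1,3)] p_nonzero[OF assms(3)] assms(2) by (auto simp: cmat_eq_iff)

lemma flat_values:
  assumes "a = 1 \<or> a = -1" "nilp 1 = 0" "l \<in> {1..r}" "s l \<in> {1, -1}"
  shows "Y \<rho> l = s l *\<^sub>m X \<rho> l" "X \<rho> (Suc l) = (eq l * s l powi q l) *\<^sub>m X \<rho> l"
proof -
  have "Y \<rho> l = s l *\<^sub>m (s l *\<^sub>m Y \<rho> l)" using assms(4) by (auto simp: cmat_eq_iff)
  also have "s l *\<^sub>m Y \<rho> l = X \<rho> l" using nilp_all_0[OF assms(1-3)] assms(4) by (simp add: nilp_def)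
  finally show "Y \<rho> l = s l *\<^sub>m X \<rho> l" .
  show "X \<rho> (Suc l) = (eq l * s l powi q l) *\<^sub>m X \<rho> l"
    using nilp_all_0[OF assms(1-3)] ne_nw(3)[OF assms(1,3,4)] by (simp add: cmat_eq_iff)
qed

lemma flat_X:
  assumes "a = 1 \<or> a = -1" "nilp 1 = 0" "1 \<le> h" "h \<le> Suc r" "\<And>l. l \<in> {1..<h} \<Longrightarrow> s l \<in> {1, -1}"
  shows "X \<rho> h = acc s h *\<^sub>m A_mat 1"
  using assms(3-5)
proof (induction h rule: nat_induct_at_least)
  case base
  then show ?case using X_1 by simp
next
  case (Suc h)
  then have "X \<rho> (Suc h) = (eq h * s h powi q h) *\<^sub>m X \<rho> h"
    by (intro flat_values(2)[OF assms(1,2)]) auto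
  then show ?case using Suc by (simp add: acc_Suc cmat_eq_iff)
qed

lemma flat_pm:
  assumes "a = 1 \<or> a = -1" "nilp 1 = 0" "\<And>l. l \<in> {1..r} \<Longrightarrow> s l \<in> {1, -1}"
  shows "l \<in> {1..r} \<Longrightarrow> X \<rho> l = acc s l *\<^sub>m A_mat 1 \<and> Y \<rho> l = (s l * acc s l) *\<^sub>m A_mat 1"
    "upper \<rho> \<and> lower \<rho>"
proof -
  show *: "X \<rho> l = acc s l *\<^sub>m A_mat 1 \<and> Y \<rho> l = (s l * acc s l) *\<^sub>m A_mat 1" if "l \<in> {1..r}" for l
    using flat_X[OF assms(1,2), of l] flat_values(1)[OF assms(1,2) that assms(3)[OF that]] assms(3) that
    by (auto simp: cmat_eq_iff)
  then show "upper \<rho> \<and> lower \<rho>" by (simp add: upper_def lower_def A_mat_1)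
qed

lemma flat_irreducible:
  assumes "a = 1 \<or> a = -1" "nilp 1 = 0" "\<exists>l\<in>{1..r}. s l \<notin> {1, -1}"
  obtains h where "h \<in> {1..r}" "\<And>l. l \<in> {1..<h} \<Longrightarrow> s l \<in> {1, -1}" "s h \<notin> {1, -1}"
    "X \<rho> h = acc s h *\<^sub>m A_mat 1" "\<not> upper \<rho>" "\<not> lower \<rho>"
proof -
  define h where "h = (LEAST l. l \<in> {1..r} \<and> s l \<notin> {1, -1})"
  have h: "h \<in> {1..r} \<and> s h \<notin> {1, -1}"
    unfolding h_def by (rule LeastI_ex) (use assms(3) in blast)
  have lt: "s l \<in> {1, -1}" if "l \<in> {1..<h}" for l
    using not_less_Least[of l "\<lambda>l. l \<in> {1..r} \<and> s l \<notin> {1, -1}", folded h_def] that h by auto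
  have X: "X \<rho> h = acc s h *\<^sub>m A_mat 1"
    by (rule flat_X[OF assms(1,2)]) (use h lt in auto)
  have "\<not> (upper \<rho> \<or> lower \<rho>)"
    using reducible_s_pm[OF _ X acc_sign] h lt by blast
  with that[OF _ lt _ X] h show thesis by blast
qed

definition slope :: "nat \<Rightarrow> complex" where
  "slope l = (\<Sum>j=1..<l. of_int (q j) / of_int (p j))"

lemma slope_Suc: "1 \<le> l \<Longrightarrow> slope (Suc l) = slope l + of_int (q l) / of_int (p l)"
  by (simp add: slope_def)

lemma slope_mu: "slope (Suc r) = of_real (mu r ks)"
  by (simp add: slope_def mu_def atLeastLessThanSuc_atLeastAtMost)

lemma parabolic_values:
  assumes "a = 1 \<or> a = -1" "nilp 1 \<noteq> 0"
  shows "l \<in> {1..r} \<Longrightarrow> s l \<in> {1, -1}"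
    "l \<in> {1..Suc r} \<Longrightarrow> X \<rho> l = acc s l *\<^sub>m (A_mat 1 + (slope l * of_int (p 1)) *\<^sub>m nilp 1)"
    "l \<in> {1..r} \<Longrightarrow> Y \<rho> l = (s l * acc s l) *\<^sub>m
       (A_mat 1 + (slope l * of_int (p 1) + of_int (p 1) / of_int (p l)) *\<^sub>m nilp 1)"
    "mu r ks = 0" "acc s (Suc r) = 1" "upper \<rho> \<or> lower \<rho>" "\<not> (upper \<rho> \<and> lower \<rho>)"
    "\<exists>y z. nilp 1 = tf 0 y z \<and> y * z = 0"
proof -
  have r1: "1 \<in> {1..r}" using r_ge_1 by simp
  show pm: "s l \<in> {1, -1}" if l: "l \<in> {1..r}" for l
  proof (rule ccontr)
    assume "s l \<notin> {1, -1}"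
    then have "nilp l = 0" by (simp add: nilp_def)
    moreover have "acc s l \<noteq> 0" using l s_nonzero by (intro acc_nonzero) auto
    ultimately show False
      using nilp_values[OF assms(1) l] p_nonzero[OF r1] assms(2) by (auto simp: cmat_eq_iff)
  qed
  have nilp_l: "nilp l = (acc s l * of_int (p 1) / of_int (p l)) *\<^sub>m nilp 1" if l: "l \<in> {1..r}" for l
    using nilp_values[OF assms(1) l] p_nonzero[OF l] by (auto simp: cmat_eq_iff field_simps)
  have X: "X \<rho> l = acc s l *\<^sub>m (A_mat 1 + (slope l * of_int (p 1)) *\<^sub>m nilp 1)" if "1 \<le> l" "l \<le> Suc r" for l
    using that
  proof (induction l rule: nat_induct_at_least)
    case base
    show ?case using X_1 by (simp add: slope_def cmat_eq_iff)
  next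
    case (Suc l)
    then have l: "l \<in> {1..r}" by auto
    have "X \<rho> (Suc l) = (eq l * s l powi q l) *\<^sub>m (X \<rho> l + of_int (q l) *\<^sub>m nilp l)"
      by (rule ne_nw(3)[OF assms(1) l pm[OF l]])
    also have "X \<rho> l + of_int (q l) *\<^sub>m nilp l =
       acc s l *\<^sub>m (A_mat 1 + ((slope l + of_int (q l) / of_int (p l)) * of_int (p 1)) *\<^sub>m nilp 1)"
      unfolding nilp_l[OF l] using Suc by (simp add: cmat_eq_iff algebra_simps)
    finally show ?case using Suc by (simp add: acc_Suc slope_Suc cmat_eq_iff)
  qed
  then show "l \<in> {1..Suc r} \<Longrightarrow> X \<rho> l = acc s l *\<^sub>m (A_mat 1 + (slope l * of_int (p 1)) *\<^sub>m nilp 1)"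
    by auto
  show Y: "Y \<rho> l = (s l * acc s l) *\<^sub>m
       (A_mat 1 + (slope l * of_int (p 1) + of_int (p 1) / of_int (p l)) *\<^sub>m nilp 1)" if l: "l \<in> {1..r}" for l
  proof -
    have "Y \<rho> l = s l *\<^sub>m (X \<rho> l + nilp l)"
      using pm[OF l] by (auto simp: nilp_def cmat_eq_iff)
    also have "X \<rho> l + nilp l = acc s l *\<^sub>m
       (A_mat 1 + (slope l * of_int (p 1) + of_int (p 1) / of_int (p l)) *\<^sub>m nilp 1)"
      unfolding nilp_l[OF l] using X[of l] l by (simp add: cmat_eq_iff algebra_simps)
    finally show ?thesis by (simp add: cmat_eq_iff)
  qed
  have ss: "s 1 * s 1 = 1" "inverse (s 1) = s 1" using pm[OF r1] by auto
  obtain x y z where YT: "Y \<rho> 1 = tf x y z" "x\<^sup>2 - y * z = 1"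
    using SL0_obtain_tf[OF Y_SL0[OF rep r1]] by blast
  have "2 * x = s 1 + inverse (s 1)"
    using bil_X_Y[OF r1] unfolding X_1 YT(1) by (simp add: A_mat_1)
  then have x: "x = s 1" using ss by simp
  have n1: "nilp 1 = tf 0 (s 1 * y) (s 1 * z)"
    using pm[OF r1] ss unfolding nilp_def X_1 YT(1) x A_mat_1 by simp
  have yz: "y * z = 0" using YT(2) ss by (simp add: x power2_eq_square)
  then have yz': "(s 1 * y) * (s 1 * z) = 0" by auto
  show "\<exists>y z. nilp 1 = tf 0 y z \<and> y * z = 0" using n1 yz' by blast
  have nz: "s 1 * y \<noteq> 0 \<or> s 1 * z \<noteq> 0" using assms(2) n1 by (auto simp: cmat_eq_iff)
  have "A_mat 1 = acc s (Suc r) *\<^sub>m (A_mat 1 + (slope (Suc r) * of_int (p 1)) *\<^sub>m nilp 1)"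
    using X[of "Suc r"] X_Suc_r[of \<rho>] X_1 by simp
  then have "acc s (Suc r) = 1 \<and> slope (Suc r) * of_int (p 1) = 0"
    unfolding n1 A_mat_1 using nz by auto
  then show "acc s (Suc r) = 1" "mu r ks = 0"
    using p_nonzero[OF r1] slope_mu by auto
  show "upper \<rho> \<or> lower \<rho>"
  proof (cases "y = 0")
    case True
    then have "lower \<rho>" unfolding lower_def using X Y n1 by (auto simp: A_mat_1)
    then show ?thesis ..
  next
    case False
    then have "z = 0" using yz by auto
    then have "upper \<rho>" unfolding upper_def using X Y n1 by (auto simp: A_mat_1)
    then show ?thesis ..
  qed
  show "\<not> (upper \<rho> \<and> lower \<rho>)"
  proof
    assume "upper \<rho> \<and> lower \<rho>"
    then have "Y \<rho> 1 $ 2 $ 1 = 0" "Y \<rho> 1 $ 1 $ 2 = 0" using r1 unfolding upper_def lower_def by blast+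
    then show False using nz unfolding YT(1) by simp
  qed
qed

end

section \<open>Encoding representations\<close>

lemma minus_1_powi_sum:
  "(-1 :: complex) powi (\<Sum>j\<in>A. f j) = (\<Prod>j\<in>A. (-1) powi f j)"
  by (induction A rule: infinite_finite_induct) (simp_all add: power_int_add)

lemma SL0_coordinates:
  assumes "N = b1 *\<^sub>m A_mat 1 + b2 *\<^sub>m D_mat + b3 *\<^sub>m E_mat"
  shows "N = tf b1 (b2 + \<i> * b3) (\<i> * b3 - b2)"
  using assms by (simp add: A_mat_1 D_mat_tf E_mat_tf algebra_simps)

lemma bil_coordinates:
  "bil (b1 *\<^sub>m A_mat 1 + b2 *\<^sub>m D_mat + b3 *\<^sub>m E_mat) (c1 *\<^sub>m A_mat 1 + c2 *\<^sub>m D_mat + c3 *\<^sub>m E_mat)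
    = 2 * (b1 * c1 + b2 * c2 + b3 * c3)"
proof -
  have "2 * b1 * c1 - (b2 + \<i> * b3) * (\<i> * c3 - c2) - (\<i> * b3 - b2) * (c2 + \<i> * c3) = 2 * (b1 * c1 + b2 * c2 + b3 * c3)"
    using i_squared by algebra
  then show ?thesis
    by (simp add: SL0_coordinates[OF refl, of b1 b2 b3] SL0_coordinates[OF refl, of c1 c2 c3] del: tf_add tf_scale)
qed

definition coords :: "cmat \<Rightarrow> complex \<times> complex \<times> complex" where
  "coords N = (- \<i> * N $ 1 $ 1, (N $ 1 $ 2 - N $ 2 $ 1) / 2, - \<i> * (N $ 1 $ 2 + N $ 2 $ 1) / 2)"

lemma coords_tf: "coords (tf x y z) = (x, (y - z) / 2, - \<i> * (y + z) / 2)"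
  by (simp add: coords_def)

lemma coords_expand:
  assumes "N \<in> SL0" "coords N = (b1, b2, b3)"
  shows "N = b1 *\<^sub>m A_mat 1 + b2 *\<^sub>m D_mat + b3 *\<^sub>m E_mat"
proof -
  obtain x y z where N: "N = tf x y z" using SL0_obtain_tf[OF assms(1)] by blast
  have b: "b1 = x" "b2 = (y - z) / 2" "b3 = - \<i> * (y + z) / 2"
    using assms(2) unfolding N coords_tf by auto
  have "b3 = - (\<i> * ((y + z) / 2))" by (simp add: b(3))
  then have i: "\<i> * b3 = (y + z) / 2" by (simp only: mult_minus_right ii_mult minus_minus)
  show ?thesis
    unfolding SL0_coordinates[OF refl] i N tf_eq_iff b(1,2) by (simp add: field_simps)
qed

lemma coords_unique: "coords (b1 *\<^sub>m A_mat 1 + b2 *\<^sub>m D_mat + b3 *\<^sub>m E_mat) = (b1, b2, b3)"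
  unfolding SL0_coordinates[OF refl] coords_tf by (simp add: algebra_simps)

lemma coords_scale:
  assumes "coords N = (b1, b2, b3)" shows "coords (c *\<^sub>m N) = (c * b1, c * b2, c * b3)"
  using assms unfolding coords_def prod.inject scale_mat_nth
  by (elim conjE, hypsubst) (simp add: algebra_simps)

lemma coords_A_1: "coords (A_mat 1) = (1, 0, 0)"
  by (simp add: A_mat_1 coords_tf)

context montesinos
begin

lemma coded: "normal \<rho> a \<Longrightarrow> s_vals \<rho> a s \<Longrightarrow> coded_rep r ks \<rho> a s"
  by (intro coded_rep.intro montesinos_axioms coded_rep_axioms.intro)

lemma one_in: "1 \<in> {1..r}"
  using r_ge_1 by simp

lemma normalized_reps: "normal \<rho> a \<Longrightarrow> \<rho> \<in> reps"
  and normalized_X_1: "normal \<rho> a \<Longrightarrow> X \<rho> 1 = A_mat 1"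
  by (auto simp: normalized_iff)

subsection \<open>Abelian representations\<close>

lemma abelian_values:
  assumes "normal \<rho> a" "abelian \<rho>" "s_vals \<rho> a s"
  shows "a = 1 \<or> a = -1" "l \<in> {1..r} \<Longrightarrow> s l \<in> {1, -1}"
    "l \<in> {1..r} \<Longrightarrow> X \<rho> l = acc s l *\<^sub>m A_mat 1 \<and> Y \<rho> l = (s l * acc s l) *\<^sub>m A_mat 1"
proof -
  interpret coded_rep r ks \<rho> a s using assms by (intro coded)
  have ul: "upper \<rho> \<and> lower \<rho>" using abelian_iff[OF rep X_1] assms(2) by blast
  then show a: "a = 1 \<or> a = -1" using generic_irreducible reducible_iff[OF rep X_1] by blast
  have n: "nilp 1 = 0" using parabolic_values(7)[OF a] ul by blast
  show pm: "s l \<in> {1, -1}" if "l \<in> {1..r}" for l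
    using flat_irreducible[OF a n] ul that by metis
  show "l \<in> {1..r} \<Longrightarrow> X \<rho> l = acc s l *\<^sub>m A_mat 1 \<and> Y \<rho> l = (s l * acc s l) *\<^sub>m A_mat 1"
    using flat_pm(1)[OF a n pm] by blast
qed

lemma pm_in_F_set: "w \<in> {1, -1} \<Longrightarrow> w \<in> F_set"
  using pm1_in_F_set by auto

lemma s_values_ext: "s_vals \<rho> a s \<Longrightarrow> s \<in> extensional {1..r}"
  unfolding s_values_iff by blast

lemma s_values_pm_unique:
  assumes "s_vals \<rho> a s" "s_vals \<rho> a s'"
    "\<And>l. l \<in> {1..r} \<Longrightarrow> s l \<in> {1, -1}" "\<And>l. l \<in> {1..r} \<Longrightarrow> s' l \<in> {1, -1}"
  shows "s = s'"
  using s_values_F_unique[OF assms(1,2)] assms(3,4) pm_in_F_set by blast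

lemma abelian_determined:
  assumes "normal \<rho> a" "abelian \<rho>"
  shows "a \<in> {1, -1}" "determined_by_unique (abelian_code r ks a) \<rho>"
proof -
  obtain s where s: "s_vals \<rho> a s" using s_values_exist[OF assms(1)] by blast
  show "a \<in> {1, -1}" using abelian_values(1)[OF assms s] by blast
  have code: "abelian_code r ks a \<rho> s"
    using assms s abelian_values(2)[OF assms s] s_values_ext[OF s] by (auto simp: abelian_code_def PiE_def)
  have unique: "s' = s" if "abelian_code r ks a \<rho> s'" for s'
  proof -
    have s': "s_vals \<rho> a s'" using that by (auto simp: abelian_code_def)
    show ?thesis
      by (rule s_values_pm_unique[OF s' s abelian_values(2)[OF assms s'] abelian_values(2)[OF assms s]])
  qed
  have det: "\<rho>' = \<rho>" if "abelian_code r ks a \<rho> t" "abelian_code r ks a \<rho>' t" for t \<rho>'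
  proof -
    have c: "normal \<rho>' a" "abelian \<rho>'" "s_vals \<rho>' a t" "s_vals \<rho> a t"
      using that by (auto simp: abelian_code_def)
    show ?thesis
      by (rule reps_determined[OF normalized_reps[OF c(1)] normalized_reps[OF assms(1)]])
        (use abelian_values(3)[OF c(1-3)] abelian_values(3)[OF assms c(4)] in metis)
  qed
  show "determined_by_unique (abelian_code r ks a) \<rho>"
    unfolding determined_by_unique_def using code unique det by blast
qed

subsection \<open>Reducible representations\<close>

lemma reducible_nilp:
  assumes "normal \<rho> a" "reducible \<rho>" "\<not> abelian \<rho>" "s_vals \<rho> a s"
  shows "a = 1 \<or> a = -1" "s 1 *\<^sub>m Y \<rho> 1 - A_mat 1 \<noteq> 0" "coded_rep.nilp r ks \<rho> s 1 = s 1 *\<^sub>m Y \<rho> 1 - A_mat 1"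
proof -
  interpret coded_rep r ks \<rho> a s using assms by (intro coded)
  show a: "a = 1 \<or> a = -1" using generic_irreducible assms(2) by blast
  have n: "nilp 1 \<noteq> 0"
  proof
    assume n: "nilp 1 = 0"
    show False
    proof (cases "\<exists>l\<in>{1..r}. s l \<notin> {1, -1}")
      case True
      then show False using flat_irreducible[OF a n] assms(2) reducible_iff[OF rep X_1] by metis
    next
      case False
      then show False using flat_pm(2)[OF a n] assms(3) abelian_iff[OF rep X_1] by blast
    qed
  qed
  then have "s 1 \<in> {1, -1}" using parabolic_values(1)[OF a] one_in by blast
  then show e: "nilp 1 = s 1 *\<^sub>m Y \<rho> 1 - A_mat 1" by (simp only: nilp_def X_1 if_True)
  show "s 1 *\<^sub>m Y \<rho> 1 - A_mat 1 \<noteq> 0" using n e by simp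
qed

lemma reducible_values:
  assumes "normal \<rho> a" "reducible \<rho>" "\<not> abelian \<rho>" "s_vals \<rho> a s"
  shows "l \<in> {1..r} \<Longrightarrow> s l \<in> {1, -1}" "mu r ks = 0" "reducible_code r ks a \<rho> s"
    "\<exists>y z. Y \<rho> 1 = tf (s 1) y z \<and> y * z = 0 \<and> (y \<noteq> 0 \<or> z \<noteq> 0)"
proof -
  interpret coded_rep r ks \<rho> a s using assms by (intro coded)
  note nilp = reducible_nilp[OF assms]
  have n: "nilp 1 \<noteq> 0" using nilp(2,3) by simp
  note par = parabolic_values[OF nilp(1) n]
  show "l \<in> {1..r} \<Longrightarrow> s l \<in> {1, -1}" "mu r ks = 0" using par by blast+
  have "(\<Prod>l=1..r. (-1) powi (qt l - 1) * s l powi q l) = acc s (Suc r)"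
    by (simp add: acc_def atLeastLessThanSuc_atLeastAtMost)
  then show "reducible_code r ks a \<rho> s"
    using assms par(1,5) s_values_ext[OF assms(4)] by (auto simp: reducible_code_def PiE_def)
  obtain y z where yz: "nilp 1 = tf 0 y z" "y * z = 0" using par(8) by blast
  have pm: "s 1 \<in> {1, -1}" using par(1) one_in by blast
  have "s 1 *\<^sub>m Y \<rho> 1 = tf 1 y z"
    using yz(1) unfolding nilp(3) A_mat_1 by (simp add: cmat_eq_iff) (metis add_diff_cancel_left' diff_add_cancel minus_diff_eq mult_1 add.left_neutral diff_eq_eq)
  moreover have "Y \<rho> 1 = s 1 *\<^sub>m (s 1 *\<^sub>m Y \<rho> 1)" using pm by (auto simp: cmat_eq_iff)
  ultimately have "Y \<rho> 1 = tf (s 1) (s 1 * y) (s 1 * z)" by simp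
  moreover have "y \<noteq> 0 \<or> z \<noteq> 0" using n yz(1) by (auto simp: cmat_eq_iff)
  ultimately show "\<exists>y z. Y \<rho> 1 = tf (s 1) y z \<and> y * z = 0 \<and> (y \<noteq> 0 \<or> z \<noteq> 0)"
    using yz(2) pm by (intro exI[of _ "s 1 * y"] exI[of _ "s 1 * z"]) auto
qed

lemma reducible_codeD:
  assumes "reducible_code r ks a \<rho> s"
  shows "normal \<rho> a" "reducible \<rho>" "\<not> abelian \<rho>" "s_vals \<rho> a s"
  using assms by (auto simp: reducible_code_def)

lemma reducible_unique_code:
  assumes "normal \<rho> a" "reducible \<rho>" "\<not> abelian \<rho>"
  shows "\<exists>!s. reducible_code r ks a \<rho> s"
proof -
  obtain s where s: "s_vals \<rho> a s" using s_values_exist[OF assms(1)] by blast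
  show ?thesis
  proof (rule ex1I)
    show "reducible_code r ks a \<rho> s" by (rule reducible_values(3)[OF assms s])
    fix s' assume c: "reducible_code r ks a \<rho> s'"
    note s' = reducible_codeD(4)[OF c]
    show "s' = s"
      by (rule s_values_pm_unique[OF s' s reducible_values(1)[OF assms s'] reducible_values(1)[OF assms s]])
  qed
qed

lemma reducible_determined:
  assumes "reducible_code r ks a \<rho> s" "reducible_code r ks a \<rho>' s" "Y \<rho> 1 = Y \<rho>' 1"
  shows "\<rho> = \<rho>'"
proof -
  note c = reducible_codeD[OF assms(1)] and c' = reducible_codeD[OF assms(2)]
  interpret a: coded_rep r ks \<rho> a s using c by (intro coded)
  interpret b: coded_rep r ks \<rho>' a s using c' by (intro coded)
  note n = reducible_nilp[OF c] and n' = reducible_nilp[OF c']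
  have nz: "a.nilp 1 \<noteq> 0" "b.nilp 1 \<noteq> 0" using n n' by simp_all
  have eq: "a.nilp 1 = b.nilp 1" unfolding n(3) n'(3) assms(3) ..
  show ?thesis
  proof (rule reps_determined[OF a.rep b.rep])
    fix l assume l: "l \<in> {1..r}"
    then have "l \<in> {1..Suc r}" by auto
    then show "X \<rho> l = X \<rho>' l \<and> Y \<rho> l = Y \<rho>' l"
      using l a.parabolic_values(2,3)[OF n(1) nz(1)] b.parabolic_values(2,3)[OF n'(1) nz(2)] eq
      by simp
  qed
qed

lemma transpose_tf [simp]: "transpose (tf x y z) = tf x z y"
  by (simp add: cmat_eq_iff transpose_def)

lemma isometry_map_values:
  assumes "isometry f" "f (A_mat 1) = A_mat 1" "normal \<rho> a"
  shows "normal (map_rep f \<rho>) a" "s_vals (map_rep f \<rho>) a s \<longleftrightarrow> s_vals \<rho> a s"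
proof -
  have b: "bil (f N) (f N') = bil N N'" for N N' using assms(1) by (simp add: isometry_def)
  have n: "\<rho> \<in> reps" "X \<rho> 1 = A_mat 1" "a \<in> F_set" "a \<noteq> 0" "bil (X \<rho> 1) (Z \<rho> 1) = a + inverse a"
    using assms(3) unfolding normalized_iff by blast+
  have "X (map_rep f \<rho>) 1 = f (X \<rho> 1)" "Z (map_rep f \<rho>) 1 = f (Z \<rho> 1)"
    using map_rep_X[of 1 f \<rho>] map_rep_Z[of 1 f \<rho>] one_in by simp_all
  then show "normal (map_rep f \<rho>) a"
    unfolding normalized_iff using n map_rep_reps[OF assms(1)] assms(2) b by metis
  show "s_vals (map_rep f \<rho>) a s \<longleftrightarrow> s_vals \<rho> a s"
    by (simp add: s_values_iff map_rep_X map_rep_Y b)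
qed

lemma reducible_transpose:
  assumes "reducible_code r ks a \<rho> s"
  shows "reducible_code r ks a (map_rep transpose \<rho>) s"
proof -
  note c = reducible_codeD[OF assms]
  let ?\<rho> = "map_rep transpose \<rho>"
  have A: "transpose (A_mat 1) = A_mat 1" by (simp add: A_mat_1)
  note v = isometry_map_values[OF isometry_transpose A c(1)]
  have t: "transpose N $ i $ j = N $ j $ i" for N :: cmat and i j by (simp add: transpose_def)
  have ul: "upper ?\<rho> \<longleftrightarrow> lower \<rho>" "lower ?\<rho> \<longleftrightarrow> upper \<rho>"
    by (simp_all add: upper_def lower_def map_rep_X map_rep_Y t)
  note rep' = normalized_reps[OF v(1)] normalized_X_1[OF v(1)]
  note rep = normalized_reps[OF c(1)] normalized_X_1[OF c(1)]
  have "reducible ?\<rho>" using reducible_iff[OF rep'] ul reducible_iff[OF rep] c(2) by blast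
  moreover have "\<not> abelian ?\<rho>" using abelian_iff[OF rep'] ul abelian_iff[OF rep] c(3) by blast
  ultimately show ?thesis
    using assms v by (simp add: reducible_code_def)
qed

lemma reducible_two_choices:
  assumes "reducible_code r ks a \<rho> s" "Y \<rho> 1 \<in> {S_mat (s 1), S'_mat (s 1)}" "N \<in> {S_mat (s 1), S'_mat (s 1)}"
  shows "\<exists>!\<rho>'. reducible_code r ks a \<rho>' s \<and> Y \<rho>' 1 = N"
proof -
  have "\<exists>\<rho>'. reducible_code r ks a \<rho>' s \<and> Y \<rho>' 1 = N"
  proof (cases "Y \<rho> 1 = N")
    case False
    then have "transpose (Y \<rho> 1) = N" using assms(2,3) by (auto simp: S_mat_tf)
    then show ?thesis using reducible_transpose[OF assms(1)] map_rep_Y[OF one_in, of transpose \<rho>] by auto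
  qed (use assms(1) in blast)
  then show ?thesis using reducible_determined by blast
qed

subsection \<open>Irreducible representations with a equal to 1 or -1\<close>

definition first_generic :: "(dart \<Rightarrow> cmat) \<Rightarrow> (nat \<Rightarrow> complex) \<Rightarrow> nat \<Rightarrow> bool" where
  "first_generic \<rho> s h \<longleftrightarrow> h \<in> {1..r} \<and> (\<forall>l\<in>{1..<h}. s l \<in> {1, -1}) \<and> s h \<notin> {1, -1}"

definition second_A_mat :: "(dart \<Rightarrow> cmat) \<Rightarrow> (nat \<Rightarrow> complex) \<Rightarrow> nat \<Rightarrow> bool" where
  "second_A_mat \<rho> s h \<longleftrightarrow> X \<rho> (Suc h) = (acc s h * eq h) *\<^sub>m A_mat (s h powi q h)"

lemma first_generic_unique:
  assumes "first_generic \<rho> s h" "first_generic \<rho>' s h'" shows "h = h'"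
proof (rule ccontr)
  assume "h \<noteq> h'"
  then have "h \<in> {1..<h'} \<or> h' \<in> {1..<h}" using assms by (auto simp: first_generic_def)
  then show False using assms unfolding first_generic_def by blast
qed

lemma irreducible_pm:
  assumes "normal \<rho> a" "\<not> reducible \<rho>" "a = 1 \<or> a = -1" "s_vals \<rho> a s"
  shows "coded_rep.nilp r ks \<rho> s 1 = 0" "\<exists>h. first_generic \<rho> s h"
proof -
  interpret coded_rep r ks \<rho> a s using assms by (intro coded)
  show n: "nilp 1 = 0" using parabolic_values(6)[OF assms(3)] assms(2) reducible_iff[OF rep X_1] by blast
  have "\<exists>l\<in>{1..r}. s l \<notin> {1, -1}" using flat_pm(2)[OF assms(3) n] assms(2) reducible_iff[OF rep X_1] by blast
  from flat_irreducible[OF assms(3) n this] show "\<exists>h. first_generic \<rho> s h"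
    unfolding first_generic_def by metis
qed

lemma cheb_q_nonzero:
  assumes "normal \<rho> a" "a = 1 \<or> a = -1" "s_vals \<rho> a s" "l \<in> {1..r}" "s l \<notin> {1, -1}"
  shows "cheb (s l) (q l) \<noteq> 0" "s l powi q l \<noteq> 1" "s l powi q l \<noteq> -1"
proof -
  interpret coded_rep r ks \<rho> a s using assms by (intro coded)
  have s: "s l \<noteq> 0" "s l \<noteq> 1" "s l \<noteq> -1" using s_nonzero assms by auto
  have "s l powi p l * s l powi p l = 1"
    using s_pow'[OF assms(4)] ep_sign[of l] assms(2) by auto
  then have *: "s l powi q l * s l powi q l \<noteq> 1"
    using coprime_powers_pm1[OF s(1) rat_det[OF ks_nonempty[OF assms(4)]]] s by blast
  then show "cheb (s l) (q l) \<noteq> 0" using cheb_eq_0_iff[OF s] by blast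
  show "s l powi q l \<noteq> 1" "s l powi q l \<noteq> -1" using * by auto
qed

lemma first_generic_bil:
  assumes "normal \<rho> a" "\<not> reducible \<rho>" "a = 1 \<or> a = -1" "s_vals \<rho> a s" "first_generic \<rho> s h"
  shows "bil (A_mat 1) ((acc s h * eq h) *\<^sub>m X \<rho> (Suc h)) = s h powi q h + inverse (s h powi q h)"
    "acc s h * eq h = 1 \<or> acc s h * eq h = -1"
proof -
  interpret coded_rep r ks \<rho> a s using assms by (intro coded)
  note n = irreducible_pm(1)[OF assms(1-4)]
  have h: "h \<in> {1..r}" "\<And>l. l \<in> {1..<h} \<Longrightarrow> s l \<in> {1, -1}" using assms(5) by (auto simp: first_generic_def)
  have acc: "acc s h = 1 \<or> acc s h = -1" using acc_sign h(2) by blast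
  then show "acc s h * eq h = 1 \<or> acc s h * eq h = -1" using eq_sign[of h] by auto
  have "X \<rho> h = acc s h *\<^sub>m A_mat 1"
    using flat_X[OF assms(3) n, of h] h by auto
  then have A: "A_mat 1 = acc s h *\<^sub>m refl_seq (s h) (X \<rho> h) (Y \<rho> h) 0"
    using acc s_nonzero[OF h(1)] by (auto simp: refl_seq_0 cmat_eq_iff)
  have "bil (refl_seq (s h) (X \<rho> h) (Y \<rho> h) 0) (refl_seq (s h) (X \<rho> h) (Y \<rho> h) (q h)) = pow_sum (s h) (q h)"
    using bil_refl_seq[OF s_nonzero[OF h(1)] X_SL0[OF rep] Y_SL0[OF rep h(1)] bil_X_Y[OF h(1)], of 0 "q h"] h(1) by simp
  then have "bil (A_mat 1) ((acc s h * eq h) *\<^sub>m X \<rho> (Suc h)) = (acc s h * acc s h) * (eq h * eq h) * pow_sum (s h) (q h)"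
    unfolding corner_values(2)[OF h(1)] by (subst A) (simp add: bil_linear mult_ac)
  also have "(acc s h * acc s h) * (eq h * eq h) = 1" using acc by (auto simp: pm1_powi_sq)
  finally show "bil (A_mat 1) ((acc s h * eq h) *\<^sub>m X \<rho> (Suc h)) = s h powi q h + inverse (s h powi q h)"
    by (simp add: pow_sum_def power_int_minus)
qed

lemma code_coefficient:
  assumes "h \<in> {1..r}"
  shows "(-1) powi (\<Sum>l=1..h. qt l - 1) * (\<Prod>l=1..<h. s l powi q l) = acc s h * eq h"
proof -
  have "{1..h} = insert h {1..<h}" using assms by auto
  then have "(\<Prod>l=1..h. eq l) = eq h * (\<Prod>l=1..<h. eq l)" by simp
  then show ?thesis
    unfolding minus_1_powi_sum by (simp add: acc_def prod.distrib)
qed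

lemma irreducible_codeD:
  assumes "irreducible_code r ks a \<rho> (h, s, x)"
  shows "normal \<rho> a" "\<not> reducible \<rho>" "s_vals \<rho> a s" "\<forall>l\<in>{1..r}. s l \<in> F_set"
    "first_generic \<rho> s h" "second_A_mat \<rho> s h" "x \<in> extensional {1..r+1}" "x 1 = (1, 0, 0)" "x (r + 1) = (1, 0, 0)"
    "\<And>l a1 b1 c1. l \<in> {1..r} \<Longrightarrow> x l = (a1, b1, c1) \<Longrightarrow> X \<rho> l = a1 *\<^sub>m A_mat 1 + b1 *\<^sub>m D_mat + c1 *\<^sub>m E_mat"
proof -
  note c = assms[unfolded irreducible_code_def prod.case]
  show h: "first_generic \<rho> s h" unfolding first_generic_def using c by blast
  then have "h \<in> {1..r}" by (simp add: first_generic_def)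
  moreover have "X \<rho> (h + 1) = ((-1) powi (\<Sum>l=1..h. qt l - 1) * (\<Prod>l=1..<h. s l powi q l)) *\<^sub>m A_mat (s h powi q h)"
    using c by blast
  ultimately show "second_A_mat \<rho> s h"
    unfolding second_A_mat_def using code_coefficient by simp
  show "normal \<rho> a" "\<not> reducible \<rho>" "s_vals \<rho> a s"
    "x \<in> extensional {1..r+1}" "x 1 = (1, 0, 0)" "x (r + 1) = (1, 0, 0)"
    using c by blast+
  show "\<forall>l\<in>{1..r}. s l \<in> F_set" using c by (auto simp: PiE_def Pi_def)
  show "X \<rho> l = a1 *\<^sub>m A_mat 1 + b1 *\<^sub>m D_mat + c1 *\<^sub>m E_mat"
    if "l \<in> {1..r}" "x l = (a1, b1, c1)" for l a1 b1 c1
    using c that by (auto split: prod.splits)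
qed

lemma irreducible_code_exists:
  assumes "normal \<rho> a" "\<not> reducible \<rho>" "a = 1 \<or> a = -1" "s_vals \<rho> a s"
    "\<forall>l\<in>{1..r}. s l \<in> F_set" "first_generic \<rho> s h" "second_A_mat \<rho> s h"
  shows "irreducible_code r ks a \<rho> (h, s, restrict (\<lambda>l. coords (X \<rho> l)) {1..r+1})" (is "irreducible_code _ _ _ _ (_, _, ?x)")
proof -
  interpret coded_rep r ks \<rho> a s using assms by (intro coded)
  note n = irreducible_pm(1)[OF assms(1-4)]
  have "case ?x l of (a1, b1, c1) \<Rightarrow> case ?x (l + 1) of (a2, b2, c2) \<Rightarrow>
        X \<rho> l = a1 *\<^sub>m A_mat 1 + b1 *\<^sub>m D_mat + c1 *\<^sub>m E_mat \<and>
        a1\<^sup>2 + b1\<^sup>2 + c1\<^sup>2 = 1 \<and>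
        eq l * (s l powi q l + s l powi (- q l)) = 2 * (a1 * a2 + b1 * b2 + c1 * c2) \<and>
        (s l \<in> {1, -1} \<longrightarrow> (let e = eq l * s l powi q l in (a2, b2, c2) = (e * a1, e * b1, e * c1)))"
    if l: "l \<in> {1..r}" for l
  proof -
    obtain a1 b1 c1 where x1: "coords (X \<rho> l) = (a1, b1, c1)" by (metis prod_cases3)
    obtain a2 b2 c2 where x2: "coords (X \<rho> (Suc l)) = (a2, b2, c2)" by (metis prod_cases3)
    have sl: "X \<rho> l \<in> SL0" "X \<rho> (Suc l) \<in> SL0" using X_SL0[OF rep] l by auto
    note e1 = coords_expand[OF sl(1) x1] and e2 = coords_expand[OF sl(2) x2]
    have "2 * (a1 * a1 + b1 * b1 + c1 * c1) = 2 * 1"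
      using bil_self[OF sl(1)] bil_coordinates[of a1 b1 c1 a1 b1 c1] e1 by simp
    then have 1: "a1\<^sup>2 + b1\<^sup>2 + c1\<^sup>2 = 1"
      unfolding power2_eq_square by (simp only: mult_cancel_left) simp
    have "bil (refl_seq (s l) (X \<rho> l) (Y \<rho> l) 0) (refl_seq (s l) (X \<rho> l) (Y \<rho> l) (q l)) = pow_sum (s l) (q l)"
      using bil_refl_seq[OF s_nonzero[OF l] sl(1) Y_SL0[OF rep l] bil_X_Y[OF l], of 0 "q l"] by simp
    then have "eq l * (s l powi q l + s l powi (- q l)) = bil (X \<rho> l) (X \<rho> (Suc l))"
      unfolding corner_values(2)[OF l] using s_nonzero[OF l]
      by (simp add: refl_seq_0 bil_linear pow_sum_def)
    also have "\<dots> = 2 * (a1 * a2 + b1 * b2 + c1 * c2)"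
      using e1 e2 bil_coordinates by simp
    finally have 2: "eq l * (s l powi q l + s l powi (- q l)) = 2 * (a1 * a2 + b1 * b2 + c1 * c2)" .
    have 3: "(a2, b2, c2) = (eq l * s l powi q l * a1, eq l * s l powi q l * b1, eq l * s l powi q l * c1)"
      if "s l \<in> {1, -1}"
      using coords_scale[OF x1, of "eq l * s l powi q l"] flat_values(2)[OF assms(3) n l that] x2 by simp
    have xs: "?x l = (a1, b1, c1)" "?x (l + 1) = (a2, b2, c2)" using l x1 x2 by auto
    show ?thesis unfolding xs Let_def prod.case using e1 1 2 3 by blast
  qed
  moreover have "?x 1 = (1, 0, 0)" using X_1 coords_A_1 by simp
  moreover have "?x (r + 1) = (1, 0, 0)" using X_1 X_Suc_r[of \<rho>] coords_A_1 by simp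
  moreover have "s \<in> {1..r} \<rightarrow>\<^sub>E F_set" using assms(5) s_values_ext[OF assms(4)] by (simp add: PiE_def)
  moreover have h: "h \<in> {1..r}" using assms(6) by (simp add: first_generic_def)
  moreover have "X \<rho> (h + 1) = ((-1) powi (\<Sum>l=1..h. qt l - 1) * (\<Prod>l=1..<h. s l powi q l)) *\<^sub>m A_mat (s h powi q h)"
    using assms(7) unfolding code_coefficient[OF h] second_A_mat_def by simp
  ultimately show ?thesis
    unfolding irreducible_code_def prod.case using assms(1,2,4,6) unfolding first_generic_def
    by (intro conjI ballI) (auto simp del: One_nat_def)
qed

lemma irreducible_code_x:
  assumes "irreducible_code r ks a \<rho> (h, s, x)"
  shows "l \<in> {1..r} \<Longrightarrow> coords (X \<rho> l) = x l" "x = restrict (\<lambda>l. coords (X \<rho> l)) {1..r+1}"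
proof -
  have X: "coords (X \<rho> l) = x l" if "l \<in> {1..r}" for l
  proof -
    obtain a1 b1 c1 where x1: "x l = (a1, b1, c1)" by (metis prod_cases3)
    have "X \<rho> l = a1 *\<^sub>m A_mat 1 + b1 *\<^sub>m D_mat + c1 *\<^sub>m E_mat"
      by (rule irreducible_codeD(10)[OF assms that x1])
    then show ?thesis using coords_unique x1 by simp
  qed
  then show "l \<in> {1..r} \<Longrightarrow> coords (X \<rho> l) = x l" by blast
  note x = irreducible_codeD(7,9,8)[OF assms]
  have "x l = coords (X \<rho> l)" if "l \<in> {1..r+1}" for l
    using that X[of l] X[OF one_in] X_Suc_r[of \<rho>] x(2,3) by (cases "l = r + 1") auto
  then show "x = restrict (\<lambda>l. coords (X \<rho> l)) {1..r+1}"
    by (intro extensionalityI[OF x(1) restrict_extensional]) auto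
qed

lemma irreducible_determined:
  assumes "normal \<rho> a" "\<not> reducible \<rho>" "a = 1 \<or> a = -1" "s_vals \<rho> a s"
    "\<forall>l\<in>{1..r}. s l \<in> F_set" "first_generic \<rho> s h" "second_A_mat \<rho> s h"
  shows "determined_by_unique (irreducible_code r ks a) \<rho>"
proof -
  note code = irreducible_code_exists[OF assms]
  have unique: "t = (h, s, restrict (\<lambda>l. coords (X \<rho> l)) {1..r+1})" if c: "irreducible_code r ks a \<rho> t" for t
  proof -
    obtain h' s' x' where t: "t = (h', s', x')" by (metis prod_cases3)
    note c' = irreducible_codeD(3-5)[OF c[unfolded t]]
    have s: "s' = s" using s_values_F_unique[OF c'(1) assms(4) c'(2) assms(5)] .
    have "h' = h" using first_generic_unique[OF c'(3)[unfolded s] assms(6)] .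
    then show ?thesis using irreducible_code_x(2)[OF c[unfolded t]] s t by simp
  qed
  have det: "\<rho>' = \<rho>" if c: "irreducible_code r ks a \<rho> t" "irreducible_code r ks a \<rho>' t" for t \<rho>'
  proof -
    obtain h' s' x' where t: "t = (h', s', x')" by (metis prod_cases3)
    note d = irreducible_codeD(1,3,2)[OF c(1)[unfolded t]] irreducible_codeD(1,3,2)[OF c(2)[unfolded t]]
    interpret a: coded_rep r ks \<rho> a s' using d by (intro coded)
    interpret b: coded_rep r ks \<rho>' a s' using d by (intro coded)
    note n = irreducible_pm(1)[OF d(1,3) assms(3) d(2)] irreducible_pm(1)[OF d(4,6) assms(3) d(5)]
    have X: "X \<rho>' l = X \<rho> l" if "l \<in> {1..r}" for l
    proof -
      obtain a1 b1 c1 where x1: "x' l = (a1, b1, c1)" by (metis prod_cases3)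
      have "X \<rho> l \<in> SL0" "X \<rho>' l \<in> SL0" using X_SL0 a.rep b.rep that by auto
      then show ?thesis
        using coords_expand irreducible_code_x(1)[OF c(1)[unfolded t] that]
          irreducible_code_x(1)[OF c(2)[unfolded t] that] x1 by metis
    qed
    then have X': "X \<rho>' (Suc l) = X \<rho> (Suc l)" if "l \<in> {1..r}" for l
      using that one_in X_Suc_r by (cases "l = r") auto
    show ?thesis
    proof (rule reps_determined[OF b.rep a.rep])
      fix l assume l: "l \<in> {1..r}"
      have "Y \<rho>' l = Y \<rho> l"
      proof (cases "s' l \<in> {1, -1}")
        case True
        then show ?thesis
          using a.flat_values(1)[OF assms(3) n(1) l] b.flat_values(1)[OF assms(3) n(2) l] X[OF l] by simp
      next
        case False
        have "eq l *\<^sub>m refl_seq (s' l) (X \<rho> l) (Y \<rho>' l) (q l) = eq l *\<^sub>m refl_seq (s' l) (X \<rho> l) (Y \<rho> l) (q l)"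
          using a.corner_values(2)[OF l] b.corner_values(2)[OF l] X[OF l] X'[OF l] by simp
        then have "refl_seq (s' l) (X \<rho> l) (Y \<rho>' l) (q l) = refl_seq (s' l) (X \<rho> l) (Y \<rho> l) (q l)"
          by (simp add: cmat_eq_iff)
        then show ?thesis
          using refl_seq_cancel cheb_q_nonzero(1)[OF d(1) assms(3) d(2) l False] by blast
      qed
      then show "X \<rho>' l = X \<rho> l \<and> Y \<rho>' l = Y \<rho> l" using X[OF l] by simp
    qed
  qed
  show ?thesis
    unfolding determined_by_unique_def using code unique det by blast
qed

end

section \<open>Arguments\<close>

lemma cis_eq_iff: "cis x = cis y \<longleftrightarrow> (\<exists>m::int. x = y + 2 * of_int m * pi)"
proof -
  have "cis x = cis y \<longleftrightarrow> sin x = sin y \<and> cos x = cos y" by (auto simp: complex_eq_iff)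
  also have "\<dots> \<longleftrightarrow> (\<exists>m::int. x = y + 2 * of_int m * pi)"
    unfolding sin_cos_eq_iff by (auto simp: mult_ac)
  finally show ?thesis .
qed

lemma powi_root_unique:
  fixes c :: real and P :: int
  assumes "0 < x" "0 < c" "P \<noteq> 0" "x powi P = c" shows "x = c powr (1 / of_int P)"
proof -
  have "c = x powr of_int P" using assms by (simp add: powr_real_of_int')
  then have "c powr (1 / of_int P) = x powr (of_int P * (1 / of_int P))" by (simp add: powr_powr)
  then show ?thesis using assms by simp
qed

lemma root_parameter:
  fixes w :: complex and P :: int and c \<phi> :: real
  assumes "P \<noteq> 0" "w \<noteq> 0" "0 < c" "w powi P = of_real c * cis \<phi>"
  shows "\<exists>!n::int. n \<in> {0..<\<bar>P\<bar>} \<and> w = of_real (c powr (1 / of_int P)) * cis ((\<phi> + 2 * of_int n * pi) / of_int P)"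
proof -
  define x where "x = norm w"
  define t where "t = Arg w"
  have w: "w = of_real x * cis t" using rcis_cmod_Arg[of w] by (simp add: rcis_def x_def t_def)
  have x0: "0 < x" using assms(2) by (simp add: x_def)
  have "norm (w powi P) = c" using assms(3,4) by (simp add: norm_mult)
  then have "x powi P = c" by (simp add: x_def norm_power_int)
  then have x: "x = c powr (1 / of_int P)" using powi_root_unique x0 assms by blast
  have "of_real (x powi P) * cis (of_int P * t) = of_real c * cis \<phi>"
    using assms(4) unfolding w by (simp add: power_int_mult_distrib cis_power_int)
  then have "cis (of_int P * t) = cis \<phi>" using \<open>x powi P = c\<close> assms(3) by simp
  then obtain m :: int where m: "of_int P * t = \<phi> + 2 * of_int m * pi" unfolding cis_eq_iff by blast
  define n where "n = m mod \<bar>P\<bar>"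
  have "n \<in> {0..<\<bar>P\<bar>}" using assms(1) by (simp add: n_def)
  have "m = n + P * (sgn P * (m div \<bar>P\<bar>))"
    by (simp add: n_def mult.assoc[symmetric] abs_sgn[symmetric])
  then obtain k where k: "m = n + P * k" by blast
  have "t = (\<phi> + 2 * of_int n * pi) / of_int P + 2 * of_int k * pi"
  proof -
    have "of_int P * t = \<phi> + 2 * of_int n * pi + of_int P * (2 * of_int k * pi)"
      using m unfolding k by (simp add: algebra_simps)
    then show ?thesis using assms(1) by (simp add: field_simps)
  qed
  then have "cis t = cis ((\<phi> + 2 * of_int n * pi) / of_int P)" unfolding cis_eq_iff by blast
  then have ex: "w = of_real (c powr (1 / of_int P)) * cis ((\<phi> + 2 * of_int n * pi) / of_int P)"
    using w x by simp
  show ?thesis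
  proof (rule ex1I[of _ n])
    show "n \<in> {0..<\<bar>P\<bar>} \<and> w = of_real (c powr (1 / of_int P)) * cis ((\<phi> + 2 * of_int n * pi) / of_int P)"
      using ex \<open>n \<in> {0..<\<bar>P\<bar>}\<close> by blast
    fix n' :: int
    assume n': "n' \<in> {0..<\<bar>P\<bar>} \<and> w = of_real (c powr (1 / of_int P)) * cis ((\<phi> + 2 * of_int n' * pi) / of_int P)"
    then have "cis ((\<phi> + 2 * of_int n' * pi) / of_int P) = cis ((\<phi> + 2 * of_int n * pi) / of_int P)"
      using ex assms(3) by simp
    then obtain j :: int where "(\<phi> + 2 * of_int n' * pi) / of_int P = (\<phi> + 2 * of_int n * pi) / of_int P + 2 * of_int j * pi"
      unfolding cis_eq_iff by blast
    then have "2 * pi * of_int n' = 2 * pi * (of_int n + of_int j * of_int P)"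
      using assms(1) by (simp add: field_simps)
    then have "(of_int n' :: real) = of_int n + of_int j * of_int P" by simp
    then have "n' = n + j * P" by (metis of_int_add of_int_eq_iff of_int_mult)
    then have "n' mod \<bar>P\<bar> = n mod \<bar>P\<bar>"
      by (simp add: mod_eq_dvd_iff)
    then show "n' = n" using n' \<open>n \<in> {0..<\<bar>P\<bar>}\<close> by simp
  qed
qed

lemma prod_powr_cis:
  assumes "0 < x"
  shows "(\<Prod>l\<in>A. of_real (x powr u l) * cis (v l)) = of_real (x powr (\<Sum>l\<in>A. u l)) * cis (\<Sum>l\<in>A. v l)"
  using assms by (induction A rule: infinite_finite_induct) (simp_all add: powr_add cis_mult[symmetric] mult_ac)

lemma minus_1_powi_cis: "(-1 :: complex) powi k = cis (of_int k * pi)"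
  by (metis cis_pi cis_power_int)

lemma F_set_upper:
  assumes "a \<in> F_set" "norm a = 1" "a \<noteq> 1" "a \<noteq> -1" shows "0 < Arg a" "Arg a < pi"
proof -
  have "Im a \<ge> 0" using assms(1,2) F_set_iff by auto
  moreover have "Im a \<noteq> 0"
  proof
    assume "Im a = 0"
    then obtain x where "a = of_real x" by (metis complex_is_Real_iff Reals_cases)
    with assms show False by (auto simp: abs_if split: if_splits)
  qed
  ultimately have "0 < Im a" by simp
  then show "0 < Arg a" "Arg a < pi" using Arg_lt_pi[of a] by auto
qed

context montesinos
begin

lemma s_of_cis:
  "s_of ks a ns l = of_real (norm a powr (1 / of_int (p l))) *
     cis ((Arg a + of_int (pt l) * pi + 2 * of_int (ns l) * pi) / of_int (p l))"
  by (simp add: s_of_def cis_conv_exp)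

lemma s_of_unique:
  assumes "normal \<rho> a" "s_vals \<rho> a s" "l \<in> {1..r}"
  shows "\<exists>!n::int. n \<in> {0..<\<bar>p l\<bar>} \<and> s l = s_of ks a (\<lambda>_. n) l"
proof -
  interpret coded_rep r ks \<rho> a s using assms by (intro coded)
  have a: "a = of_real (norm a) * cis (Arg a)" using rcis_cmod_Arg[of a] by (simp add: rcis_def)
  have "s l powi p l = of_real (norm a) * cis (Arg a + of_int (pt l) * pi)"
    unfolding s_pow'[OF assms(3)] minus_1_powi_cis by (subst a) (simp add: cis_mult[symmetric] mult_ac)
  from root_parameter[OF p_nonzero[OF assms(3)] s_nonzero[OF assms(3)] _ this] a_nonzero
  show ?thesis unfolding s_of_cis by simp
qed

lemma ns_unique:
  assumes "normal \<rho> a" "s_vals \<rho> a s"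
  shows "\<exists>!ns. ns \<in> (\<Pi>\<^sub>E l\<in>{1..r}. {0..<\<bar>p l\<bar>}) \<and> s = restrict (s_of ks a ns) {1..r}"
proof -
  have loc: "s_of ks a (\<lambda>_. ns l) l = s_of ks a ns l" for ns l by (simp add: s_of_def)
  define ns where "ns = restrict (\<lambda>l. THE n. n \<in> {0..<\<bar>p l\<bar>} \<and> s l = s_of ks a (\<lambda>_. n) l) {1..r}"
  have ns: "ns l \<in> {0..<\<bar>p l\<bar>} \<and> s l = s_of ks a (\<lambda>_. ns l) l" if "l \<in> {1..r}" for l
    using theI'[OF s_of_unique[OF assms that]] that by (simp only: ns_def restrict_apply' if_True)
  show ?thesis
  proof (rule ex1I[of _ ns])
    have "ns \<in> (\<Pi>\<^sub>E l\<in>{1..r}. {0..<\<bar>p l\<bar>})"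
      using ns by (intro PiE_I) (auto simp: ns_def)
    moreover have "s = restrict (s_of ks a ns) {1..r}"
      by (rule extensionalityI[OF s_values_ext[OF assms(2)] restrict_extensional]) (use ns loc in auto)
    ultimately show "ns \<in> (\<Pi>\<^sub>E l\<in>{1..r}. {0..<\<bar>p l\<bar>}) \<and> s = restrict (s_of ks a ns) {1..r}" ..
    fix ns' assume ns': "ns' \<in> (\<Pi>\<^sub>E l\<in>{1..r}. {0..<\<bar>p l\<bar>}) \<and> s = restrict (s_of ks a ns') {1..r}"
    show "ns' = ns"
    proof (rule extensionalityI[where A = "{1..r}"])
      show "ns' \<in> extensional {1..r}" using ns' by (auto simp: PiE_def)
      show "ns \<in> extensional {1..r}" by (simp add: ns_def)
      fix l assume l: "l \<in> {1..r}"
      have "s l = restrict (s_of ks a ns') {1..r} l" using ns' by simp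
      then have "s l = s_of ks a (\<lambda>_. ns' l) l" using l loc by simp
      moreover have "ns' l \<in> {0..<\<bar>p l\<bar>}" using ns' l by (auto simp: PiE_def Pi_def)
      ultimately show "ns' l = ns l" using s_of_unique[OF assms l] ns[OF l] by metis
    qed
  qed
qed

text \<open>The identity \<open>pt q - p qt = 1\<close> turns the term \<open>pt q / p\<close> of the argument of \<open>s\<^sup>q\<close>
  into \<open>qt + 1 / p\<close>.\<close>

lemma closing_angles:
  assumes "acc s (Suc r) = 1" "\<And>l. l \<in> {1..r} \<Longrightarrow> s l = s_of ks a ns l" "a \<noteq> 0"
  shows "norm a powr mu r ks = 1"
    "\<exists>n::int. mu r ks * Arg a = (2 * of_int n + of_nat r - angle_sum r ks ns) * pi"
proof -
  define \<alpha> where "\<alpha> l = of_int (q l) / of_int (p l) * Arg a +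
    ((2 * of_int (ns l) * of_int (q l) + 1) / of_int (p l) + (2 * of_int (qt l) - 1)) * pi" for l
  have factor: "eq l * s l powi q l = of_real (norm a powr (of_int (q l) / of_int (p l))) * cis (\<alpha> l)"
    if l: "l \<in> {1..r}" for l
  proof -
    have det: "pt l * q l = 1 + p l * qt l" using rat_det[OF ks_nonempty[OF l]] by simp
    have "(of_int (pt l * q l) :: real) = of_int (1 + p l * qt l)" using det by simp
    then have det': "(of_int (pt l) * of_int (q l) :: real) = 1 + of_int (p l) * of_int (qt l)" by simp
    have p0: "(of_int (p l) :: real) \<noteq> 0" using p_nonzero[OF l] by simp
    have e1: "(norm a powr (1 / of_int (p l))) powi q l = norm a powr (of_int (q l) / of_int (p l))"
      using assms(3) by (simp add: powr_powr flip: powr_real_of_int')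
    have "of_int (q l) * ((Arg a + of_int (pt l) * pi + 2 * of_int (ns l) * pi) / of_int (p l)) + of_int (qt l - 1) * pi = \<alpha> l"
    proof -
      have "of_int (q l) * (Arg a + of_int (pt l) * pi + 2 * of_int (ns l) * pi) =
        of_int (q l) * Arg a + (of_int (pt l) * of_int (q l)) * pi + 2 * of_int (ns l) * of_int (q l) * pi"
        by (simp add: algebra_simps)
      also have "\<dots> = of_int (q l) * Arg a + (2 * of_int (ns l) * of_int (q l) + 1) * pi + of_int (p l) * (of_int (qt l) * pi)"
        unfolding det' by (simp add: algebra_simps)
      finally show ?thesis
        using p0 by (simp add: \<alpha>_def field_simps)
    qed
    then have "cis (of_int (q l) * ((Arg a + of_int (pt l) * pi + 2 * of_int (ns l) * pi) / of_int (p l))) * cis (of_int (qt l - 1) * pi) = cis (\<alpha> l)"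
      unfolding cis_mult by simp
    then show ?thesis
      unfolding assms(2)[OF l] s_of_cis power_int_mult_distrib cis_power_int minus_1_powi_cis
      unfolding of_real_power_int[symmetric] e1 by (simp add: mult_ac)
  qed
  have "acc s (Suc r) = (\<Prod>l=1..r. of_real (norm a powr (of_int (q l) / of_int (p l))) * cis (\<alpha> l))"
    unfolding acc_def by (rule prod.cong) (use factor in auto)
  also have "\<dots> = of_real (norm a powr mu r ks) * cis (\<Sum>l=1..r. \<alpha> l)"
    using assms(3) by (subst prod_powr_cis) (auto simp: mu_def)
  finally have 1: "of_real (norm a powr mu r ks) * cis (\<Sum>l=1..r. \<alpha> l) = 1" using assms(1) by simp
  then have "norm (of_real (norm a powr mu r ks) * cis (\<Sum>l=1..r. \<alpha> l)) = 1" by simp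
  then show n1: "norm a powr mu r ks = 1" by (simp add: norm_mult)
  have "cis (\<Sum>l=1..r. \<alpha> l) = cis 0" using 1 n1 by simp
  then obtain m :: int where m: "(\<Sum>l=1..r. \<alpha> l) = 2 * of_int m * pi" unfolding cis_eq_iff by auto
  have "(\<Sum>l=1..r. \<alpha> l) = mu r ks * Arg a + (angle_sum r ks ns + (2 * of_int (\<Sum>l=1..r. qt l) - of_nat r)) * pi"
    unfolding \<alpha>_def mu_def angle_sum_def
    by (simp add: sum.distrib sum_subtractf sum_distrib_left sum_distrib_right distrib_right left_diff_distrib)
  with m have "mu r ks * Arg a = (2 * of_int (m - (\<Sum>l=1..r. qt l)) + of_nat r - angle_sum r ks ns) * pi"
    by (simp add: algebra_simps)
  then show "\<exists>n::int. mu r ks * Arg a = (2 * of_int n + of_nat r - angle_sum r ks ns) * pi" by blast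
qed

lemma angle_codeD:
  assumes "angle_code r ks a \<rho> ns"
  shows "normal \<rho> a" "a \<noteq> 1" "a \<noteq> -1" "s_vals \<rho> a (restrict (s_of ks a ns) {1..r})"
    "Y \<rho> 1 = A_mat (restrict (s_of ks a ns) {1..r} 1)" "ns \<in> (\<Pi>\<^sub>E l\<in>{1..r}. {0..<\<bar>p l\<bar>})"
  using assms one_in by (simp_all add: angle_code_def)

lemma angle_code_determined:
  assumes "angle_code r ks a \<rho> ns" "angle_code r ks a \<rho>' ns" shows "\<rho> = \<rho>'"
proof -
  note c = angle_codeD[OF assms(1)] and d = angle_codeD[OF assms(2)]
  let ?s = "restrict (s_of ks a ns) {1..r}"
  interpret a: coded_rep r ks \<rho> a ?s using c by (intro coded)
  interpret b: coded_rep r ks \<rho>' a ?s using d by (intro coded)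
  show ?thesis
    by (rule reps_determined[OF a.rep b.rep])
      (use a.generic_values(1)[OF c(2,3,5)] b.generic_values(1)[OF c(2,3) d(5)] in simp)
qed

lemma angle_code_unique:
  assumes "angle_code r ks a \<rho> ns" "angle_code r ks a \<rho> ns'" shows "ns = ns'"
proof -
  note c = angle_codeD[OF assms(1)] and d = angle_codeD[OF assms(2)]
  have "restrict (s_of ks a ns') {1..r} = restrict (s_of ks a ns) {1..r}"
    using s_values_generic_unique[OF d(4) c(4) c(2,3)] .
  then show ?thesis using ns_unique[OF c(1,4)] c(6) d(6) by metis
qed

lemma angle_code_exists:
  assumes "normal \<rho> a" "a \<noteq> 1" "a \<noteq> -1" "s_vals \<rho> a s" "Y \<rho> 1 = A_mat (s 1)"
  obtains ns where "angle_code r ks a \<rho> ns"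
proof -
  interpret coded_rep r ks \<rho> a s using assms by (intro coded)
  obtain ns where ns: "ns \<in> (\<Pi>\<^sub>E l\<in>{1..r}. {0..<\<bar>p l\<bar>})" "s = restrict (s_of ks a ns) {1..r}"
    using ns_unique[OF assms(1,4)] by blast
  have "s 1 = s_of ks a ns 1" unfolding ns(2) using one_in by simp
  then have "angle_code r ks a \<rho> ns"
    unfolding angle_code_def using assms ns generic_irreducible by auto
  then show thesis by (rule that)
qed

lemma angle_code_angles:
  assumes "angle_code r ks a \<rho> ns"
  shows "norm a powr mu r ks = 1"
    "\<exists>n::int. mu r ks * Arg a = (2 * of_int n + of_nat r - angle_sum r ks ns) * pi"
proof -
  note c = angle_codeD[OF assms]
  interpret coded_rep r ks \<rho> a "restrict (s_of ks a ns) {1..r}" using c by (intro coded)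
  note closing = closing_angles[OF generic_values(2)[OF c(2,3,5)], of a ns]
  show "norm a powr mu r ks = 1"
    "\<exists>n::int. mu r ks * Arg a = (2 * of_int n + of_nat r - angle_sum r ks ns) * pi"
    using closing a_nonzero by simp_all
qed

lemma generic_determined_mu_zero:
  assumes "angle_code r ks a \<rho> ns" "mu r ks = 0"
  shows "determined_by_unique (irreducible_code_mu_zero r ks a) \<rho>"
proof -
  obtain n :: int where "mu r ks * Arg a = (2 * of_int n + of_nat r - angle_sum r ks ns) * pi"
    using angle_code_angles(2)[OF assms(1)] by blast
  then have n: "angle_sum r ks ns = 2 * of_int n + of_nat r" using assms(2) by simp
  have code: "irreducible_code_mu_zero r ks a \<rho> (n, ns)"
    using assms(1) n by (simp add: irreducible_code_mu_zero_def)
  have unique: "t = (n, ns)" if c: "irreducible_code_mu_zero r ks a \<rho> t" for t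
  proof -
    obtain n' ns' where t: "t = (n', ns')" by (cases t)
    have c': "angle_code r ks a \<rho> ns'" "angle_sum r ks ns' = 2 * of_int n' + of_nat r"
      using c by (auto simp: t irreducible_code_mu_zero_def)
    have "ns' = ns" by (rule angle_code_unique[OF c'(1) assms(1)])
    then show ?thesis using c'(2) n t by simp
  qed
  have det: "\<rho>' = \<rho>" if "irreducible_code_mu_zero r ks a \<rho> t" "irreducible_code_mu_zero r ks a \<rho>' t" for t \<rho>'
    using that angle_code_determined by (auto simp: irreducible_code_mu_zero_def split: prod.splits)
  show ?thesis
    unfolding determined_by_unique_def using code unique det by blast
qed

lemma generic_determined_mu_nonzero:
  assumes "angle_code r ks a \<rho> ns" "mu r ks \<noteq> 0"
  shows "norm a = 1" "determined_by_unique (irreducible_code_mu_nonzero r ks) \<rho>"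
proof -
  note c = angle_codeD[OF assms(1)]
  have a: "a \<in> F_set" "a \<noteq> 0" using c(1) by (auto simp: normalized_iff)
  show n1: "norm a = 1"
  proof -
    have "mu r ks * ln (norm a) = ln (norm a powr mu r ks)" using a by (simp add: ln_powr)
    then have "ln (norm a) = 0" using angle_code_angles(1)[OF assms(1)] assms(2) by simp
    then show ?thesis using a by simp
  qed
  obtain n :: int where n: "mu r ks * Arg a = (2 * of_int n + of_nat r - angle_sum r ks ns) * pi"
    using angle_code_angles(2)[OF assms(1)] by auto
  define \<delta> where "\<delta> = 2 * of_int n + of_nat r - angle_sum r ks ns"
  have arg: "Arg a = pi / mu r ks * \<delta>" using n assms(2) by (simp add: \<delta>_def field_simps)
  have "\<delta> = (1 - Arg a / pi) * 0 + Arg a / pi * mu r ks" using n by (simp add: \<delta>_def field_simps)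
  moreover have "0 < Arg a / pi" "Arg a / pi < 1" using F_set_upper[OF a(1) n1 c(2,3)] by simp_all
  ultimately have "\<delta> \<in> open_segment 0 (mu r ks)"
    using assms(2) unfolding in_segment by (intro conjI exI[of _ "Arg a / pi"]) auto
  then have "\<delta> \<in> open_segment (2 * of_int 0 * mu r ks) ((2 * of_int 0 + 1) * mu r ks)" by simp
  then have seg: "\<exists>k::int. \<delta> \<in> open_segment (2 * of_int k * mu r ks) ((2 * of_int k + 1) * mu r ks)" by blast
  have code: "irreducible_code_mu_nonzero r ks \<rho> (n, ns)"
    unfolding irreducible_code_mu_nonzero_def prod.case Let_def \<delta>_def[symmetric]
    using assms(1) n1 arg seg by blast
  have D: "\<exists>a. angle_code r ks a \<sigma> ns' \<and> norm a = 1 \<and> Arg a = pi / mu r ks * (2 * of_int n' + of_nat r - angle_sum r ks ns')"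
    if "irreducible_code_mu_nonzero r ks \<sigma> (n', ns')" for \<sigma> n' ns'
    using that unfolding irreducible_code_mu_nonzero_def prod.case Let_def by blast
  have unique: "t = (n, ns)" if c': "irreducible_code_mu_nonzero r ks \<rho> t" for t
  proof -
    obtain n' ns' where t: "t = (n', ns')" by (cases t)
    obtain a' where a': "angle_code r ks a' \<rho> ns'"
      "Arg a' = pi / mu r ks * (2 * of_int n' + of_nat r - angle_sum r ks ns')"
      using D[OF c'[unfolded t]] by blast
    have "a' + inverse a' = a + inverse a" "a' \<in> F_set" "a' \<noteq> 0"
      using angle_codeD(1)[OF a'(1)] c(1) by (auto simp: normalized_iff)
    then have aa: "a' = a" using F_set_inj a by blast
    then have nn: "ns' = ns" using angle_code_unique a'(1) assms(1) by blast
    have "pi / mu r ks * (2 * of_int n' + of_nat r - angle_sum r ks ns) = pi / mu r ks * \<delta>"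
      by (rule trans[OF a'(2)[unfolded aa nn, symmetric] arg])
    then have "\<delta> = 2 * of_int n' + of_nat r - angle_sum r ks ns"
      using assms(2) by auto
    then have "n' = n" by (simp add: \<delta>_def)
    then show ?thesis using nn t by simp
  qed
  have det: "\<rho>' = \<rho>" if c': "irreducible_code_mu_nonzero r ks \<rho> t" "irreducible_code_mu_nonzero r ks \<rho>' t" for t \<rho>'
  proof -
    obtain n' ns' where t: "t = (n', ns')" by (cases t)
    obtain a1 where a1: "angle_code r ks a1 \<rho> ns'" "norm a1 = 1"
      "Arg a1 = pi / mu r ks * (2 * of_int n' + of_nat r - angle_sum r ks ns')"
      using D[OF c'(1)[unfolded t]] by blast
    obtain a2 where a2: "angle_code r ks a2 \<rho>' ns'" "norm a2 = 1"
      "Arg a2 = pi / mu r ks * (2 * of_int n' + of_nat r - angle_sum r ks ns')"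
      using D[OF c'(2)[unfolded t]] by blast
    have "a1 = a2" using a1 a2 by (metis rcis_cmod_Arg)
    then show ?thesis using a1 a2 angle_code_determined by blast
  qed
  show "determined_by_unique (irreducible_code_mu_nonzero r ks) \<rho>"
    unfolding determined_by_unique_def using code unique det by blast
qed

section \<open>Normal forms in conjugacy classes\<close>

definition normal_form :: "(dart \<Rightarrow> cmat) \<Rightarrow> complex \<Rightarrow> bool" where
  "normal_form \<rho> a \<longleftrightarrow> normal \<rho> a \<and>
     (reducible \<rho> \<and> \<not> abelian \<rho> \<longrightarrow>
       (\<forall>s. s_vals \<rho> a s \<longrightarrow> Y \<rho> 1 \<in> {S_mat (s 1), S'_mat (s 1)})) \<and>
     (\<not> reducible \<rho> \<and> a \<in> {1, -1} \<longrightarrow>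
       (\<exists>s h. s_vals \<rho> a s \<and> (\<forall>l\<in>{1..r}. s l \<in> F_set) \<and> first_generic \<rho> s h \<and> second_A_mat \<rho> s h)) \<and>
     (\<not> reducible \<rho> \<and> a \<notin> {1, -1} \<longrightarrow>
       (\<forall>s. s_vals \<rho> a s \<longrightarrow> Y \<rho> 1 = A_mat (s 1)))"

definition classified :: "(dart \<Rightarrow> cmat) \<Rightarrow> complex \<Rightarrow> bool" where
  "classified \<rho> a \<longleftrightarrow> normal \<rho> a \<and>
        (abelian \<rho> \<longrightarrow>
           a \<in> {1, -1} \<and> determined_by_unique (abelian_code r ks a) \<rho>) \<and>
        (reducible \<rho> \<and> \<not> abelian \<rho> \<longrightarrow>
           mu r ks = 0 \<and> a \<in> {1, -1} \<and>
           (\<exists>!s. reducible_code r ks a \<rho> s) \<and>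
           (\<forall>s. reducible_code r ks a \<rho> s \<longrightarrow>
              mont_Y r ks \<rho> 1 \<in> {S_mat (s 1), S'_mat (s 1)} \<and>
              (\<forall>Y \<in> {S_mat (s 1), S'_mat (s 1)}.
                 \<exists>!\<rho>'. reducible_code r ks a \<rho>' s \<and> mont_Y r ks \<rho>' 1 = Y))) \<and>
        (\<not> reducible \<rho> \<and> a \<in> {1, -1} \<longrightarrow>
           determined_by_unique (irreducible_code r ks a) \<rho>) \<and>
        (mu r ks = 0 \<and> \<not> reducible \<rho> \<and> a \<notin> {1, -1} \<longrightarrow>
           determined_by_unique (irreducible_code_mu_zero r ks a) \<rho>) \<and>
        (mu r ks \<noteq> 0 \<and> \<not> reducible \<rho> \<and> a \<notin> {1, -1} \<longrightarrow>
           norm a = 1 \<and> determined_by_unique (irreducible_code_mu_nonzero r ks) \<rho>)"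

lemma normal_form_classified:
  assumes "normal_form \<rho> a" shows "classified \<rho> a"
proof -
  have n: "normal \<rho> a" using assms by (simp add: normal_form_def)
  have red: "mu r ks = 0 \<and> a \<in> {1, -1} \<and> (\<exists>!s. reducible_code r ks a \<rho> s) \<and>
      (\<forall>s. reducible_code r ks a \<rho> s \<longrightarrow> Y \<rho> 1 \<in> {S_mat (s 1), S'_mat (s 1)} \<and>
        (\<forall>N \<in> {S_mat (s 1), S'_mat (s 1)}. \<exists>!\<rho>'. reducible_code r ks a \<rho>' s \<and> Y \<rho>' 1 = N))"
    if c: "reducible \<rho>" "\<not> abelian \<rho>"
  proof (intro conjI allI impI ballI)
    obtain s where s: "s_vals \<rho> a s" using s_values_exist[OF n] by blast
    show "mu r ks = 0" by (rule reducible_values(2)[OF n c s])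
    show "a \<in> {1, -1}" using reducible_nilp(1)[OF n c s] by simp
    show "\<exists>!s. reducible_code r ks a \<rho> s" by (rule reducible_unique_code[OF n c])
  next
    fix s assume code: "reducible_code r ks a \<rho> s"
    show Y: "Y \<rho> 1 \<in> {S_mat (s 1), S'_mat (s 1)}"
      using assms c reducible_codeD(4)[OF code] unfolding normal_form_def by blast
    fix N assume "N \<in> {S_mat (s 1), S'_mat (s 1)}"
    then show "\<exists>!\<rho>'. reducible_code r ks a \<rho>' s \<and> Y \<rho>' 1 = N"
      by (rule reducible_two_choices[OF code Y])
  qed
  have irr: "determined_by_unique (irreducible_code r ks a) \<rho>"
    if c: "\<not> reducible \<rho>" "a \<in> {1, -1}"
  proof -
    obtain s h where "s_vals \<rho> a s" "\<forall>l\<in>{1..r}. s l \<in> F_set" "first_generic \<rho> s h" "second_A_mat \<rho> s h"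
      using assms c unfolding normal_form_def by blast
    then show ?thesis using irreducible_determined[OF n c(1)] c(2) by blast
  qed
  have gen: "\<exists>ns. angle_code r ks a \<rho> ns"
    if c: "\<not> reducible \<rho>" "a \<notin> {1, -1}"
  proof -
    obtain s where s: "s_vals \<rho> a s" using s_values_exist[OF n] by blast
    then have "Y \<rho> 1 = A_mat (s 1)" using assms c unfolding normal_form_def by blast
    then show ?thesis using angle_code_exists[OF n _ _ s] c(2) by blast
  qed
  show ?thesis
    unfolding classified_def
  proof (intro conjI impI; (elim conjE)?)
    assume c: "reducible \<rho>" "\<not> abelian \<rho>"
    note red = red[OF c]
    from red show "mu r ks = 0" "a \<in> {1, -1}" "\<exists>!s. reducible_code r ks a \<rho> s" by blast+
    from red show "\<forall>s. reducible_code r ks a \<rho> s \<longrightarrow>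
        Y \<rho> 1 \<in> {S_mat (s 1), S'_mat (s 1)} \<and>
        (\<forall>N \<in> {S_mat (s 1), S'_mat (s 1)}. \<exists>!\<rho>'. reducible_code r ks a \<rho>' s \<and> Y \<rho>' 1 = N)"
      by (elim conjE)
  qed (use n abelian_determined[OF n] irr gen generic_determined_mu_zero generic_determined_mu_nonzero in blast)+
qed

lemma classified_normal_form:
  assumes "classified \<rho> a" shows "normal_form \<rho> a"
proof -
  have n: "normal \<rho> a" using assms by (simp add: classified_def)
  show ?thesis
    unfolding normal_form_def
  proof (intro conjI impI allI)
    show "normal \<rho> a" by (rule n)
  next
    fix s assume c: "reducible \<rho> \<and> \<not> abelian \<rho>" and s: "s_vals \<rho> a s"
    have "reducible_code r ks a \<rho> s" using reducible_values(3)[OF n _ _ s] c by blast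
    then show "Y \<rho> 1 \<in> {S_mat (s 1), S'_mat (s 1)}" using assms c unfolding classified_def by blast
  next
    assume c: "\<not> reducible \<rho> \<and> a \<in> {1, -1}"
    then have "determined_by_unique (irreducible_code r ks a) \<rho>"
      using assms unfolding classified_def by blast
    then obtain t where t: "irreducible_code r ks a \<rho> t" unfolding determined_by_unique_def by blast
    obtain h s x where "t = (h, s, x)" by (metis prod_cases3)
    with t have "irreducible_code r ks a \<rho> (h, s, x)" by simp
    from irreducible_codeD(3-6)[OF this] show "\<exists>s h. s_vals \<rho> a s \<and> (\<forall>l\<in>{1..r}. s l \<in> F_set) \<and> first_generic \<rho> s h \<and> second_A_mat \<rho> s h"
      by blast
  next
    fix s assume c: "\<not> reducible \<rho> \<and> a \<notin> {1, -1}" and s: "s_vals \<rho> a s"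
    have "\<exists>ns. angle_code r ks a \<rho> ns"
    proof (cases "mu r ks = 0")
      case True
      then have "determined_by_unique (irreducible_code_mu_zero r ks a) \<rho>"
        using assms c unfolding classified_def by blast
      then show ?thesis by (auto simp: determined_by_unique_def irreducible_code_mu_zero_def)
    next
      case False
      then have "determined_by_unique (irreducible_code_mu_nonzero r ks) \<rho>"
        using assms c unfolding classified_def by blast
      then obtain t where t: "irreducible_code_mu_nonzero r ks \<rho> t"
        unfolding determined_by_unique_def by blast
      obtain n' ns where "t = (n', ns)" by (cases t)
      with t obtain a' where a': "angle_code r ks a' \<rho> ns"
        unfolding irreducible_code_mu_nonzero_def Let_def by auto
      then have "a' = a"
        using n F_set_inj[of a' a] angle_codeD(1)[OF a'] by (auto simp: normalized_iff)
      then show ?thesis using a' by blast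
    qed
    then obtain ns where ns: "angle_code r ks a \<rho> ns" by blast
    have "restrict (s_of ks a ns) {1..r} = s"
      using s_values_generic_unique[OF angle_codeD(4)[OF ns] s] angle_codeD(2,3)[OF ns] by blast
    then show "Y \<rho> 1 = A_mat (s 1)" using angle_codeD(5)[OF ns] by simp
  qed
qed

definition conj_diag :: "complex \<Rightarrow> cmat \<Rightarrow> cmat" where
  "conj_diag t N = diag_mat t ** N ** matrix_inv (diag_mat t)"

lemma conj_diag_tf: "t \<noteq> 0 \<Longrightarrow> conj_diag t (tf x y z) = tf x (t\<^sup>2 * y) (z / t\<^sup>2)"
  by (simp add: conj_diag_def diag_mat_conj)

lemma conj_diag_A_1: "t \<noteq> 0 \<Longrightarrow> conj_diag t (A_mat 1) = A_mat 1"
  by (simp add: A_mat_1 conj_diag_tf)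

lemma isometry_conj_diag: "t \<noteq> 0 \<Longrightarrow> isometry (conj_diag t)"
  using isometry_conj[OF det_diag_mat] unfolding conj_diag_def[abs_def] by blast

lemma conj_diag_scale: "t \<noteq> 0 \<Longrightarrow> conj_diag t (c *\<^sub>m N) = c *\<^sub>m conj_diag t N"
  using isometry_conj_diag unfolding isometry_def by blast

lemma conj_diag_entries_0:
  assumes "t \<noteq> 0" "N \<in> SL0"
  shows "conj_diag t N $ 1 $ 2 = 0 \<longleftrightarrow> N $ 1 $ 2 = 0" "conj_diag t N $ 2 $ 1 = 0 \<longleftrightarrow> N $ 2 $ 1 = 0"
  using assms by (auto elim!: SL0_obtain_tf simp: conj_diag_tf)

lemma conj_diag_properties:
  assumes "normal \<rho> a" "t \<noteq> 0"
  defines "\<rho>' \<equiv> map_rep (conj_diag t) \<rho>"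
  shows "normal \<rho>' a" "s_vals \<rho>' a s \<longleftrightarrow> s_vals \<rho> a s"
    "reducible \<rho>' \<longleftrightarrow> reducible \<rho>" "abelian \<rho>' \<longleftrightarrow> abelian \<rho>"
    "first_generic \<rho>' s h \<longleftrightarrow> first_generic \<rho> s h" "conjugate_reps M \<rho> \<rho>'"
proof -
  note v = isometry_map_values[OF isometry_conj_diag[OF assms(2)] conj_diag_A_1[OF assms(2)] assms(1), folded \<rho>'_def]
  show n: "normal \<rho>' a" and "s_vals \<rho>' a s \<longleftrightarrow> s_vals \<rho> a s"
    using v by blast+
  note rep = normalized_reps[OF assms(1)] and rep' = normalized_reps[OF n]
  note X1 = normalized_X_1[OF assms(1)] and X1' = normalized_X_1[OF n]
  have e: "X \<rho>' l = conj_diag t (X \<rho> l)" "Y \<rho>' l = conj_diag t (Y \<rho> l)" "X \<rho> l \<in> SL0" "Y \<rho> l \<in> SL0" if "l \<in> {1..r}" for l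
    using that X_SL0[OF rep] Y_SL0[OF rep] by (auto simp: \<rho>'_def map_rep_X map_rep_Y)
  have "upper \<rho>' \<longleftrightarrow> upper \<rho>" "lower \<rho>' \<longleftrightarrow> lower \<rho>"
    unfolding upper_def lower_def using e conj_diag_entries_0[OF assms(2)] by auto
  then show "reducible \<rho>' \<longleftrightarrow> reducible \<rho>" "abelian \<rho>' \<longleftrightarrow> abelian \<rho>"
    using reducible_iff[OF rep X1] reducible_iff[OF rep' X1'] abelian_iff[OF rep X1] abelian_iff[OF rep' X1']
    by blast+
  show "first_generic \<rho>' s h \<longleftrightarrow> first_generic \<rho> s h" by (simp add: first_generic_def)
  show "conjugate_reps M \<rho> \<rho>'"
    unfolding conjugate_reps_iff[OF rep'] unfolding \<rho>'_def conj_diag_def[abs_def]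
    using det_diag_mat[OF assms(2)] by (intro exI[of _ "diag_mat t"]) simp
qed

lemma normal_form_exists:
  assumes "normal \<rho> a"
  obtains t where "t \<noteq> 0" "normal_form (map_rep (conj_diag t) \<rho>) a"
proof -
  note P = conj_diag_properties[OF assms]
  note rep = normalized_reps[OF assms]
  consider "abelian \<rho>" | "reducible \<rho>" "\<not> abelian \<rho>"
    | "\<not> reducible \<rho>" "a \<in> {1, -1}" | "\<not> reducible \<rho>" "a \<notin> {1, -1}" by blast
  then show thesis
  proof cases
    case 1
    then have "reducible \<rho>"
      using reducible_iff[OF rep normalized_X_1[OF assms]] abelian_iff[OF rep normalized_X_1[OF assms]] by blast
    then show thesis using P[of 1] 1 by (intro that[of 1]) (auto simp: normal_form_def)
  next
    case 2
    obtain s where s: "s_vals \<rho> a s" using s_values_exist[OF assms] by blast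
    obtain y z where yz: "Y \<rho> 1 = tf (s 1) y z" "y * z = 0" "y \<noteq> 0 \<or> z \<noteq> 0"
      using reducible_values(4)[OF assms 2 s] by blast
    define t where "t = (if z = 0 then inverse (csqrt y) else csqrt z)"
    have t0: "t \<noteq> 0" using yz by (auto simp: t_def)
    have "Y (map_rep (conj_diag t) \<rho>) 1 = tf (s 1) (t\<^sup>2 * y) (z / t\<^sup>2)"
      using map_rep_Y[OF one_in] yz(1) conj_diag_tf[OF t0] by simp
    also have "\<dots> \<in> {S_mat (s 1), S'_mat (s 1)}"
      using yz by (auto simp: t_def S_mat_tf power_inverse)
    finally have Y: "Y (map_rep (conj_diag t) \<rho>) 1 \<in> {S_mat (s 1), S'_mat (s 1)}" .
    have "s' = s" if "s_vals \<rho> a s'" for s'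
      using reducible_unique_code[OF assms 2] reducible_values(3)[OF assms 2] s that by blast
    then show thesis using t0 P[OF t0] Y 2 by (intro that[of t]) (auto simp: normal_form_def)
  next
    case 3
    have a: "a = 1 \<or> a = -1" using 3 by simp
    obtain s where s: "s_vals \<rho> a s" "\<forall>l\<in>{1..r}. s l \<in> F_set" using s_values_exist_F[OF assms] a by blast
    obtain h where h: "first_generic \<rho> s h" using irreducible_pm(2)[OF assms 3(1) a s(1)] by blast
    then have h1: "h \<in> {1..r}" "s h \<notin> {1, -1}" by (auto simp: first_generic_def)
    note b = first_generic_bil[OF assms 3(1) a s(1) h]
    have X: "X \<rho> (Suc h) \<in> SL0" using X_SL0[OF rep, of "Suc h"] h1 by auto
    then have X': "(acc s h * eq h) *\<^sub>m X \<rho> (Suc h) \<in> SL0" using b(2) SL0_uminus by auto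
    have sh: "s h \<noteq> 0" using s(1) h1 by (auto simp: s_values_iff)
    obtain t where t: "t \<noteq> 0" "conj_diag t ((acc s h * eq h) *\<^sub>m X \<rho> (Suc h)) = A_mat (s h powi q h)"
      using diag_conj_to_A_mat[OF X' _ _ _ b(1)] cheb_q_nonzero[OF assms a s(1) h1] sh
      unfolding conj_diag_def by (metis power_int_not_zero)
    have "X (map_rep (conj_diag t) \<rho>) (Suc h) = conj_diag t (X \<rho> (Suc h))"
      by (rule map_rep_X) (use h1 in auto)
    also have "\<dots> = (acc s h * eq h) *\<^sub>m ((acc s h * eq h) *\<^sub>m conj_diag t (X \<rho> (Suc h)))"
      using b(2) by auto
    also have "\<dots> = (acc s h * eq h) *\<^sub>m A_mat (s h powi q h)"
      using t(2) by (simp only: conj_diag_scale[OF t(1)])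
    finally have "second_A_mat (map_rep (conj_diag t) \<rho>) s h" unfolding second_A_mat_def .
    then show thesis using t P[OF t(1)] 3 s h by (intro that[of t]) (auto simp: normal_form_def)
  next
    case 4
    have a: "a \<noteq> 1" "a \<noteq> -1" using 4 by auto
    obtain s where s: "s_vals \<rho> a s" using s_values_exist[OF assms] by blast
    interpret coded_rep r ks \<rho> a s using assms s by (intro coded)
    obtain t where t: "t \<noteq> 0" "conj_diag t (Y \<rho> 1) = A_mat (s 1)"
      using diag_conj_to_A_mat[OF Y_SL0[OF rep one_in] s_nonzero[OF one_in] generic_s(1,2)[OF a one_in]]
        bil_X_Y[OF one_in] X_1 unfolding conj_diag_def by metis
    have Y: "Y (map_rep (conj_diag t) \<rho>) 1 = A_mat (s 1)" using map_rep_Y[OF one_in] t(2) by simp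
    have "s' = s" if "s_vals \<rho> a s'" for s'
      using s_values_generic_unique[OF that s a] .
    then show thesis using t P[OF t(1)] 4 Y by (intro that[of t]) (auto simp: normal_form_def)
  qed
qed

lemma conj_diag_square_1:
  assumes "normal \<rho> a" "t\<^sup>2 = 1" shows "map_rep (conj_diag t) \<rho> = \<rho>"
proof -
  have t0: "t \<noteq> 0" using assms(2) by auto
  note rep = normalized_reps[OF assms(1)]
  show ?thesis
  proof (rule reps_determined[OF normalized_reps[OF conj_diag_properties(1)[OF assms(1) t0]] rep])
    fix l assume l: "l \<in> {1..r}"
    then show "X (map_rep (conj_diag t) \<rho>) l = X \<rho> l \<and> Y (map_rep (conj_diag t) \<rho>) l = Y \<rho> l"
      using diag_conj_square_1[OF assms(2)] X_SL0[OF rep] Y_SL0[OF rep]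
      by (simp add: map_rep_X map_rep_Y conj_diag_def)
  qed
qed

lemma normal_form_unique_conj_diag:
  assumes "normal_form \<rho> a" "t \<noteq> 0" "normal_form (map_rep (conj_diag t) \<rho>) a"
  shows "map_rep (conj_diag t) \<rho> = \<rho>"
proof -
  have n: "normal \<rho> a" using assms(1) by (simp add: normal_form_def)
  note P = conj_diag_properties[OF n assms(2)]
  note rep = normalized_reps[OF n]
  consider "abelian \<rho>" | "reducible \<rho>" "\<not> abelian \<rho>"
    | "\<not> reducible \<rho>" "a \<in> {1, -1}" | "\<not> reducible \<rho>" "a \<notin> {1, -1}" by blast
  then show ?thesis
  proof cases
    case 1
    obtain s where s: "s_vals \<rho> a s" using s_values_exist[OF n] by blast
    show ?thesis
    proof (rule reps_determined[OF normalized_reps[OF P(1)] rep])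
      fix l assume l: "l \<in> {1..r}"
      show "X (map_rep (conj_diag t) \<rho>) l = X \<rho> l \<and> Y (map_rep (conj_diag t) \<rho>) l = Y \<rho> l"
        using abelian_values(3)[OF n 1 s l] l
        by (simp add: map_rep_X map_rep_Y conj_diag_scale[OF assms(2)] conj_diag_A_1[OF assms(2)])
    qed
  next
    case 2
    obtain s where s: "s_vals \<rho> a s" using s_values_exist[OF n] by blast
    have "Y \<rho> 1 \<in> {S_mat (s 1), S'_mat (s 1)}" using assms(1) 2 s unfolding normal_form_def by blast
    moreover have "conj_diag t (Y \<rho> 1) \<in> {S_mat (s 1), S'_mat (s 1)}"
      using assms(3) 2 s P map_rep_Y[OF one_in, of "conj_diag t" \<rho>] unfolding normal_form_def by auto
    ultimately have "t\<^sup>2 = 1" by (auto simp: S_mat_tf conj_diag_tf[OF assms(2)])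
    then show ?thesis by (rule conj_diag_square_1[OF n])
  next
    case 3
    have a: "a = 1 \<or> a = -1" using 3 by simp
    obtain s h where s: "s_vals \<rho> a s" "\<forall>l\<in>{1..r}. s l \<in> F_set" "first_generic \<rho> s h" "second_A_mat \<rho> s h"
      using assms(1) 3 unfolding normal_form_def by blast
    have "\<exists>s h. s_vals \<rho> a s \<and> (\<forall>l\<in>{1..r}. s l \<in> F_set) \<and> first_generic \<rho> s h
        \<and> second_A_mat (map_rep (conj_diag t) \<rho>) s h"
      using assms(3) 3 P unfolding normal_form_def by auto
    then obtain s' h' where s': "s_vals \<rho> a s'" "\<forall>l\<in>{1..r}. s' l \<in> F_set" "first_generic \<rho> s' h'"
      "second_A_mat (map_rep (conj_diag t) \<rho>) s' h'" by blast
    have ss: "s' = s" using s_values_F_unique s s' by blast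
    then have hh: "h' = h" using first_generic_unique s(3) s'(3) by blast
    have h1: "h \<in> {1..r}" "s h \<notin> {1, -1}" using s(3) by (auto simp: first_generic_def)
    have "X (map_rep (conj_diag t) \<rho>) (Suc h) = conj_diag t (X \<rho> (Suc h))"
      by (rule map_rep_X) (use h1 in auto)
    then have d: "conj_diag t ((acc s h * eq h) *\<^sub>m A_mat (s h powi q h)) = (acc s h * eq h) *\<^sub>m A_mat (s h powi q h)"
      using s(4) s'(4) unfolding ss hh second_A_mat_def by simp
    have sh: "s h \<noteq> 0" using s(1) h1 by (auto simp: s_values_iff)
    have "acc s h * eq h \<noteq> 0" using first_generic_bil(2)[OF n 3(1) a s(1,3)] by auto
    then have "t\<^sup>2 = 1"
      using diag_conj_fixes_A_mat[OF assms(2) _ _ _ _ d[unfolded conj_diag_def]] cheb_q_nonzero(2,3)[OF n a s(1) h1] sh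
      by (metis power_int_not_zero)
    then show ?thesis by (rule conj_diag_square_1[OF n])
  next
    case 4
    have a: "a \<noteq> 1" "a \<noteq> -1" using 4 by auto
    obtain s where s: "s_vals \<rho> a s" using s_values_exist[OF n] by blast
    interpret coded_rep r ks \<rho> a s using n s by (intro coded)
    have "Y \<rho> 1 = A_mat (s 1)" using assms(1) 4 s unfolding normal_form_def by blast
    moreover have "conj_diag t (Y \<rho> 1) = A_mat (s 1)"
      using assms(3) 4 s P map_rep_Y[OF one_in, of "conj_diag t" \<rho>] unfolding normal_form_def by auto
    ultimately have "conj_diag t (1 *\<^sub>m A_mat (s 1)) = 1 *\<^sub>m A_mat (s 1)" by simp
    then have "t\<^sup>2 = 1"
      using diag_conj_fixes_A_mat[OF assms(2) s_nonzero[OF one_in] generic_s(1,2)[OF a one_in], of 1]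
      unfolding conj_diag_def by simp
    then show ?thesis by (rule conj_diag_square_1[OF n])
  qed
qed

lemma conjugate_normalized:
  assumes "normal \<rho> a" "normal \<rho>' a'" "conjugate_reps M \<rho> \<rho>'"
  obtains t where "t \<noteq> 0" "\<rho>' = map_rep (conj_diag t) \<rho>" "a' = a"
proof -
  obtain P where P: "det P = 1" "\<rho>' = map_rep (\<lambda>N. P ** N ** matrix_inv P) \<rho>"
    using assms(3) conjugate_reps_iff[OF normalized_reps[OF assms(2)]] by blast
  have X1: "X \<rho> 1 = A_mat 1" "X \<rho>' 1 = A_mat 1"
    using normalized_X_1 assms by blast+
  have "X \<rho>' 1 = P ** X \<rho> 1 ** matrix_inv P"
    unfolding P(2) by (rule map_rep_X) (use one_in in auto)
  then obtain t where t: "t \<noteq> 0" "P = diag_mat t" using centralizer_A_1[OF P(1)] X1 by metis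
  then have r': "\<rho>' = map_rep (conj_diag t) \<rho>" using P(2) by (simp add: conj_diag_def[abs_def])
  have "normal \<rho>' a" unfolding r' by (rule conj_diag_properties(1)[OF assms(1) t(1)])
  then have "a' = a" using assms(2) F_set_inj[of a' a] by (auto simp: normalized_iff)
  with that t r' show thesis by blast
qed

lemma unique_classified:
  assumes "\<rho>\<^sub>0 \<in> reps"
  shows "\<exists>!\<rho>. conjugate_reps M \<rho>\<^sub>0 \<rho> \<and> (\<exists>a. classified \<rho> a)"
proof -
  obtain P where P: "det P = 1" "P ** X \<rho>\<^sub>0 1 ** matrix_inv P = A_mat 1"
    using conj_to_A_1[OF X_SL0[OF assms, of 1]] one_in by auto
  let ?\<rho> = "map_rep (\<lambda>N. P ** N ** matrix_inv P) \<rho>\<^sub>0"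
  have rep: "?\<rho> \<in> reps" by (rule map_rep_reps[OF isometry_conj[OF P(1)] assms])
  have conj: "conjugate_reps M \<rho>\<^sub>0 ?\<rho>" unfolding conjugate_reps_iff[OF rep] using P(1) by blast
  have X1: "X ?\<rho> 1 = A_mat 1" using map_rep_X[of 1 _ \<rho>\<^sub>0] P(2) by simp
  obtain a where "a \<in> F_set" "a \<noteq> 0" "bil (X ?\<rho> 1) (Z ?\<rho> 1) = a + inverse a"
    using F_set_representative by blast
  then have n: "normal ?\<rho> a" using rep X1 by (simp add: normalized_iff del: One_nat_def)
  obtain t where t: "t \<noteq> 0" "normal_form (map_rep (conj_diag t) ?\<rho>) a" using normal_form_exists[OF n] .
  show ?thesis
  proof (rule ex1I[of _ "map_rep (conj_diag t) ?\<rho>"])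
    show "conjugate_reps M \<rho>\<^sub>0 (map_rep (conj_diag t) ?\<rho>) \<and> (\<exists>a. classified (map_rep (conj_diag t) ?\<rho>) a)"
      using conjugate_reps_trans[OF conj conj_diag_properties(6)[OF n t(1)]] normal_form_classified[OF t(2)] by blast
    fix \<sigma> assume \<sigma>: "conjugate_reps M \<rho>\<^sub>0 \<sigma> \<and> (\<exists>a. classified \<sigma> a)"
    then obtain b where b: "normal_form \<sigma> b" using classified_normal_form by blast
    have c: "conjugate_reps M (map_rep (conj_diag t) ?\<rho>) \<sigma>"
      using conjugate_reps_trans[OF conjugate_reps_sym[OF conjugate_reps_trans[OF conj conj_diag_properties(6)[OF n t(1)]]]] \<sigma>
      by blast
    have n': "normal (map_rep (conj_diag t) ?\<rho>) a" "normal \<sigma> b"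
      using t(2) b by (auto simp: normal_form_def)
    obtain u where "u \<noteq> 0" "\<sigma> = map_rep (conj_diag u) (map_rep (conj_diag t) ?\<rho>)" "b = a"
      using conjugate_normalized[OF n' c] .
    then show "\<sigma> = map_rep (conj_diag t) ?\<rho>"
      using normal_form_unique_conj_diag[OF t(2)] b by blast
  qed
qed

end

theorem theorem3p2:
  fixes r :: nat and ks :: "nat \<Rightarrow> int list"
  assumes "1 \<le> r"
    and "\<forall>l\<in>{1..r}. admissible (ks l)"
  shows "\<forall>\<rho>\<^sub>0 \<in> montesinos_reps r ks.
    \<exists>!\<rho>. conjugate_reps (montesinos_tangle r ks) \<rho>\<^sub>0 \<rho> \<and>
      (\<exists>a. normalized r ks \<rho> a \<and>
        (mont_abelian r ks \<rho> \<longrightarrow>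
           a \<in> {1, -1} \<and> determined_by_unique (abelian_code r ks a) \<rho>) \<and>
        (mont_reducible r ks \<rho> \<and> \<not> mont_abelian r ks \<rho> \<longrightarrow>
           mu r ks = 0 \<and> a \<in> {1, -1} \<and>
           (\<exists>!s. reducible_code r ks a \<rho> s) \<and>
           (\<forall>s. reducible_code r ks a \<rho> s \<longrightarrow>
              mont_Y r ks \<rho> 1 \<in> {S_mat (s 1), S'_mat (s 1)} \<and>
              (\<forall>Y \<in> {S_mat (s 1), S'_mat (s 1)}.
                 \<exists>!\<rho>'. reducible_code r ks a \<rho>' s \<and> mont_Y r ks \<rho>' 1 = Y))) \<and>
        (\<not> mont_reducible r ks \<rho> \<and> a \<in> {1, -1} \<longrightarrow>
           determined_by_unique (irreducible_code r ks a) \<rho>) \<and>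
        (mu r ks = 0 \<and> \<not> mont_reducible r ks \<rho> \<and> a \<notin> {1, -1} \<longrightarrow>
           determined_by_unique (irreducible_code_mu_zero r ks a) \<rho>) \<and>
        (mu r ks \<noteq> 0 \<and> \<not> mont_reducible r ks \<rho> \<and> a \<notin> {1, -1} \<longrightarrow>
           norm a = 1 \<and> determined_by_unique (irreducible_code_mu_nonzero r ks) \<rho>))"
proof -
  interpret montesinos r ks using assms by unfold_locales
  show ?thesis by (intro ballI) (rule unique_classified[unfolded classified_def])
qed

end
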